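(* Let $T$ be a forward expansive correspondence on a compact metric space $X$. For every $\nu\in\mathcal{M}(\Omega_T,\sigma)$ there exist $Q\in\mathcal{K}(X;T)$ and $\mu\in\mathcal{M}(X,Q)$ such that $$(p_2)_*\nu=\gamma_{\mu,Q}\qquad\text{and}\qquad h_\nu(\sigma)\le h_\mu(Q).$$ Conversely, every pair $(\mu,Q)$ with $Q\in\mathcal{K}(X;T)$ and $\mu\in\mathcal{M}(X,Q)$ induces a shift-invariant Markov measure $\nu_{\mu,Q}$ on $\Omega_T$ (the law of the Markov process with initial law $\mu$ and transition kernel $Q$) satisfying $$(p_2)_*\nu_{\mu,Q}=\gamma_{\mu,Q},\qquad h_{\nu_{\mu,Q}}(\sigma)=h_\mu(Q).$$
   Context: For a compact metric space $Y$, $\mathcal{M}(Y)$ is the set of Borel probability measures on $Y$. For $S:Y\to Y$ continuous, $\mathcal{M}(Y,S)$ is the set of $S$-invariant elements of $\mathcal{M}(Y)$ and $h_\nu(S)$ is Kolmogorov--Sinai entropy. Logarithms are natural. Let $(X,d)$ be a compact metric space. A correspondence $T$ on $X$ assigns to each $x\in X$ a nonempty closed set $T(x)\subset X$ such that $\Gamma_T=\{(x,y)\in X^2:y\in T(x)\}$ is closed in $X^2$. The orbit space is $\Omega_T=\{(x_j)_{j\ge0}:x_{j+1}\in T(x_j)\ \forall j\ge 0\}$ with the product topology, shift $\sigma((x_j)_{j\geq 0})=(x_{j+1})_{j\geq 0}$, and projection $p_2:\Omega_T\to\Gamma_T$, $p_2((x_j)_{j\geq 0})=(x_0,x_1)$.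 $T$ is forward expansive if there is $\varepsilon_0>0$ such that any two distinct $\boldsymbol{x},\boldsymbol{y}\in\Omega_T$ satisfy $d(x_j,y_j)>\varepsilon_0$ for some $j\ge0$. $\mathcal{K}(X;T)$ is the set of Borel transition probability kernels $Q$ on $X$ (each $Q_x$ is a Borel probability measure, $x\mapsto Q_x(A)$ is Borel for every Borel $A$) with $\operatorname{supp}Q_x\subseteq T(x)$ for every $x$. $\mathcal{M}(X,Q)=\{\mu\in\mathcal{M}(X):\mu Q=\mu\}$, where $(\mu Q)(A)=\int_XQ_x(A)\,d\mu(x)$. $\gamma_{\mu,Q}\in\mathcal{M}(\Gamma_T)$ is given by $\gamma_{\mu,Q}(dx,dy)=\mu(dx)Q_x(dy)$. Kernel entropy. Let $\mu Q^{[n-1]}$ be the law on $X^n$ of $(x_0,\dots,x_{n-1})$ for the Markov process with initial law $\mu$ and kernel $Q$. For a finite Borel partition $\mathcal{A}$ of $X$ with $n$-fold product partition $\mathcal{A}^{\times n}$, $h_\mu(Q,\mathcal{A})=\lim_{n}\frac1nH_{\mu Q^{[n-1]}}(\mathcal{A}^{\times n})$, where $H_\lambda(\mathcal{B})=-\sum_{B\in\mathcal{B}}\lambda(B)\log\lambda(B)$, and $h_\mu(Q)=\sup_{\mathcal{A}}h_\mu(Q,\mathcal{A})$ over finite Borel partitions. *)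

theory Defs
  imports "HOL-Probability.Probability"
begin

section \<open>Measures on compact metric spaces\<close>

text \<open>
  Spaces are carrier sets: a compact metric space is a set \<open>X\<close> with \<open>compact X\<close> in an arbitrary type
  of class \<open>metric_space\<close>, with metric \<open>dist\<close>. Taking \<open>X = UNIV\<close> gives compact types. Sequence
  spaces live in \<open>nat \<Rightarrow> 'a\<close>, whose topology is the product topology.
\<close>

abbreviation borel_on :: "'b::topological_space set \<Rightarrow> 'b measure" where
  "borel_on Y \<equiv> restrict_space borel Y"

definition borel_probs :: "'b::topological_space set \<Rightarrow> 'b measure set" where
  "borel_probs Y = {\<nu>. sets \<nu> = sets (borel_on Y) \<and> prob_space \<nu>}"

definition invariant_probs :: "'b::topological_space set \<Rightarrow> ('b \<Rightarrow> 'b) \<Rightarrow> 'b measure set" where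
  "invariant_probs Y S = {\<nu> \<in> borel_probs Y. distr \<nu> (borel_on Y) S = \<nu>}"

definition measure_support :: "'b::topological_space measure \<Rightarrow> 'b set" where
  "measure_support M =
     {x \<in> space M. \<forall>U. openin (top_of_set (space M)) U \<and> x \<in> U \<longrightarrow> 0 < emeasure M U}"


section \<open>Entropy of partitions and Kolmogorov--Sinai entropy\<close>

definition finite_partitions :: "'b measure \<Rightarrow> 'b set set set" where
  "finite_partitions M = {P. finite P \<and> P \<subseteq> sets M \<and> partition_on (space M) P}"

text \<open>Natural logarithm; \<open>0 * ln 0 = 0\<close> holds in HOL, so null cells contribute nothing.\<close>

definition partition_entropy :: "'b measure \<Rightarrow> 'b set set \<Rightarrow> real" where
  "partition_entropy M P = - (\<Sum>B\<in>P. measure M B * ln (measure M B))"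

text \<open>The join of \<open>P, S\<^sup>-\<^sup>1 P, \<dots>, S\<^sup>-\<^sup>(\<^sup>n\<^sup>-\<^sup>1\<^sup>) P\<close>.\<close>

definition iterated_join :: "'b measure \<Rightarrow> ('b \<Rightarrow> 'b) \<Rightarrow> 'b set set \<Rightarrow> nat \<Rightarrow> 'b set set" where
  "iterated_join M S P n =
     {space M \<inter> (\<Inter>i\<in>{0..<n}. (S ^^ i) -` B i) | B. B \<in> {0..<n} \<rightarrow> P} - {{}}"

text \<open>
  For \<open>S\<close>-invariant \<open>M\<close> the sequence converges (subadditivity), so that \<open>lim\<close> is its limit. The
  irrelevant term at \<open>n = 0\<close> is a division by zero. The supremum over partitions may be infinite,
  hence is taken in the extended reals.
\<close>

definition ks_entropy_partition :: "'b measure \<Rightarrow> ('b \<Rightarrow> 'b) \<Rightarrow> 'b set set \<Rightarrow> real" where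
  "ks_entropy_partition M S P = lim (\<lambda>n. partition_entropy M (iterated_join M S P n) / real n)"

definition ks_entropy :: "'b measure \<Rightarrow> ('b \<Rightarrow> 'b) \<Rightarrow> ereal" where
  "ks_entropy M S = (SUP P\<in>finite_partitions M. ereal (ks_entropy_partition M S P))"


section \<open>Correspondences\<close>

text \<open>Only the values of \<open>T\<close> on \<open>X\<close> matter.\<close>

definition corr_graph :: "'a set \<Rightarrow> ('a \<Rightarrow> 'a set) \<Rightarrow> ('a \<times> 'a) set" where
  "corr_graph X T = {(x, y). x \<in> X \<and> y \<in> X \<and> y \<in> T x}"

definition correspondence :: "'a::metric_space set \<Rightarrow> ('a \<Rightarrow> 'a set) \<Rightarrow> bool" where
  "correspondence X T \<longleftrightarrow>
     (\<forall>x\<in>X. T x \<noteq> {} \<and> closedin (top_of_set X) (T x)) \<and>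
     closedin (top_of_set (X \<times> X)) (corr_graph X T)"

definition orbit_space :: "'a set \<Rightarrow> ('a \<Rightarrow> 'a set) \<Rightarrow> (nat \<Rightarrow> 'a) set" where
  "orbit_space X T = {x. (\<forall>j. x j \<in> X) \<and> (\<forall>j. x (Suc j) \<in> T (x j))}"

definition orbit_shift :: "(nat \<Rightarrow> 'a) \<Rightarrow> nat \<Rightarrow> 'a" where
  "orbit_shift x = (\<lambda>j. x (Suc j))"

definition p2 :: "(nat \<Rightarrow> 'a) \<Rightarrow> 'a \<times> 'a" where
  "p2 x = (x 0, x 1)"

definition forward_expansive :: "'a::metric_space set \<Rightarrow> ('a \<Rightarrow> 'a set) \<Rightarrow> bool" where
  "forward_expansive X T \<longleftrightarrow>
     (\<exists>\<epsilon>>0. \<forall>x\<in>orbit_space X T. \<forall>y\<in>orbit_space X T.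
        x \<noteq> y \<longrightarrow> (\<exists>j. dist (x j) (y j) > \<epsilon>))"


section \<open>Transition kernels\<close>

text \<open>
  Measurability into \<open>prob_algebra\<close> means that each \<open>Q x\<close> is a Borel probability measure on \<open>X\<close> and
  that \<open>x \<mapsto> Q x A\<close> is Borel for every Borel \<open>A\<close>.
\<close>

definition kernels :: "'a::metric_space set \<Rightarrow> ('a \<Rightarrow> 'a set) \<Rightarrow> ('a \<Rightarrow> 'a measure) set" where
  "kernels X T = {Q \<in> borel_on X \<rightarrow>\<^sub>M prob_algebra (borel_on X). \<forall>x\<in>X. measure_support (Q x) \<subseteq> T x}"

definition stationary_probs :: "'a::metric_space set \<Rightarrow> ('a \<Rightarrow> 'a measure) \<Rightarrow> 'a measure set" where
  "stationary_probs X Q = {\<mu> \<in> borel_probs X. \<mu> \<bind> Q = \<mu>}"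

text \<open>The measure \<open>\<mu>(dx) Q\<^sub>x(dy)\<close> on \<open>X \<times> X\<close>, regarded as a measure on the graph of \<open>T\<close>.\<close>

definition graph_measure ::
  "'a::metric_space set \<Rightarrow> ('a \<Rightarrow> 'a set) \<Rightarrow> 'a measure \<Rightarrow> ('a \<Rightarrow> 'a measure) \<Rightarrow> ('a \<times> 'a) measure" where
  "graph_measure X T \<mu> Q =
     restrict_space (\<mu> \<bind> (\<lambda>x. distr (Q x) (borel_on (X \<times> X)) (Pair x))) (corr_graph X T)"

text \<open>
  The law on \<open>X\<^sup>\<nat>\<close> of the Markov process with initial law \<open>\<mu>\<close> and kernel \<open>Q\<close>, by the
  Ionescu-Tulcea construction: \<open>markov_step \<mu> Q n \<omega>\<close> is the conditional law of the \<open>n\<close>-th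
  coordinate given the coordinates \<open>\<omega>\<close> before it.
\<close>

definition markov_step ::
  "'a measure \<Rightarrow> ('a \<Rightarrow> 'a measure) \<Rightarrow> nat \<Rightarrow> (nat \<Rightarrow> 'a) \<Rightarrow> 'a measure" where
  "markov_step \<mu> Q n \<omega> = (case n of 0 \<Rightarrow> \<mu> | Suc m \<Rightarrow> Q (\<omega> m))"

definition markov_law ::
  "'a::metric_space set \<Rightarrow> 'a measure \<Rightarrow> ('a \<Rightarrow> 'a measure) \<Rightarrow> (nat \<Rightarrow> 'a) measure" where
  "markov_law X \<mu> Q =
     projective_family.lim UNIV (Ionescu_Tulcea.CI (markov_step \<mu> Q) (\<lambda>_. borel_on X)) (\<lambda>_. borel_on X)"

definition markov_measure ::
  "'a::metric_space set \<Rightarrow> ('a \<Rightarrow> 'a set) \<Rightarrow> 'a measure \<Rightarrow> ('a \<Rightarrow> 'a measure) \<Rightarrow> (nat \<Rightarrow> 'a) measure" where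
  "markov_measure X T \<mu> Q = restrict_space (markov_law X \<mu> Q) (orbit_space X T)"

text \<open>The measure written \<open>\<mu> Q\<^sup>[\<^sup>n\<^sup>-\<^sup>1\<^sup>]\<close> in the literature: the law of the first \<open>n\<close> coordinates.\<close>

definition path_law ::
  "'a::metric_space set \<Rightarrow> 'a measure \<Rightarrow> ('a \<Rightarrow> 'a measure) \<Rightarrow> nat \<Rightarrow> (nat \<Rightarrow> 'a) measure" where
  "path_law X \<mu> Q n =
     distr (markov_law X \<mu> Q) (PiM {0..<n} (\<lambda>_. borel_on X)) (\<lambda>\<omega>. restrict \<omega> {0..<n})"

lemma Ionescu_Tulcea_markov:
  assumes "\<mu> \<in> borel_probs X" and "Q \<in> kernels X T"
  shows "Ionescu_Tulcea (markov_step \<mu> Q) (\<lambda>_. borel_on X)"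
proof (rule Ionescu_Tulcea.intro)
  fix n
  have Q: "Q \<in> borel_on X \<rightarrow>\<^sub>M prob_algebra (borel_on X)"
    using assms(2) by (simp add: kernels_def)
  have \<mu>: "\<mu> \<in> space (prob_algebra (borel_on X))"
    using assms(1) by (simp add: borel_probs_def space_prob_algebra)
  have step: "markov_step \<mu> Q n \<in> PiM {0..<n} (\<lambda>_. borel_on X) \<rightarrow>\<^sub>M prob_algebra (borel_on X)"
  proof (cases n)
    case 0
    then show ?thesis
      using \<mu> by (simp add: markov_step_def[abs_def])
  next
    case (Suc m)
    have "(\<lambda>\<omega>. \<omega> m) \<in> PiM {0..<n} (\<lambda>_. borel_on X) \<rightarrow>\<^sub>M borel_on X"
      using Suc by (intro measurable_component_singleton) auto
    from measurable_compose[OF this Q] show ?thesis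
      using Suc by (simp add: markov_step_def[abs_def])
  qed
  show "markov_step \<mu> Q n \<in> PiM {0..<n} (\<lambda>_. borel_on X) \<rightarrow>\<^sub>M subprob_algebra (borel_on X)"
    by (rule measurable_prob_algebraD[OF step])
  show "prob_space (markov_step \<mu> Q n \<omega>)" if "\<omega> \<in> space (PiM {0..<n} (\<lambda>_. borel_on X))" for \<omega>
    using measurable_space[OF step that] by (simp add: space_prob_algebra)
qed

lemma path_law_eq_C:
  assumes "\<mu> \<in> borel_probs X" and "Q \<in> kernels X T"
  shows "path_law X \<mu> Q n =
    Ionescu_Tulcea.C (markov_step \<mu> Q) (\<lambda>_. borel_on X) 0 n (\<lambda>_. undefined)"
proof -
  interpret IT: Ionescu_Tulcea "markov_step \<mu> Q" "\<lambda>_. borel_on X"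
    by (rule Ionescu_Tulcea_markov[OF assms])
  have "IT.up_to {0..<n} \<le> n"
    by (simp add: IT.up_to_iff)
  moreover have "n \<le> IT.up_to {0..<n}"
    using IT.up_to[of "{0..<n}"] by (cases n) auto
  ultimately have up: "IT.up_to {0..<n} = n" by simp
  have "path_law X \<mu> Q n = IT.CI {0..<n}"
    by (simp add: path_law_def markov_law_def IT.distr_lim)
  also have "\<dots> = IT.C 0 n (\<lambda>_. undefined)"
    unfolding IT.CI_def up using IT.distr_C[of n n "\<lambda>_. undefined" 0]
    by (simp add: space_PiM)
  finally show ?thesis .
qed

lemma path_law_Suc:
  assumes "\<mu> \<in> borel_probs X" and "Q \<in> kernels X T"
  shows "path_law X \<mu> Q (Suc (Suc n)) =
    path_law X \<mu> Q (Suc n) \<bind>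
      (\<lambda>\<omega>. distr (Q (\<omega> n)) (PiM {0..<Suc (Suc n)} (\<lambda>_. borel_on X)) (fun_upd \<omega> (Suc n)))"
proof -
  interpret IT: Ionescu_Tulcea "markov_step \<mu> Q" "\<lambda>_. borel_on X"
    by (rule Ionescu_Tulcea_markov[OF assms])
  show ?thesis
    unfolding path_law_eq_C[OF assms] IT.C.simps(2)[of 0 "Suc n"]
    by (simp add: IT.eP_def[abs_def] markov_step_def)
qed


section \<open>Kernel entropy\<close>

definition product_partition :: "'a set set \<Rightarrow> nat \<Rightarrow> (nat \<Rightarrow> 'a) set set" where
  "product_partition P n = {PiE {0..<n} B | B. B \<in> {0..<n} \<rightarrow> P}"

text \<open>For stationary \<open>\<mu>\<close> the sequence converges, so that \<open>lim\<close> is its limit.\<close>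

definition kernel_entropy_partition ::
  "'a::metric_space set \<Rightarrow> 'a measure \<Rightarrow> ('a \<Rightarrow> 'a measure) \<Rightarrow> 'a set set \<Rightarrow> real" where
  "kernel_entropy_partition X \<mu> Q P =
     lim (\<lambda>n. partition_entropy (path_law X \<mu> Q n) (product_partition P n) / real n)"

definition kernel_entropy ::
  "'a::metric_space set \<Rightarrow> 'a measure \<Rightarrow> ('a \<Rightarrow> 'a measure) \<Rightarrow> ereal" where
  "kernel_entropy X \<mu> Q =
     (SUP P\<in>finite_partitions (borel_on X). ereal (kernel_entropy_partition X \<mu> Q P))"

end

theory Submission
  imports Defs "HOL-Real_Asymp.Real_Asymp"
begin

text \<open>
  Let \<open>f\<close> label the cells of a finite Borel partition of \<open>X\<close> whose cells have diameter at most the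
  expansivity constant, and for an orbit \<open>x 0, x 1, \<dots>\<close> consider the labels \<open>f (x j)\<close>. By compactness
  and forward expansivity these labels generate the Borel sets of the orbit space, so by the
  Kolmogorov--Sinai theorem every invariant \<open>\<nu>\<close> has entropy
  \<open>lim\<^sub>n H(f (x 0) | f (x 1), \<dots>, f (x n))\<close> (\<open>ks_entropy_eq_entropy_rate\<close>).

  The conditioning is on the future: the present is in general not determined by the
  labels of the past, but the point \<open>x 1\<close> is determined by the labels from time \<open>1\<close> on. Hence
  the entropy of any invariant \<open>\<nu>\<close> is at most \<open>H(f (x 0) | x 1)\<close>, a number that depends only on the
  law of \<open>(x 0, x 1)\<close> (\<open>entropy_rate_le_cond_entropy_coordinate\<close>, \<open>ex_cond_entropy_le_point\<close>). For a
  Markov measure, \<open>x 0\<close> and the coordinates after \<open>x 1\<close> are conditionally independent given \<open>x 1\<close>,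
  and concavity of \<open>t \<mapsto> - t ln t\<close> gives \<open>H(f (x 0) | f (x 1), \<dots>, f (x n)) \<ge> H(f (x 0) | x 1)\<close>
  (\<open>point_cond_entropy_le_entropy_rate\<close>). So the Markov measure has the largest entropy among the
  invariant measures with the same law of \<open>(x 0, x 1)\<close>.

  For a Markov measure the entropy rate of the labels of any finite Borel partition of \<open>X\<close> is the
  kernel entropy of that partition, by the definition of the latter
  (\<open>kernel_entropy_partition_fibres\<close>). Taking suprema over partitions of \<open>X\<close>, kernel entropy is at
  most the entropy of the Markov measure, and the generating partition above gives equality.

  It remains to realise the law of \<open>(x 0, x 1)\<close> under a given \<open>\<nu>\<close> by a kernel supported
  in \<open>T\<close>. A disintegration with respect to \<open>x 0\<close> (\<open>disintegration_compact\<close>) is supported in \<open>T x\<close> for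
  almost every \<open>x\<close>, and on the exceptional null set it is replaced by a Borel selection of \<open>T\<close>
  (\<open>correspondence_selection\<close>).
\<close>

section \<open>Borel sets of compact metric spaces\<close>

lemma compact_imp_separable:
  fixes Y :: "'b::metric_space set"
  assumes "compact Y"
  obtains D where "countable D" "D \<subseteq> Y" "\<And>y e. y \<in> Y \<Longrightarrow> 0 < e \<Longrightarrow> \<exists>d\<in>D. dist d y < e"
proof -
  have "\<exists>k. finite k \<and> k \<subseteq> Y \<and> Y \<subseteq> (\<Union>x\<in>k. ball x (1 / real (Suc n)))" for n
    using seq_compact_imp_totally_bounded[OF compact_imp_seq_compact[OF assms]] by simp
  then obtain k where k: "\<And>n. finite (k n)" "\<And>n. k n \<subseteq> Y"
    "\<And>n. Y \<subseteq> (\<Union>x\<in>k n. ball x (1 / real (Suc n)))" by metis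
  show ?thesis
  proof
    show "countable (\<Union>n. k n)" using k(1) by (simp add: countable_finite)
    show "(\<Union>n. k n) \<subseteq> Y" using k(2) by auto
    fix y e assume "y \<in> Y" "(0::real) < e"
    then obtain n where n: "1 / real (Suc n) < e" using nat_approx_posE by metis
    obtain x where "x \<in> k n" "dist x y < 1 / real (Suc n)"
      using k(3)[of n] \<open>y \<in> Y\<close> by auto
    then show "\<exists>d\<in>\<Union>n. k n. dist d y < e" using n by force
  qed
qed

lemma dense_rational_ball:
  fixes D :: "'b::metric_space set"
  assumes dense: "\<And>e. 0 < e \<Longrightarrow> \<exists>d\<in>D. dist d y < e" and V: "open V" "y \<in> V"
  obtains d q where "d \<in> D" "q \<in> \<rat>" "y \<in> ball d q" "ball d q \<subseteq> V"
proof -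
  obtain e where e: "0 < e" "ball y e \<subseteq> V" using V open_contains_ball by blast
  obtain d where d: "d \<in> D" "dist d y < e / 3" using dense[of "e / 3"] e by auto
  obtain q where q: "q \<in> \<rat>" "e / 3 < q" "q < e / 2"
    using Rats_dense_in_real[of "e / 3" "e / 2"] e by auto
  have "ball d q \<subseteq> ball y e"
  proof
    fix z assume "z \<in> ball d q"
    then have "dist d z < e / 2" using q by auto
    moreover have "dist y z \<le> dist d y + dist d z" by (metis dist_triangle2 dist_commute)
    ultimately show "z \<in> ball y e" using d e by auto
  qed
  with d q e show ?thesis by (intro that[of d q]) auto
qed

lemma sets_borel_on_le:
  fixes Y :: "'b::topological_space set"
  assumes sp: "space M = Y" and op: "\<And>U. open U \<Longrightarrow> U \<inter> Y \<in> sets M"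
  shows "sets (borel_on Y) \<subseteq> sets M"
proof
  have "(\<lambda>x. x) \<in> borel_measurable M"
    by (rule borel_measurableI) (use op sp in auto)
  then have id: "(\<lambda>x. x) \<in> M \<rightarrow>\<^sub>M borel_on Y"
    by (intro measurable_restrict_space2) (auto simp: sp)
  fix A assume A: "A \<in> sets (borel_on Y)"
  then have "A \<subseteq> Y" by (auto simp: sets_restrict_space)
  with measurable_sets[OF id A] show "A \<in> sets M" by (simp add: sp Int_absorb2)
qed

text \<open>A \<open>\<sigma>\<close>-algebra on a compact metric space that measures the distance to each point
  contains all Borel sets, because a relatively open set is a countable union of balls. For
  products and sequence spaces this compares the Borel sets with the product
  \<open>\<sigma>\<close>-algebra; the ambient type need not be second countable.\<close>

lemma sets_borel_on_le_of_dist: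
  fixes Y :: "'b::metric_space set"
  assumes Y: "compact Y" and sp: "space M = Y"
    and dist: "\<And>y. y \<in> Y \<Longrightarrow> (\<lambda>z. dist y z) \<in> borel_measurable M"
  shows "sets (borel_on Y) \<subseteq> sets M"
proof (rule sets_borel_on_le[OF sp])
  obtain D where D: "countable D" "D \<subseteq> Y" "\<And>y e. y \<in> Y \<Longrightarrow> 0 < e \<Longrightarrow> \<exists>d\<in>D. dist d y < e"
    using compact_imp_separable[OF Y] by metis
  fix U :: "'b set" assume U: "open U"
  define I where "I = {(d, q). d \<in> D \<and> q \<in> \<rat> \<and> ball d q \<inter> Y \<subseteq> U}"
  have "countable I"
    by (rule countable_subset[of _ "D \<times> \<rat>"]) (auto simp: I_def D(1) countable_rat)
  have "U \<inter> Y = (\<Union>(d, q)\<in>I. {z \<in> space M. dist d z < q})"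
  proof (intro set_eqI iffI)
    fix y assume y: "y \<in> U \<inter> Y"
    obtain d q where dq: "d \<in> D" "q \<in> \<rat>" "y \<in> ball d q" "ball d q \<subseteq> U"
      by (rule dense_rational_ball[of D y U]) (use D(3) y U in auto)
    then have "(d, q) \<in> I" by (auto simp: I_def)
    then show "y \<in> (\<Union>(d, q)\<in>I. {z \<in> space M. dist d z < q})"
      using y dq sp by (intro UN_I[of "(d, q)"]) auto
  qed (auto simp: I_def sp)
  also have "\<dots> \<in> sets M"
  proof (intro sets.countable_UN'' \<open>countable I\<close>)
    fix p assume "p \<in> I"
    then obtain d q where p: "p = (d, q)" "d \<in> Y" using D(2) by (auto simp: I_def)
    have [measurable]: "(\<lambda>z. dist d z) \<in> borel_measurable M" by (rule dist[OF p(2)])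
    show "(case p of (d, q) \<Rightarrow> {z \<in> space M. dist d z < q}) \<in> sets M"
      unfolding p by simp
  qed
  finally show "U \<inter> Y \<in> sets M" .
qed

lemma space_borel_on [simp]: "space (borel_on Y) = Y"
  by (simp add: space_restrict_space)

lemma carrier_in_sets_borel_on: "X \<in> sets (borel_on X)"
  using sets.top[of "borel_on X"] by simp

lemma borel_measurable_dist_borel_on:
  "(\<lambda>z. dist y z) \<in> borel_measurable (borel_on Y)"
  by (intro measurable_restrict_space1 borel_measurable_continuous_onI continuous_intros)

lemma closedin_imp_sets_borel_on: "closedin (top_of_set Y) A \<Longrightarrow> A \<in> sets (borel_on Y)"
  by (auto simp: closedin_closed sets_restrict_space)

lemma openin_imp_sets_borel_on: "openin (top_of_set Y) A \<Longrightarrow> A \<in> sets (borel_on Y)"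
  by (auto simp: openin_open sets_restrict_space)

lemma measurable_borel_on_continuous:
  assumes "continuous_on Y f" "\<And>x. x \<in> Y \<Longrightarrow> f x \<in> Z"
  shows "f \<in> borel_on Y \<rightarrow>\<^sub>M borel_on Z"
  by (intro measurable_restrict_space2 borel_measurable_continuous_on_restrict) (use assms in auto)

lemma sets_borel_on_Times:
  fixes X :: "'a::metric_space set" and Y :: "'b::metric_space set"
  assumes "compact X" "compact Y"
  shows "sets (borel_on (X \<times> Y)) = sets (borel_on X \<Otimes>\<^sub>M borel_on Y)"
proof
  let ?P = "borel_on X \<Otimes>\<^sub>M borel_on Y"
  show "sets (borel_on (X \<times> Y)) \<subseteq> sets ?P"
  proof (rule sets_borel_on_le_of_dist)
    fix p :: "'a \<times> 'b"
    have [measurable]: "(\<lambda>z. dist (fst p) z) \<in> borel_measurable (borel_on X)"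
      "(\<lambda>z. dist (snd p) z) \<in> borel_measurable (borel_on Y)"
      by (rule borel_measurable_dist_borel_on)+
    show "(\<lambda>z. dist p z) \<in> borel_measurable ?P"
      unfolding dist_prod_def by measurable
  qed (use assms in \<open>auto simp: space_pair_measure intro: compact_Times\<close>)
  have "fst \<in> borel_on (X \<times> Y) \<rightarrow>\<^sub>M borel_on X" "snd \<in> borel_on (X \<times> Y) \<rightarrow>\<^sub>M borel_on Y"
    by (auto intro!: measurable_borel_on_continuous continuous_intros)
  then have "(\<lambda>p. (fst p, snd p)) \<in> borel_on (X \<times> Y) \<rightarrow>\<^sub>M ?P" by (rule measurable_Pair)
  then show "sets ?P \<subseteq> sets (borel_on (X \<times> Y))"
    using measurable_sets[of _ "borel_on (X \<times> Y)" ?P] sets.sets_into_space[of _ ?P]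
    by (fastforce simp: space_pair_measure vimage_def Int_absorb2)
qed

lemma compact_sequences:
  fixes X :: "'a::metric_space set"
  assumes "compact X" shows "compact (UNIV \<rightarrow>\<^sub>E X :: (nat \<Rightarrow> 'a) set)"
proof -
  have "compactin (product_topology (\<lambda>_. euclidean) UNIV) (UNIV \<rightarrow>\<^sub>E X :: (nat \<Rightarrow> 'a) set)"
    by (subst compactin_PiE) (use assms in auto)
  then show ?thesis by (simp add: euclidean_product_topology)
qed

lemma sets_borel_on_sequences:
  fixes X :: "'a::metric_space set"
  assumes X: "compact X"
  shows "sets (borel_on (UNIV \<rightarrow>\<^sub>E X)) = sets (PiM UNIV (\<lambda>_::nat. borel_on X))"
proof
  let ?P = "PiM UNIV (\<lambda>_::nat. borel_on X)" and ?Y = "UNIV \<rightarrow>\<^sub>E X :: (nat \<Rightarrow> 'a) set"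
  show "sets (borel_on ?Y) \<subseteq> sets ?P"
  proof (rule sets_borel_on_le_of_dist)
    fix y :: "nat \<Rightarrow> 'a"
    have [measurable]: "(\<lambda>z. dist (y (from_nat n)) (z (from_nat n))) \<in> borel_measurable ?P" for n
      by (rule measurable_compose[OF _ borel_measurable_dist_borel_on[of _ X]])
         (rule measurable_component_singleton[OF UNIV_I])
    show "(\<lambda>z. dist y z) \<in> borel_measurable ?P"
      unfolding dist_fun_def by measurable
  qed (use compact_sequences[OF X] in \<open>auto simp: space_PiM\<close>)
  have "(\<lambda>x. x i) \<in> borel_on ?Y \<rightarrow>\<^sub>M borel_on X" for i
    by (intro measurable_borel_on_continuous)
       (auto intro: continuous_on_subset[OF continuous_on_product_coordinates])
  then have "(\<lambda>x. \<lambda>i\<in>UNIV. x i) \<in> borel_on ?Y \<rightarrow>\<^sub>M ?P"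
    by (intro measurable_restrict) auto
  then have *: "(\<lambda>x. x) \<in> borel_on ?Y \<rightarrow>\<^sub>M ?P" by (simp add: restrict_UNIV)
  show "sets ?P \<subseteq> sets (borel_on ?Y)"
  proof
    fix A assume A: "A \<in> sets ?P"
    then have "A \<subseteq> ?Y" using sets.sets_into_space[OF A] by (simp add: space_PiM)
    with measurable_sets[OF * A] show "A \<in> sets (borel_on ?Y)" by (simp add: Int_absorb2)
  qed
qed

lemma orbit_space_subset: "orbit_space X T \<subseteq> UNIV \<rightarrow>\<^sub>E X"
  by (auto simp: orbit_space_def)

lemma correspondence_values:
  assumes "correspondence X T" "x \<in> X"
  shows closedin_correspondence: "closedin (top_of_set X) (T x)"
    and correspondence_subset: "T x \<subseteq> X" and correspondence_nonempty: "T x \<noteq> {}"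
    and sets_correspondence: "T x \<in> sets (borel_on X)"
  using assms by (auto simp: correspondence_def intro: closedin_imp_sets_borel_on dest: closedin_imp_subset)

lemma sets_corr_graph:
  "correspondence X T \<Longrightarrow> corr_graph X T \<in> sets (borel_on (X \<times> X))"
  by (intro closedin_imp_sets_borel_on) (simp add: correspondence_def)

lemma compact_corr_graph:
  assumes "compact X" "correspondence X T" shows "compact (corr_graph X T)"
  using assms closedin_compact[OF compact_Times[OF assms(1) assms(1)]]
  by (auto simp: correspondence_def)

lemma orbit_space_eq:
  "orbit_space X T = (UNIV \<rightarrow>\<^sub>E X) \<inter> (\<Inter>j. (\<lambda>x. (x j, x (Suc j))) -` corr_graph X T)"
  by (auto simp: orbit_space_def corr_graph_def)

lemma compact_orbit_space:
  fixes X :: "'a::metric_space set"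
  assumes "compact X" "correspondence X T" shows "compact (orbit_space X T)"
  unfolding orbit_space_eq
  using compact_imp_closed[OF compact_corr_graph[OF assms]]
  by (intro compact_Int_closed compact_sequences assms closed_INT ballI closed_vimage)
     (auto intro!: continuous_intros continuous_on_product_coordinates)

lemma sets_orbit_space:
  fixes X :: "'a::metric_space set"
  assumes "compact X" "correspondence X T"
  shows "orbit_space X T \<in> sets (PiM UNIV (\<lambda>_::nat. borel_on X))"
    and "sets (borel_on (orbit_space X T)) = sets (restrict_space (PiM UNIV (\<lambda>_. borel_on X)) (orbit_space X T))"
proof -
  have "closed (orbit_space X T)" by (rule compact_imp_closed[OF compact_orbit_space[OF assms]])
  then have "orbit_space X T \<in> sets (borel_on (UNIV \<rightarrow>\<^sub>E X))"
    using orbit_space_subset[of X T] by (intro closedin_imp_sets_borel_on) (auto simp: closedin_closed)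
  then show "orbit_space X T \<in> sets (PiM UNIV (\<lambda>_. borel_on X))"
    by (simp only: sets_borel_on_sequences[OF assms(1)])
  show "sets (borel_on (orbit_space X T)) = sets (restrict_space (PiM UNIV (\<lambda>_. borel_on X)) (orbit_space X T))"
    using orbit_space_subset[of X T]
    by (simp add: sets_restrict_space sets_borel_on_sequences[OF assms(1), symmetric] image_comp comp_def
        Int_assoc[symmetric] Int_absorb2)
qed

section \<open>Compact metric spaces as Borel retracts of the real line\<close>

text \<open>The number with digits \<open>b\<close> in base 4. Since only the digits 0 and 1 occur, the expansion
  is unique and the digits are Borel functions of the number.\<close>

definition base4 :: "(nat \<Rightarrow> bool) \<Rightarrow> real" where
  "base4 b = (\<Sum>j. of_bool (b j) * (1 / 4) ^ Suc j)"

lemma summable_base4: "summable (\<lambda>j. of_bool (b j) * (1 / 4 :: real) ^ Suc j)"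
  by (rule summable_comparison_test'[of "\<lambda>j. (1 / 4) ^ j"]) (auto simp: summable_geometric_iff)

lemma base4_nonneg: "0 \<le> base4 b"
  unfolding base4_def by (rule suminf_nonneg[OF summable_base4]) auto

lemma base4_less_1: "base4 b < 1"
proof -
  have "summable (\<lambda>j. (1 / 4 :: real) ^ Suc j)"
    using summable_base4[of "\<lambda>_. True"] by simp
  then have "base4 b \<le> (\<Sum>j. (1 / 4 :: real) ^ Suc j)"
    unfolding base4_def by (intro suminf_le summable_base4) auto
  also have "\<dots> = 1 / 4 * (\<Sum>j. (1 / 4 :: real) ^ j)"
    by (subst suminf_mult[symmetric]) (auto simp: summable_geometric_iff)
  also have "\<dots> < 1"
    by (subst suminf_geometric) auto
  finally show ?thesis .
qed

lemma base4_shift: "4 * base4 b = of_bool (b 0) + base4 (\<lambda>j. b (Suc j))"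
proof -
  have "base4 (\<lambda>j. b (Suc j)) = 4 * (\<Sum>j. of_bool (b (Suc j)) * (1 / 4) ^ Suc (Suc j))"
    unfolding base4_def
    by (subst suminf_mult[symmetric])
       (use summable_base4[of b, THEN summable_Suc_iff[THEN iffD2]] in auto)
  also have "(\<Sum>j. of_bool (b (Suc j)) * (1 / 4) ^ Suc (Suc j)) = base4 b - of_bool (b 0) / 4"
    using suminf_split_head[OF summable_base4[of b]] by (simp add: base4_def)
  finally show ?thesis by simp
qed

lemma base4_digit: "1 \<le> 4 * frac (4 ^ k * base4 b) \<longleftrightarrow> b k"
proof -
  have "\<exists>m::int. 4 ^ k * base4 b = base4 (\<lambda>j. b (k + j)) + of_int m"
  proof (induction k)
    case (Suc k)
    then obtain m where "4 ^ k * base4 b = base4 (\<lambda>j. b (k + j)) + of_int m" by blast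
    then have "4 ^ Suc k * base4 b = base4 (\<lambda>j. b (Suc k + j)) + of_int (4 * m + of_bool (b k))"
      using base4_shift[of "\<lambda>j. b (k + j)"] by simp
    then show ?case by blast
  qed (auto intro: exI[of _ 0])
  then obtain m :: int where "4 ^ k * base4 b = base4 (\<lambda>j. b (k + j)) + of_int m" by blast
  then have "frac (4 ^ k * base4 b) = base4 (\<lambda>j. b (k + j))"
    using base4_nonneg base4_less_1 by (simp add: frac_eq)
  moreover have "4 * base4 (\<lambda>j. b (k + j)) = of_bool (b k) + base4 (\<lambda>j. b (Suc k + j))"
    using base4_shift[of "\<lambda>j. b (k + j)"] by simp
  ultimately show ?thesis
    using base4_nonneg[of "\<lambda>j. b (Suc k + j)"] base4_less_1[of "\<lambda>j. b (Suc k + j)"] by auto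
qed

lemma compact_dense_sequence:
  fixes X :: "'a::metric_space set"
  assumes "compact X" "X \<noteq> {}"
  obtains d :: "nat \<Rightarrow> 'a" where "range d \<subseteq> X" "\<And>y e. y \<in> X \<Longrightarrow> 0 < e \<Longrightarrow> \<exists>i. dist (d i) y < e"
proof -
  obtain D where D: "countable D" "D \<subseteq> X" "\<And>y e. y \<in> X \<Longrightarrow> 0 < e \<Longrightarrow> \<exists>d\<in>D. dist d y < e"
    using compact_imp_separable[OF assms(1)] by metis
  have "D \<noteq> {}" using D(3)[of _ 1] assms(2) by fastforce
  then have r: "range (from_nat_into D) = D" using D(1) by (rule range_from_nat_into)
  show ?thesis
  proof
    show "range (from_nat_into D) \<subseteq> X" using r D(2) by simp
    show "\<exists>i. dist (from_nat_into D i) y < e" if "y \<in> X" "0 < e" for y e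
      using D(3)[OF that] r by (metis imageE)
  qed
qed

lemma LIMSEQ_dist_le_half_power:
  assumes "\<And>n. dist (a n) x \<le> (1 / 2) ^ n"
  shows "a \<longlonglongrightarrow> x"
proof (rule metric_LIMSEQ_I)
  fix e :: real assume "0 < e"
  then obtain N where N: "(1 / 2) ^ N < e" using real_arch_pow_inv[of e "1 / 2"] by auto
  have "dist (a n) x < e" if "n \<ge> N" for n
  proof -
    have "(1 / 2 :: real) ^ n \<le> (1 / 2) ^ N" using that by (intro power_decreasing) auto
    then show ?thesis using assms[of n] N by linarith
  qed
  then show "\<exists>no. \<forall>n\<ge>no. dist (a n) x < e" by blast
qed

text \<open>A point \<open>x\<close> is coded by the bits \<open>dist (d i) x < 2\<^sup>-\<^sup>n\<close> for a dense sequence \<open>d\<close>. The decoding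
  map \<open>g\<close> reads off approximating members of \<open>d\<close> and takes their limit. That \<open>g\<close> is defined on all
  of the line makes it unnecessary to know that the image of \<open>s\<close> is Borel.\<close>

lemma compact_Borel_retract_real:
  fixes X :: "'a::metric_space set"
  assumes X: "compact X" "X \<noteq> {}"
  obtains s :: "'a \<Rightarrow> real" and g :: "real \<Rightarrow> 'a"
  where "s \<in> borel_measurable (borel_on X)" "g \<in> borel \<rightarrow>\<^sub>M borel_on X"
    "\<And>x. x \<in> X \<Longrightarrow> g (s x) = x" "\<And>x. 0 \<le> s x \<and> s x < 1"
proof -
  obtain d :: "nat \<Rightarrow> 'a" where dX: "range d \<subseteq> X"
    and dense: "\<And>y e. y \<in> X \<Longrightarrow> 0 < e \<Longrightarrow> \<exists>i. dist (d i) y < e"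
    using compact_dense_sequence[OF X] by metis
  define near where "near x k = (case prod_decode k of (n, i) \<Rightarrow> dist (d i) x < (1 / 2) ^ n)" for x k
  define s where "s x = base4 (near x)" for x
  define digit where "digit y k \<longleftrightarrow> 1 \<le> 4 * frac (4 ^ k * y)" for y :: real and k
  define I where "I n y = (LEAST i. digit y (prod_encode (n, i)))" for n y
  define good where "good y \<longleftrightarrow> (\<forall>n m. dist (d (I n y)) (d (I m y)) \<le> (1 / 2) ^ n + (1 / 2) ^ m)" for y
  \<comment> \<open>The constant value off \<open>good\<close> makes the sequence converge in \<open>X\<close> for every real \<open>y\<close>.\<close>
  define a where "a n y = (if good y then d (I n y) else d 0)" for n y
  define g where "g y = lim (\<lambda>n. a n y)" for y
  have [measurable]: "Measurable.pred borel (\<lambda>y. digit y k)" for k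
    unfolding digit_def frac_def by measurable
  have I[measurable]: "I n \<in> borel \<rightarrow>\<^sub>M count_space UNIV" for n
    unfolding I_def by (intro measurable_Least) measurable
  have [measurable]: "(\<lambda>y. dist (d (I n y)) (d (I m y))) \<in> borel_measurable borel" for n m
    by (rule measurable_compose_countable[OF _ I[of n]], rule measurable_compose_countable[OF _ I[of m]]) simp
  have [measurable]: "Measurable.pred borel good"
    unfolding good_def[abs_def] by measurable
  have "(\<lambda>y. d (I n y)) \<in> borel \<rightarrow>\<^sub>M borel" for n
    by (rule measurable_compose[OF I[of n]]) simp
  then have a[measurable]: "a n \<in> borel \<rightarrow>\<^sub>M borel" for n
    unfolding a_def by (intro measurable_If) auto
  have aX: "a n y \<in> X" for n y using dX by (auto simp: a_def)
  have lim: "(\<lambda>n. a n y) \<longlonglongrightarrow> g y" "g y \<in> X" for y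
  proof -
    have "Cauchy (\<lambda>n. a n y)"
    proof (rule metric_CauchyI)
      fix e :: real assume "0 < e"
      then obtain N where N: "(1 / 2) ^ N < e / 2" using real_arch_pow_inv[of "e / 2" "1 / 2"] by auto
      have "dist (a m y) (a n y) < e" if "m \<ge> N" "n \<ge> N" for m n
      proof -
        have "dist (a m y) (a n y) \<le> (1 / 2) ^ m + (1 / 2) ^ n"
          by (auto simp: a_def good_def)
        also have "\<dots> \<le> (1 / 2) ^ N + (1 / 2) ^ N"
          using that by (intro add_mono power_decreasing) auto
        finally show ?thesis using N by simp
      qed
      then show "\<exists>M. \<forall>m\<ge>M. \<forall>n\<ge>M. dist (a m y) (a n y) < e" by blast
    qed
    then obtain l where "l \<in> X" "(\<lambda>n. a n y) \<longlonglongrightarrow> l"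
      using compact_imp_complete[OF X(1)] aX by (metis completeE)
    then show "(\<lambda>n. a n y) \<longlonglongrightarrow> g y" "g y \<in> X"
      unfolding g_def by (auto simp: limI)
  qed
  have "g \<in> borel \<rightarrow>\<^sub>M borel"
    by (rule borel_measurable_LIMSEQ_metric[OF a]) (rule lim)
  then have "g \<in> borel \<rightarrow>\<^sub>M borel_on X"
    using lim by (intro measurable_restrict_space2) auto
  moreover have "s \<in> borel_measurable (borel_on X)"
  proof -
    have [measurable]: "(\<lambda>x. dist y x) \<in> borel_measurable (borel_on X)" for y
      by (rule borel_measurable_dist_borel_on)
    have [measurable]: "Measurable.pred (borel_on X) (\<lambda>x. near x k)" for k
      unfolding near_def by (cases "prod_decode k") simp
    have "(\<lambda>x. (if near x j then 1 else 0) * (1 / 4 :: real) ^ Suc j) \<in> borel_measurable (borel_on X)" for j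
      by measurable
    then show ?thesis
      unfolding s_def base4_def of_bool_def by measurable
  qed
  moreover have "g (s x) = x" if x: "x \<in> X" for x
  proof -
    have "digit (s x) (prod_encode (n, i)) \<longleftrightarrow> dist (d i) x < (1 / 2) ^ n" for n i
      by (simp add: digit_def s_def base4_digit near_def)
    then have I: "dist (d (I n (s x))) x < (1 / 2) ^ n" for n
      unfolding I_def using dense[OF x, of "(1 / 2) ^ n"] LeastI_ex[of "\<lambda>i. dist (d i) x < (1 / 2) ^ n"] by auto
    have "good (s x)"
      unfolding good_def
    proof (intro allI)
      fix n m
      show "dist (d (I n (s x))) (d (I m (s x))) \<le> (1 / 2) ^ n + (1 / 2) ^ m"
        using dist_triangle2[of "d (I n (s x))" "d (I m (s x))" x] I[of n] I[of m] by linarith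
    qed
    then have "dist (a n (s x)) x \<le> (1 / 2) ^ n" for n
      using I[of n] by (simp add: a_def)
    then have "(\<lambda>n. a n (s x)) \<longlonglongrightarrow> x" by (rule LIMSEQ_dist_le_half_power)
    then show ?thesis using lim(1) LIMSEQ_unique by blast
  qed
  moreover have "0 \<le> s x \<and> s x < 1" for x
    using base4_nonneg base4_less_1 by (simp add: s_def)
  ultimately show ?thesis by (intro that[of s g])
qed

section \<open>Measurable selection\<close>

lemma nested_compact_Inter_nonempty:
  fixes F :: "nat \<Rightarrow> 'b::t2_space set"
  assumes "\<And>n. compact (F n)" "\<And>n. F n \<noteq> {}" "\<And>m n. m \<le> n \<Longrightarrow> F n \<subseteq> F m"
  shows "(\<Inter>n. F n) \<noteq> {}"
proof -
  have "F 0 \<inter> \<Inter> (F ` UNIV) \<noteq> {}"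
  proof (rule compact_imp_fip_image[OF assms(1)[of 0]])
    fix I :: "nat set" assume "finite I"
    then have "F (Max (insert 0 I)) \<subseteq> F 0 \<inter> \<Inter> (F ` I)"
      using assms(3) by (auto intro!: INF_greatest) (meson Max_ge finite.insertI in_mono insertI2 subsetD)+
    then show "F 0 \<inter> \<Inter> (F ` I) \<noteq> {}" using assms(2) by blast
  qed (use assms(1) in \<open>auto intro: compact_imp_closed\<close>)
  then show ?thesis by blast
qed

text \<open>\<open>T x\<close> is cut down successively by closed balls of radius \<open>2\<^sup>-\<^sup>k\<close>, each time choosing the
  first centre whose ball still meets what is left of \<open>T x\<close>; the selected point is the limit of
  the centres. Each choice is Borel in \<open>x\<close>, because the set of \<open>x\<close> for which \<open>T x\<close> meets a given closed set is
  the projection of a compact set.\<close>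

lemma correspondence_selection:
  fixes X :: "'a::metric_space set"
  assumes X: "compact X" "X \<noteq> {}" and T: "correspondence X T"
  obtains t where "t \<in> borel_on X \<rightarrow>\<^sub>M borel_on X" "\<And>x. x \<in> X \<Longrightarrow> t x \<in> T x"
proof -
  obtain d :: "nat \<Rightarrow> 'a" where dX: "range d \<subseteq> X"
    and dense: "\<And>y e. y \<in> X \<Longrightarrow> 0 < e \<Longrightarrow> \<exists>i. dist (d i) y < e"
    using compact_dense_sequence[OF X] by metis
  have TX: "T x \<subseteq> X" "T x \<noteq> {}" "compact (T x)" if "x \<in> X" for x
    using correspondence_values[OF T that] closedin_compact[OF X(1)] by auto
  define C where "C is = (\<Inter>k<length is. cball (d (is ! k)) ((1 / 2) ^ k))" for "is"
  have closedC: "closed (C is)" for "is" unfolding C_def by auto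
  define H where "H is x \<longleftrightarrow> T x \<inter> C is \<noteq> {}" for "is" x
  have H[measurable]: "Measurable.pred (borel_on X) (H is)" for "is"
  proof -
    have "{x \<in> X. H is x} = fst ` (corr_graph X T \<inter> UNIV \<times> C is)"
      using TX by (force simp: H_def corr_graph_def)
    moreover have "compact (fst ` (corr_graph X T \<inter> UNIV \<times> C is))"
      using compact_corr_graph[OF X(1) T] closedC
      by (intro compact_continuous_image compact_Int_closed closed_Times continuous_intros) auto
    ultimately have "closed {x \<in> X. H is x}" by (simp add: compact_imp_closed)
    then have "{x \<in> X. H is x} \<in> sets (borel_on X)"
      by (intro closedin_imp_sets_borel_on) (auto simp: closedin_closed)
    then show ?thesis by (simp add: pred_def)
  qed
  \<comment> \<open>the indices of the first \<open>n\<close> centres chosen for \<open>x\<close>\<close>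
  define L where "L = rec_nat (\<lambda>x. []) (\<lambda>n l x. l x @ [LEAST i. H (l x @ [i]) x])"
  have L0: "L 0 x = []" and LSuc: "L (Suc n) x = L n x @ [LEAST i. H (L n x @ [i]) x]" for n x
    by (simp_all add: L_def)
  have len: "length (L n x) = n" for n x by (induction n) (auto simp: L0 LSuc)
  have L[measurable]: "L n \<in> borel_on X \<rightarrow>\<^sub>M count_space UNIV" for n
  proof (induction n)
    case 0
    then show ?case by (simp add: L0[abs_def])
  next
    case (Suc n)
    have "(\<lambda>x. l @ [LEAST i. H (l @ [i]) x]) \<in> borel_on X \<rightarrow>\<^sub>M count_space UNIV" for l
      by (rule measurable_compose[OF measurable_Least]) auto
    from measurable_compose_countable[OF this Suc] show ?case
      by (simp add: LSuc[abs_def])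
  qed
  have HL: "H (L n x) x" if x: "x \<in> X" for n x
  proof (induction n)
    case 0
    then show ?case using TX[OF x] by (simp add: H_def C_def L0)
  next
    case (Suc n)
    then obtain y where y: "y \<in> T x" "y \<in> C (L n x)" by (auto simp: H_def)
    obtain i where i: "dist (d i) y < (1 / 2) ^ n"
      using dense[of y "(1 / 2) ^ n"] TX[OF x] y by auto
    have "y \<in> C (L n x @ [i])"
      using y(2) i by (auto simp: C_def len nth_append less_Suc_eq)
    then have "H (L n x @ [i]) x" using y(1) by (auto simp: H_def)
    then show ?case unfolding LSuc by (rule LeastI)
  qed
  have Lnth: "L (Suc n) x ! k = L (Suc k) x ! k" if "k \<le> n" for n k x
    using that
  proof (induction n)
    case (Suc n)
    then show ?case
      by (cases "k = Suc n") (auto simp: LSuc[of "Suc n"] nth_append len)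
  qed simp
  define a where "a k x = d (L (Suc k) x ! k)" for k x
  have ex: "\<exists>y\<in>T x. (\<lambda>k. a k x) \<longlonglongrightarrow> y" if x: "x \<in> X" for x
  proof -
    have anti: "T x \<inter> C (L n x) \<subseteq> T x \<inter> C (L m x)" if "m \<le> n" for m n
    proof -
      have "L n x ! k = L m x ! k" if "k < m" for k
        using that \<open>m \<le> n\<close> Lnth[of k "m - 1" x] Lnth[of k "n - 1" x] by (cases m; cases n) auto
      then have "C (L n x) \<subseteq> C (L m x)"
        unfolding C_def len using that by (intro INF_superset_mono) auto
      then show ?thesis by blast
    qed
    have "(\<Inter>n. T x \<inter> C (L n x)) \<noteq> {}"
      by (rule nested_compact_Inter_nonempty) (use TX[OF x] closedC HL[OF x] anti in \<open>auto simp: H_def intro: compact_Int_closed\<close>)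
    then obtain y where y: "y \<in> T x" "\<And>n. y \<in> C (L n x)" by auto
    have "dist (a k x) y \<le> (1 / 2) ^ k" for k
      using y(2)[of "Suc k"] by (auto simp: C_def len a_def)
    then have "(\<lambda>k. a k x) \<longlonglongrightarrow> y" by (rule LIMSEQ_dist_le_half_power)
    then show ?thesis using y(1) by blast
  qed
  define t where "t x = lim (\<lambda>k. a k x)" for x
  have t: "t x \<in> T x" "(\<lambda>k. a k x) \<longlonglongrightarrow> t x" if "x \<in> X" for x
    using ex[OF that] by (auto simp: t_def limI)
  have "a k \<in> borel_on X \<rightarrow>\<^sub>M borel" for k
    unfolding a_def by (rule measurable_compose[OF L]) simp
  then have "t \<in> borel_on X \<rightarrow>\<^sub>M borel"
    by (rule borel_measurable_LIMSEQ_metric) (use t in auto)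
  then have "t \<in> borel_on X \<rightarrow>\<^sub>M borel_on X"
    using t TX by (intro measurable_restrict_space2) auto
  with t show ?thesis using that by blast
qed

section \<open>Disintegration\<close>

lemma emeasure_lborel_unit_le:
  assumes "0 \<le> c" "c \<le> 1"
  shows "emeasure lborel ({0<..<1::real} \<inter> {..c}) = ennreal c"
proof -
  have "emeasure lborel ({0<..<1::real} \<inter> {..c}) = emeasure lborel {0<..c}"
  proof (cases "c = 1")
    case True
    then have "{0<..<1} \<inter> {..c} = {0<..<1::real}" by auto
    then show ?thesis using True by simp
  next
    case False
    then have "{0<..<1} \<inter> {..c} = {0<..c}" using assms by auto
    then show ?thesis by simp
  qed
  then show ?thesis using assms by simp
qed

lemma rational_sequence_from_below:
  fixes t :: real
  obtains q :: "nat \<Rightarrow> real" where "\<And>n. q n \<in> \<rat>" "\<And>n. q n < t" "incseq q" "q \<longlonglongrightarrow> t"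
proof -
  define q :: "nat \<Rightarrow> real" where "q n = of_int (\<lceil>t * 2 ^ n\<rceil> - 1) / 2 ^ n" for n :: nat
  have rat: "q n \<in> \<rat>" for n unfolding q_def by auto
  have lt: "q n < t" for n
    unfolding q_def by (subst pos_divide_less_eq) (simp, simp, linarith)
  have inc: "incseq q"
  proof (rule incseq_SucI)
    fix n
    have "2 * (\<lceil>t * 2 ^ n\<rceil> - 1) \<le> \<lceil>t * 2 ^ Suc n\<rceil> - 1"
    proof -
      have "of_int (\<lceil>t * 2 ^ n\<rceil> - 1) < t * 2 ^ n" by linarith
      then have "of_int (2 * (\<lceil>t * 2 ^ n\<rceil> - 1)) < t * 2 ^ Suc n" by simp
      then show ?thesis by (simp only: less_ceiling_iff[symmetric])
    qed
    then have "real_of_int (2 * (\<lceil>t * 2 ^ n\<rceil> - 1)) \<le> real_of_int (\<lceil>t * 2 ^ Suc n\<rceil> - 1)"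
      by (simp only: of_int_le_iff)
    then have le: "real_of_int (2 * (\<lceil>t * 2 ^ n\<rceil> - 1)) / 2 ^ Suc n \<le> q (Suc n)"
      unfolding q_def by (intro divide_right_mono) auto
    have "real_of_int (2 * (\<lceil>t * 2 ^ n\<rceil> - 1)) / 2 ^ Suc n = q n"
      by (simp only: q_def of_int_mult power_Suc of_int_numeral mult_divide_mult_cancel_left_if) simp
    with le show "q n \<le> q (Suc n)" by simp
  qed
  have ge: "t - (1 / 2) ^ n \<le> q n" for n
  proof -
    have "t * 2 ^ n - 1 \<le> of_int (\<lceil>t * 2 ^ n\<rceil> - 1)" by linarith
    then have "(t * 2 ^ n - 1) / 2 ^ n \<le> q n"
      unfolding q_def by (intro divide_right_mono) auto
    then show ?thesis by (simp add: field_simps power_divide)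
  qed
  have "(\<lambda>n. t - (1 / 2) ^ n) \<longlonglongrightarrow> t - 0"
    by (intro tendsto_intros LIMSEQ_power_zero) auto
  then have "q \<longlonglongrightarrow> t"
    using ge lt by (intro tendsto_sandwich[of "\<lambda>n. t - (1 / 2) ^ n" q sequentially "\<lambda>_. t"])
      (auto intro!: always_eventually less_imp_le)
  with rat lt inc show ?thesis by (rule that)
qed

lemma AE_le_of_set_integrals:
  fixes f g :: "'b \<Rightarrow> ennreal"
  assumes [measurable]: "f \<in> borel_measurable M" "g \<in> borel_measurable M"
    and le: "\<And>A. A \<in> sets M \<Longrightarrow> (\<integral>\<^sup>+x. f x * indicator A x \<partial>M) \<le> (\<integral>\<^sup>+x. g x * indicator A x \<partial>M)"
    and fin: "\<And>A. A \<in> sets M \<Longrightarrow> (\<integral>\<^sup>+x. g x * indicator A x \<partial>M) < \<infinity>"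
  shows "AE x in M. f x \<le> g x"
proof -
  define A where "A = {x \<in> space M. g x < f x}"
  have A[measurable]: "A \<in> sets M" by (simp add: A_def)
  have "(\<integral>\<^sup>+x. f x * indicator A x - g x * indicator A x \<partial>M)
      = (\<integral>\<^sup>+x. f x * indicator A x \<partial>M) - (\<integral>\<^sup>+x. g x * indicator A x \<partial>M)"
    using fin[OF A] by (intro nn_integral_diff AE_I2) (auto simp: A_def split: split_indicator)
  also have "\<dots> = 0"
    using le[OF A] fin[OF A] by (simp add: diff_eq_0_iff_ennreal)
  finally have "AE x in M. f x * indicator A x - g x * indicator A x = 0"
    by (subst (asm) nn_integral_0_iff_AE) auto
  then show ?thesis
  proof (rule AE_mp, intro AE_I2 impI)
    fix x assume "x \<in> space M" "f x * indicator A x - g x * indicator A x = 0"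
    then show "f x \<le> g x"
      by (cases "x \<in> A") (auto simp: A_def diff_eq_0_iff_ennreal not_less)
  qed
qed

text \<open>The kernel pushes the uniform law on the unit interval forward by the conditional
  quantile function \<open>G\<close>, computed from Radon--Nikodym versions \<open>F q\<close> of the conditional distribution
  function at rational \<open>q\<close>. In this way every \<open>K x\<close> is a probability measure, and the monotonicity
  of \<open>q \<mapsto> F q x\<close>, which holds only for almost every \<open>x\<close>, is needed only under the integral.\<close>

lemma disintegration_real:
  fixes N :: "('b \<times> real) measure"
  assumes M: "prob_space M" and sets_N: "sets N = sets (M \<Otimes>\<^sub>M borel)"
    and fst_N: "distr N M fst = M"
    and unit: "emeasure N (space M \<times> {0..<1}) = 1"
  obtains K where "K \<in> M \<rightarrow>\<^sub>M prob_algebra borel"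
    "\<And>A B. A \<in> sets M \<Longrightarrow> B \<in> sets borel \<Longrightarrow>
       emeasure N (A \<times> B) = (\<integral>\<^sup>+x. indicator A x * emeasure (K x) B \<partial>M)"
proof -
  interpret M: prob_space M by (rule M)
  have [measurable_cong]: "sets N = sets (M \<Otimes>\<^sub>M borel)" by (rule sets_N)
  have space_N: "space N = space M \<times> UNIV"
    using sets_eq_imp_space_eq[OF sets_N] by (simp add: space_pair_measure)
  have fst_A: "emeasure N (A \<times> UNIV) = emeasure M A" if A[measurable]: "A \<in> sets M" for A
  proof -
    have "emeasure M A = emeasure (distr N M fst) A" by (simp add: fst_N)
    also have "\<dots> = emeasure N (fst -` A \<inter> space N)" by (rule emeasure_distr) auto
    also have "fst -` A \<inter> space N = A \<times> UNIV"
      using sets.sets_into_space[OF A] by (auto simp: space_N)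
    finally show ?thesis by simp
  qed
  interpret N: prob_space N
    by (rule prob_spaceI) (use fst_A[of "space M"] in \<open>simp add: space_N M.emeasure_space_1\<close>)
  define R where "R q = distr (density N (indicator (space M \<times> {..q}))) M fst" for q :: real
  have R: "emeasure (R q) A = emeasure N (A \<times> {..q})" if A[measurable]: "A \<in> sets M" for A q
  proof -
    have "emeasure (R q) A = emeasure (density N (indicator (space M \<times> {..q}))) (fst -` A \<inter> space N)"
      unfolding R_def by (subst emeasure_distr) auto
    also have "\<dots> = (\<integral>\<^sup>+w. indicator (space M \<times> {..q}) w * indicator (fst -` A \<inter> space N) w \<partial>N)"
      by (rule emeasure_density) measurable
    also have "\<dots> = (\<integral>\<^sup>+w. indicator (A \<times> {..q}) w \<partial>N)"
      using sets.sets_into_space[OF A]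
      by (intro nn_integral_cong) (auto simp: space_N split: split_indicator)
    finally show ?thesis by simp
  qed
  have R_le: "emeasure (R q) A \<le> emeasure M A" if "A \<in> sets M" for A q
    unfolding R[OF that] fst_A[OF that, symmetric]
    using that by (intro emeasure_mono) auto
  have dens: "density M (RN_deriv M (R q)) = R q" for q
  proof (rule M.density_RN_deriv)
    show "absolutely_continuous M (R q)"
      unfolding absolutely_continuous_def
      using R_le by (auto simp: null_sets_def R_def) (metis R_def le_zero_eq)
  qed (simp add: R_def)
  define D where "D q = RN_deriv M (R q)" for q
  have D[measurable]: "D q \<in> borel_measurable M" for q by (simp add: D_def)
  have intD: "(\<integral>\<^sup>+x. D q x * indicator A x \<partial>M) = emeasure N (A \<times> {..q})" if A[measurable]: "A \<in> sets M" for A q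
    using dens[of q] R[OF A, of q] by (simp add: D_def emeasure_density[symmetric])
  have D_mono: "AE x in M. D q x \<le> D r x" if "q \<le> r" for q r
  proof -
    have "(\<integral>\<^sup>+x. D q x * indicator A x \<partial>M) \<le> (\<integral>\<^sup>+x. D r x * indicator A x \<partial>M)" if "A \<in> sets M" for A
      unfolding intD[OF that] using that \<open>q \<le> r\<close> by (intro emeasure_mono) auto
    then show ?thesis
      using N.emeasure_finite by (intro AE_le_of_set_integrals) (auto simp: intD less_top[symmetric])
  qed
  have D_le_1: "AE x in M. D q x \<le> 1" for q
  proof -
    have "(\<integral>\<^sup>+x. D q x * indicator A x \<partial>M) \<le> (\<integral>\<^sup>+x. 1 * indicator A x \<partial>M)" if "A \<in> sets M" for A
      using R_le[OF that, of q] that by (simp add: intD R)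
    then show ?thesis
      using M.emeasure_finite by (intro AE_le_of_set_integrals) (auto simp: less_top[symmetric])
  qed
  \<comment> \<open>The values outside the unit interval are prescribed for all \<open>x\<close>, so that the infimum defining
    \<open>G\<close> is over a nonempty set that is bounded below.\<close>
  define F where "F q x = (if q < 0 then 0 else if 1 \<le> q then 1 else enn2real (min 1 (D q x)))" for q x
  have F01: "0 \<le> F q x" "F q x \<le> 1" for q x
  proof -
    have "enn2real (min 1 (D q x)) \<le> enn2real 1"
      by (intro enn2real_mono) auto
    then show "0 \<le> F q x" "F q x \<le> 1" by (auto simp: F_def)
  qed
  have F[measurable]: "F q \<in> borel_measurable M" for q
    unfolding F_def[abs_def] by measurable
  have F_mono: "AE x in M. F q x \<le> F r x" if "q \<le> r" for q r
  proof -
    have "enn2real (min 1 (D q x)) \<le> enn2real (min 1 (D r x))" if "D q x \<le> D r x" for x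
      using that by (intro enn2real_mono min.mono) (auto simp: min_less_iff_disj)
    then have "D q x \<le> D r x \<Longrightarrow> F q x \<le> F r x" for x
      using \<open>q \<le> r\<close> F01[of r x] F01[of q x] by (auto simp: F_def)
    with D_mono[OF that] show ?thesis by (auto elim: eventually_mono)
  qed
  have outside: "emeasure N (A \<times> B) = 0" if [measurable]: "A \<in> sets M" "B \<in> sets borel" and "B \<inter> {0..<1} = {}" for A B
  proof -
    have "emeasure N (A \<times> B) \<le> emeasure N (space N - space M \<times> {0..<1})"
      using that sets.sets_into_space[OF that(1)] by (intro emeasure_mono) (auto simp: space_N)
    also have "\<dots> = 0"
      using unit N.emeasure_space_1 by (subst emeasure_compl) auto
    finally show ?thesis by simp
  qed
  have intF: "(\<integral>\<^sup>+x. indicator A x * ennreal (F q x) \<partial>M) = emeasure N (A \<times> {..q})"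
    if A[measurable]: "A \<in> sets M" for A q
  proof -
    consider "q < 0" | "1 \<le> q" | "0 \<le> q" "q < 1" by linarith
    then show ?thesis
    proof cases
      case 1
      then have "emeasure N (A \<times> {..q}) = 0" by (intro outside) auto
      with 1 show ?thesis by (simp add: F_def)
    next
      case 2
      have "emeasure N (A \<times> UNIV) = emeasure N (A \<times> {..q} \<union> A \<times> {q<..})"
        by (intro arg_cong[where f="emeasure N"]) auto
      also have "\<dots> = emeasure N (A \<times> {..q}) + emeasure N (A \<times> {q<..})"
        by (intro plus_emeasure[symmetric]) auto
      also have "emeasure N (A \<times> {q<..}) = 0" using 2 by (intro outside) auto
      finally show ?thesis using 2 fst_A[OF A] by (simp add: F_def)
    next
      case 3
      have "(\<integral>\<^sup>+x. indicator A x * ennreal (F q x) \<partial>M) = (\<integral>\<^sup>+x. D q x * indicator A x \<partial>M)"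
      proof (intro nn_integral_cong_AE eventually_mono[OF D_le_1[of q]])
        fix x assume "D q x \<le> 1"
        then have "ennreal (F q x) = D q x"
          using 3 by (simp add: F_def min_absorb2) (metis ennreal_enn2real ennreal_one_less_top order_le_less_trans)
        then show "indicator A x * ennreal (F q x) = D q x * indicator A x" by (simp add: mult.commute)
      qed
      then show ?thesis using intD[OF A] by simp
    qed
  qed
  define U :: "real measure" where "U = restrict_space lborel {0<..<1}"
  have U_space: "space U = {0<..<1}" by (simp add: U_def space_restrict_space)
  have U_em: "emeasure U B = emeasure lborel B" if "B \<subseteq> {0<..<1}" for B
    unfolding U_def using that by (intro emeasure_restrict_space) auto
  interpret U: prob_space U
    by (rule prob_spaceI) (simp add: U_space U_em)
  define G where "G x u = Inf {q \<in> \<rat>. u \<le> F q x}" for x u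
  have G_less: "G x u < t \<longleftrightarrow> (\<exists>q\<in>\<rat> \<inter> {..<t}. u \<le> F q x)" if "0 < u" "u < 1" for x u t
  proof -
    have "1 \<in> {q \<in> \<rat>. u \<le> F q x}" using that by (simp add: F_def)
    moreover have "bdd_below {q \<in> \<rat>. u \<le> F q x}"
      using that by (intro bdd_belowI[of _ 0]) (auto simp: F_def split: if_splits)
    ultimately show ?thesis
      unfolding G_def by (subst cInf_less_iff) auto
  qed
  have G: "(\<lambda>(x, u). G x u) \<in> M \<Otimes>\<^sub>M U \<rightarrow>\<^sub>M borel"
  proof (rule borel_measurableI_less)
    fix t :: real
    have "(\<lambda>u. u) \<in> borel_measurable U"
      unfolding U_def by (intro measurable_restrict_space1) auto
    then have [measurable]: "snd \<in> borel_measurable (M \<Otimes>\<^sub>M U)"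
      using measurable_compose[OF measurable_snd] by blast
    have "{w \<in> space (M \<Otimes>\<^sub>M U). (case w of (x, u) \<Rightarrow> G x u) < t}
      = (\<Union>q\<in>\<rat> \<inter> {..<t}. {w \<in> space (M \<Otimes>\<^sub>M U). snd w \<le> F q (fst w)})"
      using G_less by (auto simp: space_pair_measure U_space)
    also have "\<dots> \<in> sets (M \<Otimes>\<^sub>M U)"
      by (intro sets.countable_UN'' countable_Int1 countable_rat) measurable
    finally show "{w \<in> space (M \<Otimes>\<^sub>M U). (case w of (x, u) \<Rightarrow> G x u) < t} \<in> sets (M \<Otimes>\<^sub>M U)" .
  qed
  define K where "K x = distr U borel (G x)" for x
  have Gx: "G x \<in> borel_measurable U" if "x \<in> space M" for x
    using measurable_Pair2[OF G that] by simp
  have K: "K \<in> M \<rightarrow>\<^sub>M prob_algebra borel"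
    unfolding K_def
    by (rule measurable_distr_prob_space2[OF _ G])
       (auto intro!: measurable_const simp: space_prob_algebra U.prob_space_axioms)
  have K_less: "(\<integral>\<^sup>+x. indicator A x * emeasure (K x) {..<t} \<partial>M) = emeasure N (A \<times> {..<t})"
    if A[measurable]: "A \<in> sets M" for A t
  proof -
    obtain q where q: "\<And>n. q n \<in> \<rat>" "\<And>n. q n < t" "incseq q" "q \<longlonglongrightarrow> t"
      using rational_sequence_from_below by metis
    have "AE x in M. \<forall>r\<in>\<rat>. \<forall>s\<in>\<rat>. r \<le> s \<longrightarrow> F r x \<le> F s x"
      using F_mono by (auto simp: AE_ball_countable countable_rat)
    then have K_SUP: "AE x in M. emeasure (K x) {..<t} = (SUP n. ennreal (F (q n) x))"
    proof (rule AE_mp, intro AE_I2 impI)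
      fix x assume x: "x \<in> space M" and mono: "\<forall>r\<in>\<rat>. \<forall>s\<in>\<rat>. r \<le> s \<longrightarrow> F r x \<le> F s x"
      have "emeasure (K x) {..<t} = emeasure U {u \<in> {0<..<1}. G x u < t}"
        unfolding K_def using Gx[OF x]
        by (subst emeasure_distr) (auto simp: U_space intro!: arg_cong[where f="emeasure U"])
      also have "{u \<in> {0<..<1}. G x u < t} = (\<Union>n. {0<..<1} \<inter> {..F (q n) x})"
      proof -
        have "(\<exists>r\<in>\<rat> \<inter> {..<t}. u \<le> F r x) \<longleftrightarrow> (\<exists>n. u \<le> F (q n) x)" for u
        proof
          assume "\<exists>r\<in>\<rat> \<inter> {..<t}. u \<le> F r x"
          then obtain r where r: "r \<in> \<rat>" "r < t" "u \<le> F r x" by auto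
          obtain n where "r < q n"
            using order_tendstoD(1)[OF q(4) r(2)] by (auto simp: eventually_sequentially)
          then have "F r x \<le> F (q n) x" using mono r q(1) by auto
          with r show "\<exists>n. u \<le> F (q n) x" by (auto intro: order_trans)
        qed (use q in auto)
        then show ?thesis using G_less by auto
      qed
      also have "emeasure U \<dots> = emeasure lborel \<dots>"
        by (rule U_em) auto
      also have "\<dots> = (SUP n. emeasure lborel ({0<..<1} \<inter> {..F (q n) x}))"
      proof (rule SUP_emeasure_incseq[symmetric])
        have "F (q n) x \<le> F (q (Suc n)) x" for n
          using mono q(1) incseq_SucD[OF q(3)] by blast
        then show "incseq (\<lambda>n. {0<..<1} \<inter> {..F (q n) x})"
          by (intro incseq_SucI) (auto intro: order_trans)
      qed auto
      also have "\<dots> = (SUP n. ennreal (F (q n) x))"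
        using F01 by (simp add: emeasure_lborel_unit_le)
      finally show "emeasure (K x) {..<t} = (SUP n. ennreal (F (q n) x))" .
    qed
    have "(\<integral>\<^sup>+x. indicator A x * emeasure (K x) {..<t} \<partial>M)
        = (\<integral>\<^sup>+x. (SUP n. indicator A x * ennreal (F (q n) x)) \<partial>M)"
      using K_SUP by (intro nn_integral_cong_AE) (auto elim!: eventually_mono simp: SUP_mult_left_ennreal)
    also have "\<dots> = (SUP n. \<integral>\<^sup>+x. indicator A x * ennreal (F (q n) x) \<partial>M)"
    proof (rule nn_integral_monotone_convergence_SUP_AE)
      fix n
      have "AE x in M. F (q n) x \<le> F (q (Suc n)) x"
        using incseq_SucD[OF q(3)] by (rule F_mono)
      then show "AE x in M. indicator A x * ennreal (F (q n) x) \<le> indicator A x * ennreal (F (q (Suc n)) x)"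
        by (auto elim!: eventually_mono intro!: mult_left_mono ennreal_leI)
    qed measurable
    also have "\<dots> = (SUP n. emeasure N (A \<times> {..q n}))"
      by (simp add: intF)
    also have "\<dots> = emeasure N (\<Union>n. A \<times> {..q n})"
    proof (rule SUP_emeasure_incseq)
      show "incseq (\<lambda>n. A \<times> {..q n})"
        using incseq_SucD[OF q(3)] by (intro incseq_SucI) (auto intro: order_trans)
    qed auto
    also have "(\<Union>n. A \<times> {..q n}) = A \<times> {..<t}"
    proof -
      have "(\<exists>n. r \<le> q n) \<longleftrightarrow> r < t" for r
      proof
        assume "r < t"
        then obtain n where "r < q n"
          using order_tendstoD(1)[OF q(4)] by (auto simp: eventually_sequentially)
        then show "\<exists>n. r \<le> q n" by (auto intro: less_imp_le)
      qed (use q(2) in \<open>auto intro: le_less_trans\<close>)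
      then show ?thesis by auto
    qed
    finally show ?thesis .
  qed
  show ?thesis
  proof (rule that[OF K])
    fix A :: "'b set" and B :: "real set" assume A[measurable]: "A \<in> sets M" and B: "B \<in> sets borel"
    define N1 where "N1 = distr (density N (indicator (A \<times> UNIV))) borel snd"
    define N2 where "N2 = density M (indicator A) \<bind> K"
    note Ks[measurable] = measurable_prob_algebraD[OF K]
    have ne: "space M \<noteq> {}" by (rule M.not_empty)
    have Kd: "K \<in> density M (indicator A) \<rightarrow>\<^sub>M subprob_algebra borel" by simp
    have N1: "emeasure N1 C = emeasure N (A \<times> C)" if [measurable]: "C \<in> sets borel" for C
    proof -
      have "emeasure N1 C = emeasure (density N (indicator (A \<times> UNIV))) (snd -` C \<inter> space N)"
        unfolding N1_def by (subst emeasure_distr) auto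
      also have "\<dots> = (\<integral>\<^sup>+w. indicator (A \<times> UNIV) w * indicator (snd -` C \<inter> space N) w \<partial>N)"
        by (rule emeasure_density) measurable
      also have "\<dots> = (\<integral>\<^sup>+w. indicator (A \<times> C) w \<partial>N)"
        by (intro nn_integral_cong) (auto simp: space_N split: split_indicator)
      finally show ?thesis by simp
    qed
    have N2: "emeasure N2 C = (\<integral>\<^sup>+x. indicator A x * emeasure (K x) C \<partial>M)" if [measurable]: "C \<in> sets borel" for C
    proof -
      have "emeasure N2 C = (\<integral>\<^sup>+x. emeasure (K x) C \<partial>density M (indicator A))"
        unfolding N2_def using ne by (intro emeasure_bind[OF _ Kd]) auto
      also have "\<dots> = (\<integral>\<^sup>+x. indicator A x * emeasure (K x) C \<partial>M)"
        by (rule nn_integral_density) measurable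
      finally show ?thesis .
    qed
    have "N1 = N2"
    proof (rule measure_eqI_generator_eq[where E="range lessThan" and A="\<lambda>i. {..<real i}" and \<Omega>=UNIV])
      show "Int_stable (range lessThan :: real set set)"
        by (auto simp: Int_stable_def greaterThan_Int_greaterThan)
      show "sets N1 = sigma_sets UNIV (range lessThan)"
        by (simp add: N1_def borel_Iio)
      have "sets N2 = sets borel"
        unfolding N2_def using ne K by (intro sets_bind) (auto dest: measurable_space simp: space_prob_algebra)
      then show "sets N2 = sigma_sets UNIV (range lessThan)"
        by (simp add: borel_Iio)
      show "\<Union> (range (\<lambda>i. {..<real i})) = UNIV"
        using reals_Archimedean2 by auto
      show "emeasure N1 {..<real i} \<noteq> \<infinity>" for i
        using N.emeasure_finite by (simp add: N1)
    qed (auto simp: N1 N2 K_less)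
    then show "emeasure N (A \<times> B) = (\<integral>\<^sup>+x. indicator A x * emeasure (K x) B \<partial>M)"
      using N1[OF B] N2[OF B] by simp
  qed
qed

text \<open>The second coordinate is coded by a real number, and the kernel is decoded by the retraction.\<close>

lemma disintegration_compact:
  fixes N :: "('b \<times> 'a::metric_space) measure"
  assumes X: "compact X"
    and M: "prob_space M" and sets_N: "sets N = sets (M \<Otimes>\<^sub>M borel_on X)"
    and fst_N: "distr N M fst = M"
  obtains K where "K \<in> M \<rightarrow>\<^sub>M prob_algebra (borel_on X)"
    "\<And>A B. A \<in> sets M \<Longrightarrow> B \<in> sets (borel_on X) \<Longrightarrow>
       emeasure N (A \<times> B) = (\<integral>\<^sup>+x. indicator A x * emeasure (K x) B \<partial>M)"
proof -
  interpret M: prob_space M by (rule M)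
  have [measurable_cong]: "sets N = sets (M \<Otimes>\<^sub>M borel_on X)" by (rule sets_N)
  have space_N: "space N = space M \<times> X"
    using sets_eq_imp_space_eq[OF sets_N] by (simp add: space_pair_measure)
  have mfst: "fst \<in> N \<rightarrow>\<^sub>M M" by measurable
  have "prob_space (distr N M fst)" by (simp add: fst_N M)
  then interpret N: prob_space N
    by (rule prob_space_distrD[OF mfst])
  have "X \<noteq> {}" using N.not_empty by (auto simp: space_N)
  then obtain s :: "'a \<Rightarrow> real" and g :: "real \<Rightarrow> 'a" where
    s[measurable]: "s \<in> borel_measurable (borel_on X)" and g[measurable]: "g \<in> borel \<rightarrow>\<^sub>M borel_on X"
    and gs: "\<And>x. x \<in> X \<Longrightarrow> g (s x) = x" and s01: "\<And>x. 0 \<le> s x \<and> s x < 1"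
    using compact_Borel_retract_real[OF X] by metis
  define h where "h = (\<lambda>p. (fst p, s (snd p)) :: 'b \<times> real)"
  have h[measurable]: "h \<in> N \<rightarrow>\<^sub>M M \<Otimes>\<^sub>M borel" unfolding h_def by measurable
  define N' where "N' = distr N (M \<Otimes>\<^sub>M borel) h"
  have "distr N' M fst = distr N M (fst \<circ> h)"
    unfolding N'_def by (rule distr_distr) auto
  also have "fst \<circ> h = fst" by (auto simp: h_def)
  finally have 1: "distr N' M fst = M" by (simp add: fst_N)
  have 2: "emeasure N' (space M \<times> {0..<1}) = 1"
  proof -
    have "h -` (space M \<times> {0..<1}) \<inter> space N = space N"
      using s01 by (auto simp: h_def space_N)
    then show ?thesis
      unfolding N'_def by (subst emeasure_distr) (auto simp: N.emeasure_space_1)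
  qed
  obtain K where K: "K \<in> M \<rightarrow>\<^sub>M prob_algebra borel"
    "\<And>A B. A \<in> sets M \<Longrightarrow> B \<in> sets borel \<Longrightarrow>
       emeasure N' (A \<times> B) = (\<integral>\<^sup>+x. indicator A x * emeasure (K x) B \<partial>M)"
    by (rule disintegration_real[OF M _ 1 2]) (auto simp: N'_def)
  show ?thesis
  proof (rule that)
    show "(\<lambda>x. distr (K x) (borel_on X) g) \<in> M \<rightarrow>\<^sub>M prob_algebra (borel_on X)"
      by (rule measurable_compose[OF K(1) measurable_distr_prob_space[OF g]])
    fix A B assume A[measurable]: "A \<in> sets M" and B[measurable]: "B \<in> sets (borel_on X)"
    have gB[measurable]: "g -` B \<in> sets borel"
      using measurable_sets[OF g B] by simp
    have "h -` (A \<times> (g -` B)) \<inter> space N = A \<times> B"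
      using gs sets.sets_into_space[OF A] sets.sets_into_space[OF B]
      by (force simp: h_def space_N)
    then have "emeasure N (A \<times> B) = emeasure N' (A \<times> (g -` B))"
      unfolding N'_def by (subst emeasure_distr) auto
    also have "\<dots> = (\<integral>\<^sup>+x. indicator A x * emeasure (K x) (g -` B) \<partial>M)"
      by (rule K(2)) auto
    also have "\<dots> = (\<integral>\<^sup>+x. indicator A x * emeasure (distr (K x) (borel_on X) g) B \<partial>M)"
    proof (intro nn_integral_cong)
      fix x assume "x \<in> space M"
      then have "sets (K x) = sets borel"
        using measurable_space[OF K(1)] by (auto simp: space_prob_algebra)
      then have [measurable_cong]: "sets (K x) = sets borel" and sp: "space (K x) = UNIV"
        by (auto dest: sets_eq_imp_space_eq)
      show "indicator A x * emeasure (K x) (g -` B) = indicator A x * emeasure (distr (K x) (borel_on X) g) B"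
        by (subst emeasure_distr) (auto simp: sp)
    qed
    finally show "emeasure N (A \<times> B) = (\<integral>\<^sup>+x. indicator A x * emeasure (distr (K x) (borel_on X) g) B \<partial>M)" .
  qed
qed

section \<open>Entropy of a simple function\<close>

text \<open>The entropy function \<open>- t ln t\<close>, with value 0 at 0 by \<open>ln 0 = 0\<close>.\<close>

definition eta :: "real \<Rightarrow> real" where
  "eta t = - (t * ln t)"

lemma eta_0 [simp]: "eta 0 = 0" and eta_1 [simp]: "eta 1 = 0"
  by (simp_all add: eta_def)

lemma eta_nonneg: "0 \<le> t \<Longrightarrow> t \<le> 1 \<Longrightarrow> 0 \<le> eta t"
  by (cases "t = 0") (auto simp: eta_def mult_nonneg_nonpos)

lemma continuous_on_eta: "continuous_on {0..} eta"
  unfolding continuous_on_def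
proof
  fix t :: real assume t: "t \<in> {0..}"
  show "(eta \<longlongrightarrow> eta t) (at t within {0..})"
  proof (cases "t = 0")
    case True
    have "(eta \<longlongrightarrow> 0) (at_right 0)"
      unfolding eta_def by real_asymp
    then show ?thesis
      using True by (simp add: at_within_Ici_at_right)
  next
    case False
    then have "isCont eta t"
      using t unfolding eta_def by (intro continuous_intros) auto
    then show ?thesis
      by (metis continuous_at_imp_continuous_at_within continuous_within)
  qed
qed

text \<open>The tangent line at \<open>t\<close> lies above the graph of \<open>eta\<close>.\<close>

lemma eta_tangent: "0 \<le> r \<Longrightarrow> 0 < t \<Longrightarrow> eta r \<le> t - r - r * ln t"
proof (cases "r = 0")
  case False
  assume "0 \<le> r" "0 < t"
  with False have r: "r > 0" by simp
  have "ln (t / r) \<le> t / r - 1"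
    using r \<open>0 < t\<close> by (intro ln_le_minus_one) auto
  then have "r * (ln t - ln r) \<le> r * (t / r - 1)"
    using r \<open>0 < t\<close> by (intro mult_left_mono) (auto simp: ln_div)
  then show ?thesis
    using r by (simp add: eta_def algebra_simps)
qed auto

lemma eta_sum_le:
  assumes "finite A" "\<And>x. x \<in> A \<Longrightarrow> 0 \<le> p x"
  shows "eta (\<Sum>x\<in>A. p x) \<le> (\<Sum>x\<in>A. eta (p x))"
proof -
  let ?s = "\<Sum>x\<in>A. p x"
  have "eta ?s = (\<Sum>x\<in>A. - (p x * ln ?s))"
    by (simp add: eta_def sum_distrib_right sum_negf)
  also have "\<dots> \<le> (\<Sum>x\<in>A. eta (p x))"
  proof (rule sum_mono)
    fix x assume x: "x \<in> A"
    show "- (p x * ln ?s) \<le> eta (p x)"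
    proof (cases "p x = 0")
      case False
      then have "0 < p x" using assms(2)[OF x] by simp
      moreover have "p x \<le> ?s"
        using x assms by (intro member_le_sum) auto
      ultimately show ?thesis by (simp add: eta_def)
    qed simp
  qed
  finally show ?thesis .
qed

text \<open>Nonnegativity of mutual information, for an unnormalised joint law \<open>q\<close>.\<close>

lemma eta_sum_submodular2:
  assumes "finite A" "finite B" and q: "\<And>x y. 0 \<le> q x y"
  shows "(\<Sum>x\<in>A. \<Sum>y\<in>B. eta (q x y)) + eta (\<Sum>x\<in>A. \<Sum>y\<in>B. q x y)
    \<le> (\<Sum>x\<in>A. eta (\<Sum>y\<in>B. q x y)) + (\<Sum>y\<in>B. eta (\<Sum>x\<in>A. q x y))"
proof -
  define a where "a x = (\<Sum>y\<in>B. q x y)" for x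
  define b where "b y = (\<Sum>x\<in>A. q x y)" for y
  define s where "s = (\<Sum>x\<in>A. a x)"
  have sb: "s = (\<Sum>y\<in>B. b y)"
    unfolding s_def a_def b_def by (rule sum.swap)
  have a0: "0 \<le> a x" and b0: "0 \<le> b y" for x y
    unfolding a_def b_def by (auto intro: sum_nonneg q)
  have point: "q x y * (ln (a x) + ln (b y) - ln (q x y) - ln s) \<le> a x * b y / s - q x y"
    if "x \<in> A" "y \<in> B" for x y
  proof (cases "q x y = 0")
    case True
    then show ?thesis using a0[of x] b0[of y] by (simp add: s_def sum_nonneg a0)
  next
    case False
    then have q0: "0 < q x y" using q[of x y] by simp
    have "q x y \<le> a x" unfolding a_def using that assms by (intro member_le_sum) auto
    moreover have "q x y \<le> b y" unfolding b_def using that assms by (intro member_le_sum) auto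
    moreover have "a x \<le> s" unfolding s_def using that assms a0 by (intro member_le_sum) auto
    ultimately have pos: "0 < a x" "0 < b y" "0 < s" using q0 by auto
    have "ln (a x * b y / (q x y * s)) \<le> a x * b y / (q x y * s) - 1"
      using pos q0 by (intro ln_le_minus_one) auto
    then have "q x y * ln (a x * b y / (q x y * s)) \<le> q x y * (a x * b y / (q x y * s) - 1)"
      using q0 by (intro mult_left_mono) auto
    also have "\<dots> = a x * b y / s - q x y"
      using q0 by (simp add: field_simps)
    finally show ?thesis
      using pos q0 by (simp add: ln_mult ln_div algebra_simps)
  qed
  have "(\<Sum>x\<in>A. \<Sum>y\<in>B. q x y * (ln (a x) + ln (b y) - ln (q x y) - ln s))
      \<le> (\<Sum>x\<in>A. \<Sum>y\<in>B. a x * b y / s - q x y)"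
    by (intro sum_mono point)
  also have "\<dots> = (\<Sum>x\<in>A. \<Sum>y\<in>B. a x * b y / s) - s"
    by (simp add: sum_subtractf s_def a_def)
  also have "(\<Sum>x\<in>A. \<Sum>y\<in>B. a x * b y / s) = (\<Sum>x\<in>A. a x) * (\<Sum>y\<in>B. b y) / s"
    by (simp add: sum_product sum_divide_distrib)
  also have "\<dots> = s"
    using sb by (simp add: s_def)
  finally have le: "(\<Sum>x\<in>A. \<Sum>y\<in>B. q x y * (ln (a x) + ln (b y) - ln (q x y) - ln s)) \<le> 0" by simp
  have "(\<Sum>x\<in>A. \<Sum>y\<in>B. q x y * (ln (a x) + ln (b y) - ln (q x y) - ln s))
      = (\<Sum>x\<in>A. \<Sum>y\<in>B. q x y * ln (a x)) + (\<Sum>x\<in>A. \<Sum>y\<in>B. q x y * ln (b y))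
        + (\<Sum>x\<in>A. \<Sum>y\<in>B. eta (q x y)) - (\<Sum>x\<in>A. \<Sum>y\<in>B. q x y * ln s)"
    by (simp add: eta_def ring_distribs sum.distrib sum_subtractf sum_negf)
  also have "(\<Sum>x\<in>A. \<Sum>y\<in>B. q x y * ln (a x)) = - (\<Sum>x\<in>A. eta (a x))"
    by (simp add: eta_def a_def sum_distrib_right sum_negf)
  also have "(\<Sum>x\<in>A. \<Sum>y\<in>B. q x y * ln (b y)) = - (\<Sum>y\<in>B. eta (b y))"
    by (subst sum.swap) (simp add: eta_def b_def sum_distrib_right sum_negf)
  also have "(\<Sum>x\<in>A. \<Sum>y\<in>B. q x y * ln s) = - eta s"
    by (simp add: eta_def s_def a_def sum_distrib_right)
  finally show ?thesis using le by (simp add: a_def b_def s_def)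
qed

text \<open>Finite partitions are handled through functions with finitely many values, whose fibres are
  the cells: joins of partitions then become tuples.\<close>

definition rv_entropy :: "'b measure \<Rightarrow> ('b \<Rightarrow> 'c) \<Rightarrow> real" where
  "rv_entropy M f = (\<Sum>v\<in>f ` space M. eta (measure M (f -` {v} \<inter> space M)))"

text \<open>The conditional entropy of \<open>f\<close> given \<open>g\<close>.\<close>

definition cond_entropy :: "'b measure \<Rightarrow> ('b \<Rightarrow> 'c) \<Rightarrow> ('b \<Rightarrow> 'd) \<Rightarrow> real" where
  "cond_entropy M f g = rv_entropy M (\<lambda>x. (f x, g x)) - rv_entropy M g"

lemma rv_entropy_superset:
  assumes "finite A" "f ` space M \<subseteq> A"
  shows "rv_entropy M f = (\<Sum>v\<in>A. eta (measure M (f -` {v} \<inter> space M)))"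
proof -
  have "f -` {v} \<inter> space M = {}" if "v \<in> A - f ` space M" for v
    using that by auto
  then show ?thesis
    unfolding rv_entropy_def using assms by (intro sum.mono_neutral_left) auto
qed

lemma rv_entropy_cong: "(\<And>x. x \<in> space M \<Longrightarrow> f x = g x) \<Longrightarrow> rv_entropy M f = rv_entropy M g"
proof -
  assume eq: "\<And>x. x \<in> space M \<Longrightarrow> f x = g x"
  then have "f -` {v} \<inter> space M = g -` {v} \<inter> space M" for v by auto
  moreover have "f ` space M = g ` space M" using eq by auto
  ultimately show ?thesis by (simp add: rv_entropy_def)
qed

text \<open>Entropy depends only on the partition into fibres.\<close>

lemma rv_entropy_inj:
  assumes inj: "\<And>x y. x \<in> space M \<Longrightarrow> y \<in> space M \<Longrightarrow> f x = f y \<longleftrightarrow> g x = g y"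
  shows "rv_entropy M f = rv_entropy M g"
proof -
  define k where "k v = g (SOME x. x \<in> space M \<and> f x = v)" for v
  have k: "k (f x) = g x" if "x \<in> space M" for x
  proof -
    have "(SOME y. y \<in> space M \<and> f y = f x) \<in> space M \<and> f (SOME y. y \<in> space M \<and> f y = f x) = f x"
      by (rule someI[of _ x]) (use that in auto)
    then show ?thesis unfolding k_def using inj that by blast
  qed
  have "inj_on k (f ` space M)"
    using k inj by (intro inj_onI) auto
  moreover have "k ` f ` space M = g ` space M"
    using k by (auto simp: image_iff)
  moreover have "g -` {k v} \<inter> space M = f -` {v} \<inter> space M" if "v \<in> f ` space M" for v
    using that k inj by auto
  ultimately show ?thesis
    unfolding rv_entropy_def by (intro sum.reindex_cong[symmetric]) auto
qed

lemma rv_entropy_distr: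
  assumes T: "T \<in> M \<rightarrow>\<^sub>M N" and f: "simple_function N f"
  shows "rv_entropy (distr M N T) f = rv_entropy M (f \<circ> T)"
proof -
  have fin: "finite (f ` space N)" and fs: "f -` {v} \<inter> space N \<in> sets N" for v
    using f by (auto intro: simple_functionD)
  have "rv_entropy (distr M N T) f = (\<Sum>v\<in>f ` space N. eta (measure (distr M N T) (f -` {v} \<inter> space N)))"
    by (simp add: rv_entropy_def)
  also have "\<dots> = (\<Sum>v\<in>f ` space N. eta (measure M ((f \<circ> T) -` {v} \<inter> space M)))"
  proof (intro sum.cong refl arg_cong[where f=eta])
    fix v
    have "T -` (f -` {v} \<inter> space N) \<inter> space M = (f \<circ> T) -` {v} \<inter> space M"
      using measurable_space[OF T] by auto
    then show "measure (distr M N T) (f -` {v} \<inter> space N) = measure M ((f \<circ> T) -` {v} \<inter> space M)"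
      using fs T by (simp add: measure_distr)
  qed
  also have "\<dots> = rv_entropy M (f \<circ> T)"
    using fin measurable_space[OF T] by (intro rv_entropy_superset[symmetric]) auto
  finally show ?thesis .
qed

context prob_space
begin

lemma prob_fibre_eq_sum:
  assumes f: "simple_function M f" and g: "simple_function M g"
  shows "prob (f -` {v} \<inter> space M)
    = (\<Sum>w\<in>g ` space M. prob ((\<lambda>x. (f x, g x)) -` {(v, w)} \<inter> space M))"
proof -
  have "f -` {v} \<inter> space M = (\<Union>w\<in>g ` space M. (\<lambda>x. (f x, g x)) -` {(v, w)} \<inter> space M)"
    by auto
  also have "prob \<dots> = (\<Sum>w\<in>g ` space M. prob ((\<lambda>x. (f x, g x)) -` {(v, w)} \<inter> space M))"
    using simple_functionD[OF g] simple_functionD[OF simple_function_Pair[OF f g]]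
    by (intro finite_measure_finite_Union) (auto simp: disjoint_family_on_def)
  finally show ?thesis .
qed

lemma prob_fibre_eq_sum':
  assumes f: "simple_function M f" and g: "simple_function M g"
  shows "prob (f -` {v} \<inter> space M)
    = (\<Sum>w\<in>g ` space M. prob ((\<lambda>x. (g x, f x)) -` {(w, v)} \<inter> space M))"
proof -
  have "(\<lambda>x. (g x, f x)) -` {(w, v)} = (\<lambda>x. (f x, g x)) -` {(v, w)}" for w by auto
  then show ?thesis using prob_fibre_eq_sum[OF assms] by simp
qed

lemma rv_entropy_Pair_eq:
  assumes f: "simple_function M f" and g: "simple_function M g"
  shows "rv_entropy M (\<lambda>x. (f x, g x))
    = (\<Sum>v\<in>f ` space M. \<Sum>w\<in>g ` space M. eta (prob ((\<lambda>x. (f x, g x)) -` {(v, w)} \<inter> space M)))"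
  unfolding sum.cartesian_product
  by (subst rv_entropy_superset[where A="f ` space M \<times> g ` space M"])
     (use simple_functionD(1)[OF f] simple_functionD(1)[OF g] in \<open>auto simp: case_prod_beta\<close>)

text \<open>Nonnegativity of the mutual information of \<open>f\<close> and \<open>g\<close> given \<open>h\<close>.\<close>

lemma rv_entropy_submodular:
  assumes f: "simple_function M f" and g: "simple_function M g" and h: "simple_function M h"
  shows "rv_entropy M (\<lambda>x. (f x, g x, h x)) + rv_entropy M h
    \<le> rv_entropy M (\<lambda>x. (f x, h x)) + rv_entropy M (\<lambda>x. (g x, h x))"
proof -
  define p where "p x y z = prob ((\<lambda>t. (f t, g t, h t)) -` {(x, y, z)} \<inter> space M)" for x y z
  let ?A = "f ` space M" and ?B = "g ` space M" and ?C = "h ` space M"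
  note fin = simple_functionD(1)[OF f] simple_functionD(1)[OF g] simple_functionD(1)[OF h]
  have gh: "prob ((\<lambda>x. (g x, h x)) -` {(y, z)} \<inter> space M) = (\<Sum>x\<in>?A. p x y z)" for y z
    unfolding p_def by (rule prob_fibre_eq_sum'[OF simple_function_Pair[OF g h] f])
  have fh: "prob ((\<lambda>x. (f x, h x)) -` {(x, z)} \<inter> space M) = (\<Sum>y\<in>?B. p x y z)" for x z
  proof -
    have "(\<lambda>t. (g t, f t, h t)) -` {(y, x, z)} = (\<lambda>t. (f t, g t, h t)) -` {(x, y, z)}" for y
      by auto
    then show ?thesis
      using prob_fibre_eq_sum'[OF simple_function_Pair[OF f h] g, of "(x, z)"] by (simp add: p_def)
  qed
  have ph: "prob (h -` {z} \<inter> space M) = (\<Sum>x\<in>?A. \<Sum>y\<in>?B. p x y z)" for z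
    by (simp add: prob_fibre_eq_sum'[OF h f] fh)
  have "rv_entropy M (\<lambda>x. (f x, g x, h x)) = (\<Sum>v\<in>?A \<times> ?B \<times> ?C. eta (prob ((\<lambda>t. (f t, g t, h t)) -` {v} \<inter> space M)))"
    using fin by (intro rv_entropy_superset) auto
  also have "\<dots> = (\<Sum>x\<in>?A. \<Sum>y\<in>?B. \<Sum>z\<in>?C. eta (p x y z))"
    by (simp add: p_def sum.cartesian_product' )
  also have "\<dots> = (\<Sum>z\<in>?C. \<Sum>x\<in>?A. \<Sum>y\<in>?B. eta (p x y z))"
    by (simp add: sum.swap[of _ ?C])
  finally have 1: "rv_entropy M (\<lambda>x. (f x, g x, h x)) + rv_entropy M h =
    (\<Sum>z\<in>?C. (\<Sum>x\<in>?A. \<Sum>y\<in>?B. eta (p x y z)) + eta (\<Sum>x\<in>?A. \<Sum>y\<in>?B. p x y z))"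
    by (simp add: rv_entropy_def[of M h] ph sum.distrib)
  have "rv_entropy M (\<lambda>x. (f x, h x)) + rv_entropy M (\<lambda>x. (g x, h x))
    = (\<Sum>z\<in>?C. (\<Sum>x\<in>?A. eta (\<Sum>y\<in>?B. p x y z)) + (\<Sum>y\<in>?B. eta (\<Sum>x\<in>?A. p x y z)))"
    unfolding rv_entropy_Pair_eq[OF f h] rv_entropy_Pair_eq[OF g h] fh gh sum.distrib
    by (intro arg_cong2[where f="(+)"] sum.swap)
  then show ?thesis
    unfolding 1 using fin by (auto intro!: sum_mono eta_sum_submodular2 simp: p_def)
qed

lemma rv_entropy_le_Pair:
  assumes f: "simple_function M f" and g: "simple_function M g"
  shows "rv_entropy M f \<le> rv_entropy M (\<lambda>x. (f x, g x))"
  unfolding rv_entropy_Pair_eq[OF f g] rv_entropy_def[of M f] prob_fibre_eq_sum[OF f g]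
  using simple_functionD(1)[OF g] by (intro sum_mono eta_sum_le) auto

lemma rv_entropy_mono:
  assumes f: "simple_function M f" and g: "simple_function M g"
    and fg: "\<And>x y. x \<in> space M \<Longrightarrow> y \<in> space M \<Longrightarrow> f x = f y \<Longrightarrow> g x = g y"
  shows "rv_entropy M g \<le> rv_entropy M f"
proof -
  have "rv_entropy M g \<le> rv_entropy M (\<lambda>x. (g x, f x))"
    by (rule rv_entropy_le_Pair[OF g f])
  also have "\<dots> = rv_entropy M f"
    by (rule rv_entropy_inj) (auto dest: fg)
  finally show ?thesis .
qed

lemma cond_entropy_nonneg:
  assumes f: "simple_function M f" and g: "simple_function M g"
  shows "0 \<le> cond_entropy M f g"
proof -
  have "rv_entropy M g \<le> rv_entropy M (\<lambda>x. (f x, g x))"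
    by (rule rv_entropy_mono[OF simple_function_Pair[OF f g] g]) simp
  then show ?thesis by (simp add: cond_entropy_def)
qed

lemma cond_entropy_inj:
  assumes "\<And>x y. x \<in> space M \<Longrightarrow> y \<in> space M \<Longrightarrow> g x = g y \<longleftrightarrow> h x = h y"
    and "\<And>x y. x \<in> space M \<Longrightarrow> y \<in> space M \<Longrightarrow> f x = f y \<longleftrightarrow> f' x = f' y"
  shows "cond_entropy M f g = cond_entropy M f' h"
proof -
  have "rv_entropy M (\<lambda>x. (f x, g x)) = rv_entropy M (\<lambda>x. (f' x, h x))"
    by (rule rv_entropy_inj) (simp add: assms)
  moreover have "rv_entropy M g = rv_entropy M h"
    by (rule rv_entropy_inj) (rule assms(1))
  ultimately show ?thesis by (simp add: cond_entropy_def)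
qed

lemma cond_entropy_antimono:
  assumes f: "simple_function M f" and g: "simple_function M g" and h: "simple_function M h"
    and gh: "\<And>x y. x \<in> space M \<Longrightarrow> y \<in> space M \<Longrightarrow> g x = g y \<Longrightarrow> h x = h y"
  shows "cond_entropy M f g \<le> cond_entropy M f h"
proof -
  have "rv_entropy M (\<lambda>x. (f x, g x, h x)) = rv_entropy M (\<lambda>x. (f x, g x))"
    by (rule rv_entropy_inj) (auto dest: gh)
  moreover have "rv_entropy M (\<lambda>x. (g x, h x)) = rv_entropy M g"
    by (rule rv_entropy_inj) (auto dest: gh)
  ultimately show ?thesis
    using rv_entropy_submodular[OF f g h] by (simp add: cond_entropy_def)
qed

lemma cond_entropy_chain:
  "cond_entropy M (\<lambda>x. (f x, g x)) h = cond_entropy M g h + cond_entropy M f (\<lambda>x. (g x, h x))"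
proof -
  have "rv_entropy M (\<lambda>x. ((f x, g x), h x)) = rv_entropy M (\<lambda>x. (f x, g x, h x))"
    by (intro rv_entropy_inj) auto
  then show ?thesis by (simp add: cond_entropy_def)
qed

lemma cond_entropy_le_entropy_Pair:
  assumes f: "simple_function M f" and g: "simple_function M g" and h: "simple_function M h"
  shows "cond_entropy M f h \<le> cond_entropy M (\<lambda>x. (f x, g x)) h"
proof -
  have "rv_entropy M (\<lambda>x. (f x, h x)) \<le> rv_entropy M (\<lambda>x. ((f x, g x), h x))"
    using f g h by (intro rv_entropy_mono simple_function_Pair) auto
  then show ?thesis by (simp add: cond_entropy_def)
qed

text \<open>Conditioning on \<open>h\<close> instead of \<open>g\<close> costs at most the conditional entropy of \<open>g\<close> given \<open>h\<close>.\<close>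

lemma cond_entropy_triangle:
  assumes f: "simple_function M f" and g: "simple_function M g" and h: "simple_function M h"
  shows "cond_entropy M f h \<le> cond_entropy M f g + cond_entropy M g h"
proof -
  have "cond_entropy M f h \<le> cond_entropy M (\<lambda>x. (f x, g x)) h"
    by (rule cond_entropy_le_entropy_Pair[OF f g h])
  also have "\<dots> = cond_entropy M g h + cond_entropy M f (\<lambda>x. (g x, h x))"
    by (rule cond_entropy_chain)
  also have "cond_entropy M f (\<lambda>x. (g x, h x)) \<le> cond_entropy M f g"
    using f g h by (intro cond_entropy_antimono simple_function_Pair) auto
  finally show ?thesis by simp
qed

end

section \<open>Entropy rate of a measure preserving map\<close>

lemma Cesaro_tendsto:
  fixes d :: "nat \<Rightarrow> real"
  assumes "d \<longlonglongrightarrow> L"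
  shows "(\<lambda>n. (\<Sum>i<n. d i) / real n) \<longlonglongrightarrow> L"
proof (rule LIMSEQ_I)
  fix e :: real assume "0 < e"
  then obtain N where N: "\<And>i. i \<ge> N \<Longrightarrow> \<bar>d i - L\<bar> < e / 2"
    using LIMSEQ_D[OF assms, of "e / 2"] by auto
  define c where "c = (\<Sum>i<N. \<bar>d i - L\<bar>)"
  obtain K :: nat where K: "2 * c / e < real K" using reals_Archimedean2 by blast
  show "\<exists>no. \<forall>n\<ge>no. norm ((\<Sum>i<n. d i) / real n - L) < e"
  proof (intro exI allI impI)
    fix n assume n: "n \<ge> Suc (N + K)"
    have "c < e / 2 * real n"
    proof -
      have "2 * c / e < real n" using K n by linarith
      then show ?thesis using \<open>0 < e\<close> by (simp add: field_simps)
    qed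
    have "\<bar>(\<Sum>i<n. d i) - real n * L\<bar> = \<bar>\<Sum>i<n. d i - L\<bar>"
      by (simp add: sum_subtractf)
    also have "\<dots> \<le> (\<Sum>i<n. \<bar>d i - L\<bar>)" by (rule sum_abs)
    also have "\<dots> = c + (\<Sum>i\<in>{N..<n}. \<bar>d i - L\<bar>)"
      unfolding c_def lessThan_atLeast0 using n by (subst sum.atLeastLessThan_concat) auto
    also have "(\<Sum>i\<in>{N..<n}. \<bar>d i - L\<bar>) \<le> (\<Sum>i\<in>{N..<n}. e / 2)"
      using N by (intro sum_mono) (auto intro: less_imp_le)
    also have "\<dots> \<le> e / 2 * real n"
      using \<open>0 < e\<close> n by (simp add: field_simps)
    finally have "\<bar>(\<Sum>i<n. d i) - real n * L\<bar> < e * real n"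
      using \<open>c < e / 2 * real n\<close> by linarith
    moreover have "(\<Sum>i<n. d i) / real n - L = ((\<Sum>i<n. d i) - real n * L) / real n"
      using n by (simp add: field_simps)
    ultimately show "norm ((\<Sum>i<n. d i) / real n - L) < e"
      using n by (simp add: pos_divide_less_eq)
  qed
qed

text \<open>The \<open>f\<close>-labels met along the first \<open>n\<close> points of an orbit; its fibres are the cells of
  the join of the first \<open>n\<close> preimages of the partition into fibres of \<open>f\<close>.\<close>

definition itinerary :: "('b \<Rightarrow> 'b) \<Rightarrow> ('b \<Rightarrow> 'c) \<Rightarrow> nat \<Rightarrow> 'b \<Rightarrow> 'c list" where
  "itinerary S f n x = map (\<lambda>i. f ((S ^^ i) x)) [0..<n]"

text \<open>The entropy of \<open>S\<close> with respect to the partition into fibres of \<open>f\<close>.\<close>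

definition entropy_rate :: "'b measure \<Rightarrow> ('b \<Rightarrow> 'b) \<Rightarrow> ('b \<Rightarrow> 'c) \<Rightarrow> real" where
  "entropy_rate M S f = lim (\<lambda>n. rv_entropy M (itinerary S f n) / real n)"

text \<open>Only labels that occur on the space are used, so that the cells are nonempty.\<close>

definition fibres :: "'b measure \<Rightarrow> ('b \<Rightarrow> 'c) \<Rightarrow> 'b set set" where
  "fibres M f = (\<lambda>v. f -` {v} \<inter> space M) ` f ` space M"

lemma itinerary_0 [simp]: "itinerary S f 0 x = []"
  by (simp add: itinerary_def)

lemma itinerary_Suc: "itinerary S f (Suc n) x = f x # itinerary S f n (S x)"
  by (simp add: itinerary_def upt_conv_Cons map_Suc_upt[symmetric] funpow_swap1 del: upt_Suc)

lemma itinerary_Suc': "itinerary S f (Suc n) x = itinerary S f n x @ [f ((S ^^ n) x)]"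
  by (simp add: itinerary_def)

lemma itinerary_eq_iff:
  "itinerary S f n x = itinerary S f n y \<longleftrightarrow> (\<forall>i<n. f ((S ^^ i) x) = f ((S ^^ i) y))"
  by (auto simp: itinerary_def)

lemma partition_entropy_fibres: "partition_entropy M (fibres M f) = rv_entropy M f"
proof -
  have "inj_on (\<lambda>v. f -` {v} \<inter> space M) (f ` space M)"
    by (rule inj_onI) blast
  then show ?thesis
    by (simp add: partition_entropy_def fibres_def rv_entropy_def sum.reindex eta_def sum_negf)
qed

lemma iterated_join_fibres:
  assumes S: "\<And>x. x \<in> space M \<Longrightarrow> S x \<in> space M"
  shows "iterated_join M S (fibres M f) n = fibres M (itinerary S f n)"
proof -
  have Si: "(S ^^ i) x \<in> space M" if "x \<in> space M" for i x
    using that by (induction i) (auto intro: S)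
  have cell: "space M \<inter> (\<Inter>i\<in>{0..<n}. (S ^^ i) -` B i) = itinerary S f n -` {itinerary S f n x} \<inter> space M"
    if "\<And>i. i < n \<Longrightarrow> B i = f -` {f ((S ^^ i) x)} \<inter> space M" for B x
    using that Si by (auto simp: itinerary_eq_iff)
  show ?thesis
  proof (intro set_eqI iffI)
    fix D assume "D \<in> iterated_join M S (fibres M f) n"
    then obtain B x where B: "B \<in> {0..<n} \<rightarrow> fibres M f"
      "D = space M \<inter> (\<Inter>i\<in>{0..<n}. (S ^^ i) -` B i)" "x \<in> D"
      by (auto simp: iterated_join_def)
    have "B i = f -` {f ((S ^^ i) x)} \<inter> space M" if "i < n" for i
    proof -
      have "B i \<in> fibres M f" using B(1) that by auto
      moreover have "(S ^^ i) x \<in> B i" using B(2,3) that by auto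
      ultimately show ?thesis by (auto simp: fibres_def)
    qed
    from cell[of B x, OF this] B show "D \<in> fibres M (itinerary S f n)"
      by (auto simp: fibres_def)
  next
    fix D assume "D \<in> fibres M (itinerary S f n)"
    then obtain x where x: "x \<in> space M" "D = itinerary S f n -` {itinerary S f n x} \<inter> space M"
      by (auto simp: fibres_def)
    define B where "B i = f -` {f ((S ^^ i) x)} \<inter> space M" for i
    have "D = space M \<inter> (\<Inter>i\<in>{0..<n}. (S ^^ i) -` B i)"
      unfolding x(2) by (rule cell[symmetric]) (simp add: B_def)
    moreover have "B \<in> {0..<n} \<rightarrow> fibres M f"
      using x Si by (auto simp: B_def fibres_def)
    moreover have "D \<noteq> {}" using x by auto
    ultimately show "D \<in> iterated_join M S (fibres M f) n"
      unfolding iterated_join_def by blast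
  qed
qed

lemma ks_entropy_partition_fibres:
  assumes "\<And>x. x \<in> space M \<Longrightarrow> S x \<in> space M"
  shows "ks_entropy_partition M S (fibres M f) = entropy_rate M S f"
  by (simp add: ks_entropy_partition_def entropy_rate_def iterated_join_fibres[OF assms]
      partition_entropy_fibres)

lemma fibres_in_finite_partitions:
  assumes "simple_function M f"
  shows "fibres M f \<in> finite_partitions M"
proof -
  have "partition_on (space M) (fibres M f)"
    by (rule partition_onI) (auto simp: fibres_def disjnt_def)
  then show ?thesis
    using simple_functionD[OF assms] by (auto simp: finite_partitions_def fibres_def)
qed

lemma finite_partitions_eq_fibres:
  fixes M :: "'b measure"
  assumes P: "P \<in> finite_partitions M"
  obtains f :: "'b \<Rightarrow> 'b set" where "simple_function M f" "P = fibres M f"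
proof
  define f where "f x = (THE B. B \<in> P \<and> x \<in> B)" for x
  have fin: "finite P" and sets: "P \<subseteq> sets M" and part: "partition_on (space M) P"
    using P by (auto simp: finite_partitions_def)
  have f: "f x \<in> P \<and> x \<in> f x" if x: "x \<in> space M" for x
  proof -
    have "\<exists>!B. B \<in> P \<and> x \<in> B"
      using x partition_onD1[OF part] partition_onD2[OF part]
      by (metis UnionE disjoint_iff disjoint_def)
    then show ?thesis unfolding f_def by (rule theI')
  qed
  have f_eq: "f x = B" if "B \<in> P" "x \<in> B" for x B
  proof -
    have "x \<in> space M" using that sets sets.sets_into_space by blast
    with f[OF this] that show ?thesis
      using partition_onD2[OF part] by (metis disjoint_iff disjoint_def)
  qed
  have cell: "f -` {B} \<inter> space M = B" if "B \<in> P" for B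
    using that f f_eq[OF that] sets sets.sets_into_space by blast
  have img: "f ` space M = P"
  proof
    show "P \<subseteq> f ` space M"
    proof
      fix B assume B: "B \<in> P"
      then obtain x where x: "x \<in> B" using partition_onD3[OF part] by fastforce
      then have "x \<in> space M" using B sets sets.sets_into_space by blast
      then show "B \<in> f ` space M" using f_eq[OF B x] by (intro image_eqI[of _ _ x]) auto
    qed
  qed (use f in auto)
  show "simple_function M f"
    unfolding simple_function_def img using fin cell sets by auto
  show "P = fibres M f"
    unfolding fibres_def img using cell by auto
qed

text \<open>A probability measure preserved by a measurable map.\<close>

locale measure_preserving_map = prob_space M for M :: "'b measure" +
  fixes S :: "'b \<Rightarrow> 'b"
  assumes measurable_map: "S \<in> M \<rightarrow>\<^sub>M M" and distr_map: "distr M M S = M"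
begin

lemma map_space: "x \<in> space M \<Longrightarrow> S x \<in> space M"
  using measurable_map by (rule measurable_space)

lemma measurable_funpow: "S ^^ n \<in> M \<rightarrow>\<^sub>M M"
proof (induction n)
  case (Suc n)
  then show ?case using measurable_comp[OF Suc measurable_map] by (simp add: comp_def)
qed (simp add: id_def)

lemma simple_function_funpow: "simple_function M f \<Longrightarrow> simple_function M (\<lambda>x. f ((S ^^ n) x))"
  using simple_function_comp[OF measurable_funpow] by blast

lemma simple_function_map: "simple_function M f \<Longrightarrow> simple_function M (\<lambda>x. f (S x))"
  using simple_function_comp[OF measurable_map] by blast

lemma simple_function_itinerary:
  assumes f: "simple_function M f"
  shows "simple_function M (itinerary S f n)"
proof (induction n)
  case (Suc n)
  then have "simple_function M (\<lambda>x. itinerary S f n x @ [f ((S ^^ n) x)])"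
    by (rule simple_function_compose2[OF _ simple_function_funpow[OF f], where h="\<lambda>u v. u @ [v]"])
  then show ?case by (simp add: itinerary_Suc'[abs_def])
qed (simp add: itinerary_def[abs_def])

lemma rv_entropy_map:
  assumes "simple_function M f"
  shows "rv_entropy M (\<lambda>x. f (S x)) = rv_entropy M f"
  using rv_entropy_distr[OF measurable_map assms] by (simp add: distr_map comp_def)

lemma cond_entropy_map:
  assumes "simple_function M f" "simple_function M g"
  shows "cond_entropy M (\<lambda>x. f (S x)) (\<lambda>x. g (S x)) = cond_entropy M f g"
  using rv_entropy_map[OF simple_function_Pair[OF assms]] rv_entropy_map[OF assms(2)]
  by (simp add: cond_entropy_def)

lemma rv_entropy_itinerary_Suc:
  assumes f: "simple_function M f"
  shows "rv_entropy M (itinerary S f (Suc n))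
    = rv_entropy M (itinerary S f n) + cond_entropy M f (\<lambda>x. itinerary S f n (S x))"
proof -
  have "rv_entropy M (itinerary S f (Suc n)) = rv_entropy M (\<lambda>x. (f x, itinerary S f n (S x)))"
    by (intro rv_entropy_inj) (auto simp: itinerary_Suc)
  then show ?thesis
    using rv_entropy_map[OF simple_function_itinerary[OF f], of n] by (simp add: cond_entropy_def)
qed

lemma itinerary_prefix:
  "m \<le> n \<Longrightarrow> itinerary S f n x = itinerary S f n y \<Longrightarrow> itinerary S f m x = itinerary S f m y"
  by (auto simp: itinerary_eq_iff)

text \<open>By stationarity the increments of \<open>n \<mapsto> H (itinerary S f n)\<close> are the entropies of the
  present given the next \<open>n\<close> labels. They decrease, so the averages converge to their infimum.\<close>

lemma cond_entropy_future_antimono: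
  assumes f: "simple_function M f" and "m \<le> n"
  shows "cond_entropy M f (\<lambda>x. itinerary S f n (S x)) \<le> cond_entropy M f (\<lambda>x. itinerary S f m (S x))"
  by (intro cond_entropy_antimono f simple_function_map simple_function_itinerary)
     (rule itinerary_prefix[OF \<open>m \<le> n\<close>])

lemma cond_entropy_future_tendsto:
  assumes f: "simple_function M f"
  shows "(\<lambda>n. cond_entropy M f (\<lambda>x. itinerary S f n (S x))) \<longlonglongrightarrow> entropy_rate M S f"
    and entropy_rate_tendsto:
      "(\<lambda>n. rv_entropy M (itinerary S f n) / real n) \<longlonglongrightarrow> entropy_rate M S f"
proof -
  let ?d = "\<lambda>n. cond_entropy M f (\<lambda>x. itinerary S f n (S x))"
  have "decseq ?d"
    by (auto simp: decseq_def intro: cond_entropy_future_antimono[OF f])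
  moreover have "0 \<le> ?d n" for n
    by (intro cond_entropy_nonneg f simple_function_map simple_function_itinerary)
  ultimately obtain L where L: "?d \<longlonglongrightarrow> L"
    using decseq_convergent[of ?d 0] by metis
  have "rv_entropy M (itinerary S f n) = (\<Sum>i<n. ?d i)" for n
  proof (induction n)
    case 0
    have "rv_entropy M (itinerary S f 0) = (\<Sum>v\<in>{[]}. eta (prob (itinerary S f 0 -` {v} \<inter> space M)))"
      by (rule rv_entropy_superset) auto
    moreover have "itinerary S f 0 -` {[]} \<inter> space M = space M" by auto
    ultimately show ?case by (simp add: prob_space del: itinerary_0)
  qed (simp add: rv_entropy_itinerary_Suc[OF f])
  then have *: "(\<lambda>n. rv_entropy M (itinerary S f n) / real n) \<longlonglongrightarrow> L"
    using Cesaro_tendsto[OF L] by simp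
  then have "entropy_rate M S f = L"
    unfolding entropy_rate_def by (rule limI)
  with L * show "?d \<longlonglongrightarrow> entropy_rate M S f"
    "(\<lambda>n. rv_entropy M (itinerary S f n) / real n) \<longlonglongrightarrow> entropy_rate M S f" by auto
qed

lemma entropy_rate_le:
  assumes f: "simple_function M f"
  shows "entropy_rate M S f \<le> cond_entropy M f (\<lambda>x. itinerary S f n (S x))"
  using cond_entropy_future_antimono[OF f]
  by (intro LIMSEQ_le_const2[OF cond_entropy_future_tendsto(1)[OF f]]) auto

lemma entropy_rate_ge:
  assumes f: "simple_function M f"
    and "\<And>n. c \<le> cond_entropy M f (\<lambda>x. itinerary S f n (S x))"
  shows "c \<le> entropy_rate M S f"
  using assms(2) by (intro LIMSEQ_le_const[OF cond_entropy_future_tendsto(1)[OF f]]) auto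

lemma cond_entropy_itinerary_le:
  assumes f: "simple_function M f" and g: "simple_function M g"
  shows "cond_entropy M (itinerary S f n) (itinerary S g n) \<le> real n * cond_entropy M f g"
proof (induction n)
  case 0
  have "cond_entropy M (itinerary S f 0) (itinerary S g 0) = 0"
    unfolding cond_entropy_def by (subst rv_entropy_inj[where g="itinerary S g 0"]) auto
  then show ?case by (simp del: itinerary_0)
next
  case (Suc n)
  note sf = simple_function_itinerary[OF f] and sg = simple_function_itinerary[OF g]
  have "cond_entropy M (itinerary S f (Suc n)) (itinerary S g (Suc n))
      = cond_entropy M (\<lambda>x. (f x, itinerary S f n (S x))) (\<lambda>x. (g x, itinerary S g n (S x)))"
    by (intro cond_entropy_inj) (auto simp: itinerary_Suc)
  also have "\<dots> = cond_entropy M (\<lambda>x. itinerary S f n (S x)) (\<lambda>x. (g x, itinerary S g n (S x)))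
      + cond_entropy M f (\<lambda>x. (itinerary S f n (S x), g x, itinerary S g n (S x)))"
    by (rule cond_entropy_chain)
  also have "\<dots> \<le> cond_entropy M (\<lambda>x. itinerary S f n (S x)) (\<lambda>x. itinerary S g n (S x))
      + cond_entropy M f g"
    using f g sf sg simple_function_map[OF sf] simple_function_map[OF sg]
    by (intro add_mono cond_entropy_antimono simple_function_Pair) auto
  also have "cond_entropy M (\<lambda>x. itinerary S f n (S x)) (\<lambda>x. itinerary S g n (S x))
      = cond_entropy M (itinerary S f n) (itinerary S g n)"
    by (rule cond_entropy_map[OF sf sg])
  finally show ?case using Suc by (simp add: algebra_simps)
qed

text \<open>The estimate behind the Kolmogorov--Sinai theorem: coding by \<open>g\<close> along \<open>n + m\<close> times
  determines \<open>f\<close> along \<open>n\<close> times up to \<open>n\<close> times the conditional entropy of \<open>f\<close> given \<open>m\<close> labels.\<close>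

lemma entropy_rate_le_add_cond_entropy:
  assumes f: "simple_function M f" and g: "simple_function M g"
  shows "entropy_rate M S f \<le> entropy_rate M S g + cond_entropy M f (itinerary S g m)"
proof -
  let ?G = "itinerary S g m" and ?c = "cond_entropy M f (itinerary S g m)"
  note sf = simple_function_itinerary[OF f] and sg = simple_function_itinerary[OF g]
  have le: "rv_entropy M (itinerary S f n) / real n
      \<le> rv_entropy M (itinerary S g (n + m)) / real (n + m) * (real (n + m) / real n) + ?c"
    if "n > 0" for n
  proof -
    have "rv_entropy M (itinerary S f n) \<le> rv_entropy M (\<lambda>x. (itinerary S f n x, itinerary S ?G n x))"
      by (intro rv_entropy_le_Pair sf simple_function_itinerary sg)
    also have "\<dots> = rv_entropy M (itinerary S ?G n) + cond_entropy M (itinerary S f n) (itinerary S ?G n)"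
      by (simp add: cond_entropy_def)
    also have "cond_entropy M (itinerary S f n) (itinerary S ?G n) \<le> real n * ?c"
      by (intro cond_entropy_itinerary_le f sg)
    also have "rv_entropy M (itinerary S ?G n) \<le> rv_entropy M (itinerary S g (n + m))"
    proof (intro rv_entropy_mono sg simple_function_itinerary)
      fix x y assume "itinerary S g (n + m) x = itinerary S g (n + m) y"
      then have *: "g ((S ^^ i) x) = g ((S ^^ i) y)" if "i < n + m" for i
        using that by (auto simp: itinerary_eq_iff)
      show "itinerary S ?G n x = itinerary S ?G n y"
        unfolding itinerary_eq_iff
      proof (intro allI impI)
        fix i j assume "i < n" "j < m"
        then show "g ((S ^^ j) ((S ^^ i) x)) = g ((S ^^ j) ((S ^^ i) y))"
          using *[of "j + i"] by (simp add: funpow_add)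
      qed
    qed
    finally have "rv_entropy M (itinerary S f n) \<le> rv_entropy M (itinerary S g (n + m)) + real n * ?c"
      by simp
    then have "rv_entropy M (itinerary S f n) / real n
        \<le> (rv_entropy M (itinerary S g (n + m)) + real n * ?c) / real n"
      by (intro divide_right_mono) auto
    also have "\<dots> = rv_entropy M (itinerary S g (n + m)) / real (n + m) * (real (n + m) / real n) + ?c"
      using that by (subst add_divide_distrib) simp
    finally show ?thesis .
  qed
  have "(\<lambda>n. real (n + m) / real n) \<longlonglongrightarrow> 1"
    by real_asymp
  moreover have "(\<lambda>n. rv_entropy M (itinerary S g (n + m)) / real (n + m)) \<longlonglongrightarrow> entropy_rate M S g"
    by (rule LIMSEQ_ignore_initial_segment[OF entropy_rate_tendsto[OF g]])
  ultimately have "(\<lambda>n. rv_entropy M (itinerary S g (n + m)) / real (n + m) * (real (n + m) / real n) + ?c)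
      \<longlonglongrightarrow> entropy_rate M S g * 1 + ?c"
    by (intro tendsto_intros)
  then have "entropy_rate M S f \<le> entropy_rate M S g * 1 + ?c"
    using le by (intro LIMSEQ_le[OF entropy_rate_tendsto[OF f]]) (auto intro!: exI[of _ 1])
  then show ?thesis by simp
qed

lemma ks_entropy_le:
  assumes "\<And>f :: 'b \<Rightarrow> 'b set. simple_function M f \<Longrightarrow> ereal (entropy_rate M S f) \<le> c"
  shows "ks_entropy M S \<le> c"
  unfolding ks_entropy_def
proof (rule SUP_least)
  fix P assume "P \<in> finite_partitions M"
  then obtain f :: "'b \<Rightarrow> 'b set" where "simple_function M f" "P = fibres M f"
    by (rule finite_partitions_eq_fibres)
  then show "ereal (ks_entropy_partition M S P) \<le> c"
    using assms by (simp add: ks_entropy_partition_fibres[OF map_space])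
qed

lemma entropy_rate_le_ks_entropy:
  assumes "simple_function M f"
  shows "ereal (entropy_rate M S f) \<le> ks_entropy M S"
proof -
  have "ereal (ks_entropy_partition M S (fibres M f)) \<le> ks_entropy M S"
    unfolding ks_entropy_def by (rule SUP_upper[OF fibres_in_finite_partitions[OF assms]])
  then show ?thesis by (simp add: ks_entropy_partition_fibres[OF map_space])
qed

end

section \<open>Generating partitions\<close>

lemma eta_uniformly_continuous:
  assumes "0 < e"
  obtains d where "0 < d" "\<And>s t. 0 \<le> s \<Longrightarrow> s \<le> 1 \<Longrightarrow> 0 \<le> t \<Longrightarrow> t \<le> 1 \<Longrightarrow> \<bar>s - t\<bar> < d \<Longrightarrow> \<bar>eta s - eta t\<bar> < e"
proof -
  have "uniformly_continuous_on {0..1} eta"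
    by (intro compact_uniformly_continuous continuous_on_subset[OF continuous_on_eta]) auto
  then show ?thesis
    using that assms unfolding uniformly_continuous_on_def dist_real_def
    by (metis abs_minus_commute atLeastAtMost_iff)
qed

text \<open>Functions that rarely differ from \<open>h\<close> leave little uncertainty about \<open>h\<close>.\<close>

lemma (in prob_space) cond_entropy_small_error:
  assumes "0 < e" and h: "simple_function M h"
  obtains d where "0 < d"
    "\<And>g. simple_function M g \<Longrightarrow> g ` space M \<subseteq> h ` space M \<Longrightarrow> prob {x \<in> space M. h x \<noteq> g x} < d \<Longrightarrow>
      cond_entropy M h g < e"
proof -
  define H where "H = h ` space M"
  define k where "k = real (card H)"
  have finH: "finite H" using simple_functionD(1)[OF h] by (simp add: H_def)
  have "0 < e / (k * k + k + 1)" using assms by (auto simp: k_def add_nonneg_pos)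
  then obtain d where d: "0 < d" "\<And>s t. 0 \<le> s \<Longrightarrow> s \<le> 1 \<Longrightarrow> 0 \<le> t \<Longrightarrow> t \<le> 1 \<Longrightarrow> \<bar>s - t\<bar> < d \<Longrightarrow>
      \<bar>eta s - eta t\<bar> < e / (k * k + k + 1)"
    using eta_uniformly_continuous by metis
  define e' where "e' = e / (k * k + k + 1)"
  have e': "0 < e'" unfolding e'_def by fact
  show ?thesis
  proof (rule that[OF d(1)])
    fix g assume g: "simple_function M g" and gH: "g ` space M \<subseteq> h ` space M"
      and small: "prob {x \<in> space M. h x \<noteq> g x} < d"
    define p where "p v w = prob ((\<lambda>x. (h x, g x)) -` {(v, w)} \<inter> space M)" for v w
    define q where "q w = prob (g -` {w} \<inter> space M)" for w
    have pair: "(\<lambda>x. (h x, g x)) -` {(v, w)} \<inter> space M \<in> sets M" for v w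
      using simple_functionD(2)[OF simple_function_Pair[OF h g]] .
    have err: "{x \<in> space M. h x \<noteq> g x} \<in> sets M"
    proof -
      have "{x \<in> space M. h x \<noteq> g x} = (\<lambda>x. (h x, g x)) -` {(v, w). v \<noteq> w} \<inter> space M" by auto
      then show ?thesis using simple_functionD(2)[OF simple_function_Pair[OF h g]] by metis
    qed
    have off: "eta (p v w) \<le> e'" if "v \<noteq> w" for v w
    proof -
      have "p v w \<le> prob {x \<in> space M. h x \<noteq> g x}"
        unfolding p_def using that err by (intro finite_measure_mono) auto
      then have "\<bar>eta (p v w) - eta 0\<bar> < e'"
        unfolding e'_def using small by (intro d(2)) (auto simp: p_def)
      then show ?thesis by simp
    qed
    have diag: "eta (p w w) - eta (q w) \<le> e'" for w
    proof -
      have "q w \<le> p w w + prob {x \<in> space M. h x \<noteq> g x}"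
      proof -
        have "q w \<le> prob ((\<lambda>x. (h x, g x)) -` {(w, w)} \<inter> space M \<union> {x \<in> space M. h x \<noteq> g x})"
          unfolding q_def using pair err by (intro finite_measure_mono) auto
        also have "\<dots> \<le> p w w + prob {x \<in> space M. h x \<noteq> g x}"
          unfolding p_def using pair err by (intro measure_Un_le) auto
        finally show ?thesis .
      qed
      moreover have "p w w \<le> q w"
        unfolding p_def q_def using simple_functionD(2)[OF g] by (intro finite_measure_mono) auto
      ultimately have "\<bar>eta (p w w) - eta (q w)\<bar> < e'"
        unfolding e'_def using small by (intro d(2)) (auto simp: p_def q_def)
      then show ?thesis by simp
    qed
    have "rv_entropy M (\<lambda>x. (h x, g x)) = (\<Sum>(v, w)\<in>H \<times> H. eta (p v w))"
      by (subst rv_entropy_superset[of "H \<times> H"]) (use finH gH in \<open>auto simp: H_def p_def case_prod_beta\<close>)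
    also have "\<dots> = (\<Sum>w\<in>H. \<Sum>v\<in>H. eta (p v w))"
      by (subst sum.swap) (simp add: sum.cartesian_product)
    also have "\<dots> = (\<Sum>w\<in>H. eta (p w w) + (\<Sum>v\<in>H - {w}. eta (p v w)))"
      using finH by (intro sum.cong refl sum.remove) auto
    finally have 1: "rv_entropy M (\<lambda>x. (h x, g x)) = (\<Sum>w\<in>H. eta (p w w) + (\<Sum>v\<in>H - {w}. eta (p v w)))" .
    have 2: "rv_entropy M g = (\<Sum>w\<in>H. eta (q w))"
      unfolding q_def by (rule rv_entropy_superset) (use finH gH in \<open>auto simp: H_def\<close>)
    have "cond_entropy M h g = (\<Sum>w\<in>H. eta (p w w) - eta (q w) + (\<Sum>v\<in>H - {w}. eta (p v w)))"
      by (simp add: cond_entropy_def 1 2 sum_subtractf[symmetric] algebra_simps)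
    also have "\<dots> \<le> (\<Sum>w\<in>H. e' + k * e')"
    proof (intro sum_mono add_mono diag)
      fix w
      have "(\<Sum>v\<in>H - {w}. eta (p v w)) \<le> (\<Sum>v\<in>H - {w}. e')"
        by (intro sum_mono off) auto
      also have "\<dots> \<le> k * e'"
        using e' finH by (auto simp: k_def intro!: mult_right_mono card_mono)
      finally show "(\<Sum>v\<in>H - {w}. eta (p v w)) \<le> k * e'" .
    qed
    also have "\<dots> = (k * k + k) * e'" by (simp add: k_def algebra_simps)
    also have "\<dots> < (k * k + k + 1) * e'" using e' by simp
    also have "\<dots> = e" using \<open>0 < e / (k * k + k + 1)\<close> assms by (auto simp: e'_def)
    finally show "cond_entropy M h g < e" .
  qed
qed

context measure_preserving_map
begin

text \<open>The sets that are, up to small measure, unions of cells of some join of preimages of the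
  partition into fibres of \<open>f\<close>.\<close>

definition approximable :: "('b \<Rightarrow> 'c) \<Rightarrow> 'b set \<Rightarrow> bool" where
  "approximable f A \<longleftrightarrow> A \<in> sets M \<and>
     (\<forall>e>0. \<exists>m L. prob {x \<in> space M. (x \<in> A) \<noteq> (itinerary S f m x \<in> L)} < e)"

lemma sets_itinerary:
  assumes "simple_function M f"
  shows "{x \<in> space M. itinerary S f m x \<in> L} \<in> sets M"
proof -
  have "{x \<in> space M. itinerary S f m x \<in> L} = itinerary S f m -` L \<inter> space M" by auto
  then show ?thesis using simple_functionD(2)[OF simple_function_itinerary[OF assms]] by simp
qed

lemma sets_itinerary_error:
  assumes f: "simple_function M f" and A: "A \<in> sets M"
  shows "{x \<in> space M. (x \<in> A) \<noteq> (itinerary S f m x \<in> L)} \<in> sets M"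
proof -
  have [measurable]: "Measurable.pred M (\<lambda>x. itinerary S f m x \<in> L)" "Measurable.pred M (\<lambda>x. x \<in> A)"
    using sets_itinerary[OF f] A by (auto simp: pred_def)
  show ?thesis by measurable
qed

lemma take_itinerary: "m \<le> n \<Longrightarrow> take m (itinerary S f n x) = itinerary S f m x"
  by (simp add: itinerary_def take_map)

lemma approximable_space: "approximable f (space M)"
  unfolding approximable_def
proof (intro conjI allI impI)
  fix e :: real assume "0 < e"
  have "{x \<in> space M. (x \<in> space M) \<noteq> (itinerary S f 0 x \<in> UNIV)} = {}" by auto
  then show "\<exists>m L. prob {x \<in> space M. (x \<in> space M) \<noteq> (itinerary S f m x \<in> L)} < e"
    using \<open>0 < e\<close> by (metis measure_empty)
qed auto

lemma approximable_compl: 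
  assumes "approximable f A" shows "approximable f (space M - A)"
  unfolding approximable_def
proof (intro conjI allI impI)
  fix e :: real assume "0 < e"
  then obtain m L where mL: "prob {x \<in> space M. (x \<in> A) \<noteq> (itinerary S f m x \<in> L)} < e"
    using assms by (auto simp: approximable_def)
  have "{x \<in> space M. (x \<in> space M - A) \<noteq> (itinerary S f m x \<in> - L)}
      = {x \<in> space M. (x \<in> A) \<noteq> (itinerary S f m x \<in> L)}" by auto
  then show "\<exists>m L. prob {x \<in> space M. (x \<in> space M - A) \<noteq> (itinerary S f m x \<in> L)} < e"
    using mL by (intro exI[of _ m] exI[of _ "- L"]) simp
qed (use assms in \<open>auto simp: approximable_def\<close>)

lemma approximable_Un:
  assumes f: "simple_function M f" and A: "approximable f A" and B: "approximable f B"
  shows "approximable f (A \<union> B)"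
  unfolding approximable_def
proof (intro conjI allI impI)
  fix e :: real assume "0 < e"
  then have "0 < e / 2" by simp
  with A B obtain m L n K where 
    mL: "prob {x \<in> space M. (x \<in> A) \<noteq> (itinerary S f m x \<in> L)} < e / 2" and
    nK: "prob {x \<in> space M. (x \<in> B) \<noteq> (itinerary S f n x \<in> K)} < e / 2"
    unfolding approximable_def by blast
  let ?E = "{x \<in> space M. (x \<in> A) \<noteq> (itinerary S f m x \<in> L)}"
  let ?F = "{x \<in> space M. (x \<in> B) \<noteq> (itinerary S f n x \<in> K)}"
  let ?L = "{l. take m l \<in> L \<or> take n l \<in> K}"
  have sets: "A \<in> sets M" "B \<in> sets M" using A B by (auto simp: approximable_def)
  have meas: "?E \<in> sets M" "?F \<in> sets M"
    by (rule sets_itinerary_error[OF f sets(1)], rule sets_itinerary_error[OF f sets(2)])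
  have "{x \<in> space M. (x \<in> A \<union> B) \<noteq> (itinerary S f (max m n) x \<in> ?L)} \<subseteq> ?E \<union> ?F"
    by (auto simp: take_itinerary)
  then have "prob {x \<in> space M. (x \<in> A \<union> B) \<noteq> (itinerary S f (max m n) x \<in> ?L)} \<le> prob (?E \<union> ?F)"
    using meas by (intro finite_measure_mono) auto
  also have "\<dots> \<le> prob ?E + prob ?F"
    using meas by (intro measure_Un_le) auto
  also have "\<dots> < e" using mL nK by simp
  finally show "\<exists>m L. prob {x \<in> space M. (x \<in> A \<union> B) \<noteq> (itinerary S f m x \<in> L)} < e" by blast
qed (use A B in \<open>auto simp: approximable_def\<close>)

lemma approximable_limit:
  assumes f: "simple_function M f" and A: "A \<in> sets M"
    and approx: "\<And>e. 0 < e \<Longrightarrow> \<exists>B. approximable f B \<and> prob {x \<in> space M. (x \<in> A) \<noteq> (x \<in> B)} < e"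
  shows "approximable f A"
  unfolding approximable_def
proof (intro conjI allI impI)
  fix e :: real assume "0 < e"
  then have "0 < e / 2" by simp
  with approx[OF this] obtain B m L where B: "B \<in> sets M" and
    AB: "prob {x \<in> space M. (x \<in> A) \<noteq> (x \<in> B)} < e / 2" and
    mL: "prob {x \<in> space M. (x \<in> B) \<noteq> (itinerary S f m x \<in> L)} < e / 2"
    unfolding approximable_def by blast
  let ?E = "{x \<in> space M. (x \<in> A) \<noteq> (x \<in> B)}"
  let ?F = "{x \<in> space M. (x \<in> B) \<noteq> (itinerary S f m x \<in> L)}"
  have meas: "?F \<in> sets M"
    by (rule sets_itinerary_error[OF f B])
  moreover have "?E \<in> sets M" using A B by measurable
  ultimately have meas: "?E \<in> sets M" "?F \<in> sets M" by blast+
  have "prob {x \<in> space M. (x \<in> A) \<noteq> (itinerary S f m x \<in> L)} \<le> prob (?E \<union> ?F)"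
    using meas by (intro finite_measure_mono) auto
  also have "\<dots> \<le> prob ?E + prob ?F"
    using meas by (intro measure_Un_le) auto
  also have "\<dots> < e" using AB mL by simp
  finally show "\<exists>m L. prob {x \<in> space M. (x \<in> A) \<noteq> (itinerary S f m x \<in> L)} < e" by blast
qed (rule A)

lemma approximable_UN:
  fixes A :: "nat \<Rightarrow> 'b set"
  assumes f: "simple_function M f" and A: "\<And>i. approximable f (A i)"
  shows "approximable f (\<Union>i. A i)"
proof (rule approximable_limit[OF f])
  have sets: "A i \<in> sets M" for i using A by (auto simp: approximable_def)
  then show "(\<Union>i. A i) \<in> sets M" by auto
  fix e :: real assume "0 < e"
  define B where "B n = (\<Union>i\<in>{..n}. A i)" for n
  have Bs: "B n \<in> sets M" for n unfolding B_def using sets by auto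
  have Ba: "approximable f (B n)" for n
  proof (induction n)
    case (Suc n)
    then show ?case using approximable_Un[OF f Suc A[of "Suc n"]] by (simp add: B_def atMost_Suc Un_commute)
  qed (use A in \<open>simp add: B_def\<close>)
  have "(\<lambda>n. prob (B n)) \<longlonglongrightarrow> prob (\<Union>n. B n)"
    using Bs by (intro finite_Lim_measure_incseq) (auto simp: B_def intro!: incseq_SucI intro: le_SucI)
  then obtain n where n: "\<bar>prob (B n) - prob (\<Union>n. B n)\<bar> < e"
    using LIMSEQ_D[of _ _ e] \<open>0 < e\<close> by fastforce
  have eq: "(\<Union>n. B n) = (\<Union>i. A i)" by (auto simp: B_def)
  have "{x \<in> space M. (x \<in> (\<Union>i. A i)) \<noteq> (x \<in> B n)} = (\<Union>n. B n) - B n"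
    using sets.sets_into_space[OF Bs] unfolding eq[symmetric] by blast
  also have "prob \<dots> = prob (\<Union>n. B n) - prob (B n)"
    using Bs by (intro finite_measure_Diff) auto
  also have "\<dots> < e" using n by simp
  finally show "\<exists>B. approximable f B \<and> prob {x \<in> space M. (x \<in> (\<Union>i. A i)) \<noteq> (x \<in> B)} < e"
    using Ba by blast
qed

lemma approximable_sigma_sets:
  assumes f: "simple_function M f" and G: "\<And>A. A \<in> G \<Longrightarrow> approximable f A"
    and A: "A \<in> sigma_sets (space M) G"
  shows "approximable f A"
  using A
proof induction
  case Empty
  then show ?case using approximable_compl[OF approximable_space] by simp
qed (auto intro: G approximable_compl approximable_UN[OF f])

text \<open>If the iterated partitions generate the \<open>\<sigma>\<close>-algebra, they eventually determine any simple function
  up to small entropy.\<close>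

lemma cond_entropy_itinerary_small:
  assumes f: "simple_function M f" and approx: "\<And>A. A \<in> sets M \<Longrightarrow> approximable f A"
    and h: "simple_function M h" and "0 < e"
  obtains m where "cond_entropy M h (itinerary S f m) < e"
proof -
  define H where "H = h ` space M"
  have finH: "finite H" using simple_functionD(1)[OF h] by (simp add: H_def)
  obtain v0 where v0: "v0 \<in> H" using not_empty by (auto simp: H_def)
  have cardH: "0 < card H" using v0 finH by (auto simp: card_gt_0_iff)
  obtain d where d: "0 < d"
    "\<And>g. simple_function M g \<Longrightarrow> g ` space M \<subseteq> h ` space M \<Longrightarrow> prob {x \<in> space M. h x \<noteq> g x} < d \<Longrightarrow>
      cond_entropy M h g < e"
    using cond_entropy_small_error[OF \<open>0 < e\<close> h] by metis
  have cell: "h -` {v} \<inter> space M \<in> sets M" for v using simple_functionD(2)[OF h] .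
  have "\<exists>m L. prob {x \<in> space M. (x \<in> h -` {v} \<inter> space M) \<noteq> (itinerary S f m x \<in> L)} < d / card H" for v
  proof -
    have "0 < d / card H" using d(1) cardH by simp
    then show ?thesis using approx[OF cell, of v] unfolding approximable_def by blast
  qed
  then have "\<forall>v. \<exists>m L. prob {x \<in> space M. (x \<in> h -` {v} \<inter> space M) \<noteq> (itinerary S f m x \<in> L)} < d / card H"
    by blast
  from choice[OF this] obtain m where "\<forall>v. \<exists>L. prob {x \<in> space M. (x \<in> h -` {v} \<inter> space M) \<noteq> (itinerary S f (m v) x \<in> L)} < d / card H"
    by blast
  from choice[OF this] have "\<exists>L. \<forall>v. prob {x \<in> space M. (x \<in> h -` {v} \<inter> space M) \<noteq> (itinerary S f (m v) x \<in> L v)} < d / card H"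
    by blast
  then obtain L where mL: "\<And>v. prob {x \<in> space M. (x \<in> h -` {v} \<inter> space M) \<noteq> (itinerary S f (m v) x \<in> L v)} < d / card H"
    by blast
  define n where "n = Max (m ` H)"
  have n: "m v \<le> n" if "v \<in> H" for v using that finH by (simp add: n_def)
  \<comment> \<open>\<open>\<phi>\<close> guesses the value of \<open>h\<close> from the itinerary; off the union of the error sets \<open>?E v\<close>
    exactly one \<open>v\<close> is admissible, and it is the value of \<open>h\<close>.\<close>
  define \<phi> where "\<phi> l = (if \<exists>v\<in>H. take (m v) l \<in> L v then SOME v. v \<in> H \<and> take (m v) l \<in> L v else v0)" for l
  have \<phi>H: "\<phi> l \<in> H" for l
    unfolding \<phi>_def using v0 by (auto intro: someI2)
  let ?E = "\<lambda>v. {x \<in> space M. (x \<in> h -` {v} \<inter> space M) \<noteq> (itinerary S f (m v) x \<in> L v)}"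
  let ?g = "\<lambda>x. \<phi> (itinerary S f n x)"
  have Es: "?E v \<in> sets M" for v by (rule sets_itinerary_error[OF f cell])
  have sg: "simple_function M ?g"
    by (rule simple_function_compose1[OF simple_function_itinerary[OF f]])
  have "{x \<in> space M. h x \<noteq> ?g x} \<subseteq> (\<Union>v\<in>H. ?E v)"
  proof (rule subsetI, rule ccontr)
    fix x assume x: "x \<in> {x \<in> space M. h x \<noteq> ?g x}" and nE: "x \<notin> (\<Union>v\<in>H. ?E v)"
    let ?l = "itinerary S f n x"
    have iff: "take (m v) ?l \<in> L v \<longleftrightarrow> h x = v" if "v \<in> H" for v
      using nE x that by (auto simp: take_itinerary[OF n[OF that]])
    have "h x \<in> H" using x by (auto simp: H_def)
    then have "\<phi> ?l \<in> H \<and> take (m (\<phi> ?l)) ?l \<in> L (\<phi> ?l)"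
      unfolding \<phi>_def using iff by (auto intro: someI2)
    then show False using iff x by auto
  qed
  then have "prob {x \<in> space M. h x \<noteq> ?g x} \<le> prob (\<Union>v\<in>H. ?E v)"
    using Es finH by (intro finite_measure_mono) auto
  also have "\<dots> \<le> (\<Sum>v\<in>H. prob (?E v))"
    using Es finH by (intro finite_measure_subadditive_finite) auto
  also have "\<dots> < (\<Sum>v\<in>H. d / card H)"
    using finH v0 mL by (intro sum_strict_mono) auto
  also have "\<dots> = d" using cardH by simp
  finally have "cond_entropy M h ?g < e"
    using sg \<phi>H by (intro d(2)) (auto simp: H_def)
  moreover have "cond_entropy M h (itinerary S f n) \<le> cond_entropy M h ?g"
    by (intro cond_entropy_antimono h sg simple_function_itinerary f) simp
  ultimately have "cond_entropy M h (itinerary S f n) < e" by (rule le_less_trans[rotated])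
  then show ?thesis by (rule that)
qed

text \<open>For a generating partition: the Kolmogorov--Sinai theorem, and the bound by the entropy of the
  present given any simple function of the next point, which the future labels nearly determine.\<close>

lemma
  assumes f: "simple_function M f" and approx: "\<And>A. A \<in> sets M \<Longrightarrow> approximable f A"
  shows ks_entropy_generator: "ks_entropy M S = ereal (entropy_rate M S f)"
    and entropy_rate_le_cond_entropy_next:
      "simple_function M h \<Longrightarrow> entropy_rate M S f \<le> cond_entropy M f (\<lambda>x. h (S x))"
proof -
  show "ks_entropy M S = ereal (entropy_rate M S f)"
  proof (rule antisym)
    show "ks_entropy M S \<le> ereal (entropy_rate M S f)"
    proof (rule ks_entropy_le)
      fix g :: "'b \<Rightarrow> 'b set" assume g: "simple_function M g"
      have "entropy_rate M S g \<le> entropy_rate M S f"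
      proof (rule field_le_epsilon)
        fix e :: real assume "0 < e"
        then obtain m where "cond_entropy M g (itinerary S f m) < e"
          using cond_entropy_itinerary_small[OF f approx g] by blast
        then show "entropy_rate M S g \<le> entropy_rate M S f + e"
          using entropy_rate_le_add_cond_entropy[OF g f, of m] by simp
      qed
      then show "ereal (entropy_rate M S g) \<le> ereal (entropy_rate M S f)" by simp
    qed
  qed (rule entropy_rate_le_ks_entropy[OF f])
  show "entropy_rate M S f \<le> cond_entropy M f (\<lambda>x. h (S x))" if h: "simple_function M h"
  proof (rule field_le_epsilon)
    fix e :: real assume "0 < e"
    then obtain m where m: "cond_entropy M h (itinerary S f m) < e"
      using cond_entropy_itinerary_small[OF f approx h] by blast
    note sf = simple_function_itinerary[OF f]
    have "entropy_rate M S f \<le> cond_entropy M f (\<lambda>x. itinerary S f m (S x))"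
      by (rule entropy_rate_le[OF f])
    also have "\<dots> \<le> cond_entropy M f (\<lambda>x. h (S x)) + cond_entropy M (\<lambda>x. h (S x)) (\<lambda>x. itinerary S f m (S x))"
      by (intro cond_entropy_triangle f simple_function_map h sf)
    also have "cond_entropy M (\<lambda>x. h (S x)) (\<lambda>x. itinerary S f m (S x)) = cond_entropy M h (itinerary S f m)"
      by (rule cond_entropy_map[OF h sf])
    finally show "entropy_rate M S f \<le> cond_entropy M f (\<lambda>x. h (S x)) + e" using m by simp
  qed
qed

end

section \<open>Expansivity\<close>

lemma sets_borel_on_closed:
  "sets (borel_on Y) \<subseteq> sigma_sets Y {K. closedin (top_of_set Y) K}"
proof -
  let ?G = "{K. closedin (top_of_set Y) K}"
  have G: "?G \<subseteq> Pow Y" by (auto dest: closedin_imp_subset)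
  have "sets (borel_on Y) \<subseteq> sets (sigma Y ?G)"
  proof (rule sets_borel_on_le)
    fix U :: "'a set" assume "open U"
    then have "closedin (top_of_set Y) (Y - U)"
      by (auto simp: closedin_closed Diff_eq intro!: exI[of _ "- U"])
    then have "Y - (Y - U) \<in> sigma_sets Y ?G"
      by (intro sigma_sets.Compl sigma_sets.Basic) simp
    then show "U \<inter> Y \<in> sets (sigma Y ?G)"
      using G by (simp add: Diff_Diff_Int Int_commute)
  qed (use G in \<open>simp add: space_measure_of\<close>)
  then show ?thesis using G by simp
qed

lemma funpow_orbit_shift: "(orbit_shift ^^ i) x j = x (i + j)"
  by (induction i arbitrary: j) (auto simp: orbit_shift_def)

lemma closed_Collect_dist_coordinates:
  "closed {p :: (nat \<Rightarrow> 'a::metric_space) \<times> (nat \<Rightarrow> 'a). \<forall>j<m. dist (fst p j) (snd p j) \<le> e}"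
proof -
  have *: "continuous_on UNIV (\<lambda>p :: (nat \<Rightarrow> 'a) \<times> (nat \<Rightarrow> 'a). fst p j)"
      "continuous_on UNIV (\<lambda>p :: (nat \<Rightarrow> 'a) \<times> (nat \<Rightarrow> 'a). snd p j)" for j
    by (rule continuous_on_compose2[OF continuous_on_product_coordinates[of j]];
        auto intro: continuous_intros)+
  have "closed (\<Inter>j\<in>{..<m}. {p :: (nat \<Rightarrow> 'a) \<times> (nat \<Rightarrow> 'a). dist (fst p j) (snd p j) \<le> e})"
    by (intro closed_INT ballI closed_Collect_le continuous_intros *)
  then show ?thesis by (simp add: INTER_eq lessThan_def)
qed

text \<open>If points with equal labels are at distance at most the expansivity constant, then the
  itineraries generate: for a closed set \<open>K\<close> and a neighbourhood \<open>U n\<close> of \<open>K\<close>, compactness yields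
  an \<open>m\<close> such that the cells of length \<open>m\<close> that meet \<open>K\<close> stay inside \<open>U n\<close>. Cells need not be closed,
  so compactness is applied to the closed conditions \<open>dist (x j) (y j) \<le> e0\<close> for \<open>j < m\<close>.\<close>

lemma expansive_approximable:
  fixes \<Omega> :: "(nat \<Rightarrow> 'a::metric_space) set"
  assumes \<nu>: "measure_preserving_map \<nu> orbit_shift" and sets_\<nu>: "sets \<nu> = sets (borel_on \<Omega>)"
    and \<Omega>: "compact \<Omega>" and coord: "\<And>\<omega> j. \<omega> \<in> \<Omega> \<Longrightarrow> \<omega> j \<in> X"
    and expansive: "\<And>x y. x \<in> \<Omega> \<Longrightarrow> y \<in> \<Omega> \<Longrightarrow> (\<And>j. dist (x j) (y j) \<le> e0) \<Longrightarrow> x = y"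
    and f: "\<And>x y. x \<in> X \<Longrightarrow> y \<in> X \<Longrightarrow> f x = f y \<Longrightarrow> dist x y \<le> e0"
    and sf: "simple_function \<nu> (\<lambda>\<omega>. f (\<omega> 0))" and A: "A \<in> sets \<nu>"
  shows "measure_preserving_map.approximable \<nu> orbit_shift (\<lambda>\<omega>. f (\<omega> 0)) A"
proof -
  interpret measure_preserving_map \<nu> orbit_shift by (rule \<nu>)
  have sp: "space \<nu> = \<Omega>" using sets_eq_imp_space_eq[OF sets_\<nu>] by simp
  let ?f = "\<lambda>\<omega>. f (\<omega> 0)"
  have closed_approx: "approximable ?f K" if K: "closedin (top_of_set \<Omega>) K" for K
  proof (cases "K = {}")
    case True
    then show ?thesis using approximable_compl[OF approximable_space] by simp
  next
    case False
    have K\<Omega>: "K \<subseteq> \<Omega>" using K by (rule closedin_imp_subset)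
    have cK: "compact K" by (rule closedin_compact[OF \<Omega> K])
    have Ks: "K \<in> sets \<nu>" unfolding sets_\<nu> by (rule closedin_imp_sets_borel_on[OF K])
    define U where "U n = {\<omega> \<in> \<Omega>. infdist \<omega> K < 1 / real (Suc n)}" for n
    have Us: "U n \<in> sets \<nu>" for n
    proof -
      have "open {\<omega>. infdist \<omega> K < 1 / real (Suc n)}"
        by (intro open_Collect_less continuous_intros)
      then show ?thesis
        unfolding sets_\<nu> U_def by (intro openin_imp_sets_borel_on) (auto simp: openin_open)
    qed
    have UK: "(\<Inter>n. U n) = K"
    proof
      show "(\<Inter>n. U n) \<subseteq> K"
      proof
        fix \<omega> assume "\<omega> \<in> (\<Inter>n. U n)"
        then have *: "infdist \<omega> K < 1 / real (Suc n)" for n by (auto simp: U_def)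
        have "infdist \<omega> K \<le> 0"
        proof (rule ccontr)
          assume "\<not> infdist \<omega> K \<le> 0"
          then obtain n where "1 / real (Suc n) < infdist \<omega> K" using nat_approx_posE[of "infdist \<omega> K"] by auto
          with *[of n] show False by simp
        qed
        then have "infdist \<omega> K = 0" using infdist_nonneg[of \<omega> K] by simp
        then show "\<omega> \<in> K"
          using in_closed_iff_infdist_zero[OF compact_imp_closed[OF cK] False] by simp
      qed
    qed (use K\<Omega> in \<open>auto simp: U_def\<close>)
    have "decseq U"
    proof (rule decseq_SucI)
      fix n show "U (Suc n) \<subseteq> U n"
        by (auto simp: U_def elim!: less_le_trans intro!: divide_left_mono)
    qed
    then have lim: "(\<lambda>n. prob (U n)) \<longlonglongrightarrow> prob K"
      using finite_Lim_measure_decseq[of U] Us by (auto simp: UK)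
    show ?thesis
    proof (rule approximable_limit[OF sf Ks])
      fix e :: real assume "0 < e"
      then obtain n where n: "\<bar>prob (U n) - prob K\<bar> < e"
        using LIMSEQ_D[OF lim, of e] by auto
      define E where "E m = (K \<times> (\<Omega> \<inter> {\<omega>. 1 / real (Suc n) \<le> infdist \<omega> K}))
        \<inter> {p. \<forall>j<m. dist (fst p j) (snd p j) \<le> e0}" for m
      have "\<exists>m. E m = {}"
      proof (rule ccontr)
        assume "\<nexists>m. E m = {}"
        have "(\<Inter>m. E m) \<noteq> {}"
        proof (rule nested_compact_Inter_nonempty)
          show "compact (E m)" for m
            unfolding E_def
            by (intro compact_Int_closed compact_Times cK \<Omega> closed_Collect_le closed_Collect_dist_coordinates
                continuous_intros)
        qed (use \<open>\<nexists>m. E m = {}\<close> in \<open>auto simp: E_def\<close>)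
        then obtain x y where xy: "\<And>m. (x, y) \<in> E m" by auto
        then have "x \<in> K" "y \<in> \<Omega>" "1 / real (Suc n) \<le> infdist y K"
          using xy[of 0] by (auto simp: E_def)
        moreover have "dist (x j) (y j) \<le> e0" for j
          using xy[of "Suc j"] by (auto simp: E_def)
        ultimately have "x = y" using expansive K\<Omega> by blast
        then show False using \<open>x \<in> K\<close> \<open>1 / real (Suc n) \<le> infdist y K\<close> by simp
      qed
      then obtain m where m: "E m = {}" by blast
      define B where "B = {\<omega> \<in> \<Omega>. itinerary orbit_shift ?f m \<omega> \<in> itinerary orbit_shift ?f m ` K}"
      have Bs: "B \<in> sets \<nu>" unfolding B_def sp[symmetric] by (rule sets_itinerary[OF sf])
      have "B \<subseteq> U n"
      proof
        fix \<omega> assume "\<omega> \<in> B"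
        then obtain x where x: "\<omega> \<in> \<Omega>" "x \<in> K" "itinerary orbit_shift ?f m \<omega> = itinerary orbit_shift ?f m x"
          by (auto simp: B_def)
        have "dist (x j) (\<omega> j) \<le> e0" if "j < m" for j
          using x(3) that K\<Omega> x coord by (intro f) (auto simp: itinerary_eq_iff funpow_orbit_shift)
        then have "(x, \<omega>) \<in> E m \<or> infdist \<omega> K < 1 / real (Suc n)"
          using x K\<Omega> by (auto simp: E_def)
        then show "\<omega> \<in> U n" using m x(1) by (auto simp: U_def)
      qed
      have KB: "K \<subseteq> B" using K\<Omega> by (auto simp: B_def)
      have "{\<omega> \<in> space \<nu>. (\<omega> \<in> K) \<noteq> (\<omega> \<in> B)} \<subseteq> U n - K"
        using \<open>B \<subseteq> U n\<close> KB by (auto simp: sp)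
      then have "prob {\<omega> \<in> space \<nu>. (\<omega> \<in> K) \<noteq> (\<omega> \<in> B)} \<le> prob (U n - K)"
        using Us Ks by (intro finite_measure_mono) auto
      also have "\<dots> = prob (U n) - prob K"
        using Us Ks \<open>B \<subseteq> U n\<close> KB by (intro finite_measure_Diff) auto
      also have "\<dots> < e" using n by simp
      finally have small: "prob {\<omega> \<in> space \<nu>. (\<omega> \<in> K) \<noteq> (\<omega> \<in> B)} < e" .
      have "approximable ?f B"
        unfolding approximable_def
      proof (intro conjI Bs allI impI exI)
        fix d :: real assume "0 < d"
        have "{\<omega> \<in> space \<nu>. (\<omega> \<in> B) \<noteq> (itinerary orbit_shift ?f m \<omega> \<in> itinerary orbit_shift ?f m ` K)} = {}"
          by (auto simp: B_def sp)
        then show "prob {\<omega> \<in> space \<nu>. (\<omega> \<in> B) \<noteq> (itinerary orbit_shift ?f m \<omega> \<in> itinerary orbit_shift ?f m ` K)} < d"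
          using \<open>0 < d\<close> by (simp only: measure_empty)
      qed
      with small show "\<exists>B. approximable ?f B \<and> prob {\<omega> \<in> space \<nu>. (\<omega> \<in> K) \<noteq> (\<omega> \<in> B)} < e" by blast
    qed
  qed
  show ?thesis
  proof (rule approximable_sigma_sets[OF sf])
    show "A \<in> sigma_sets (space \<nu>) {K. closedin (top_of_set \<Omega>) K}"
      using A sets_borel_on_closed[of \<Omega>] by (auto simp: sets_\<nu> sp)
  qed (use closed_approx in auto)
qed

section \<open>Conditional entropy given a point\<close>

lemma ex_simple_function_bins:
  fixes r :: "'c \<Rightarrow> 'b \<Rightarrow> real"
  assumes "finite V" and r: "\<And>v. v \<in> V \<Longrightarrow> r v \<in> borel_measurable M"
    and r01: "\<And>v y. v \<in> V \<Longrightarrow> y \<in> space M \<Longrightarrow> 0 \<le> r v y \<and> r v y \<le> 1" and "0 < d"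
  obtains c :: "'b \<Rightarrow> 'c \<Rightarrow> int" where "simple_function M c"
    "\<And>v y z. v \<in> V \<Longrightarrow> c y = c z \<Longrightarrow> \<bar>r v y - r v z\<bar> < d"
proof -
  obtain k :: nat where k: "0 < k" "1 / real k < d"
    using nat_approx_posE[OF \<open>0 < d\<close>] by (metis zero_less_Suc)
  define c where "c y = (\<lambda>v\<in>V. \<lfloor>real k * r v y\<rfloor>)" for y
  have close: "\<bar>r v y - r v z\<bar> < d" if "v \<in> V" "c y = c z" for v y z
  proof -
    have "\<lfloor>real k * r v y\<rfloor> = \<lfloor>real k * r v z\<rfloor>"
      using that by (auto simp: c_def fun_eq_iff restrict_def) (metis that(1))
    then have "\<bar>real k * r v y - real k * r v z\<bar> < 1" by linarith
    then have "\<bar>real k * (r v y - r v z)\<bar> < 1" by (simp add: algebra_simps)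
    then have "real k * \<bar>r v y - r v z\<bar> < 1" by (simp add: abs_mult)
    then have "\<bar>r v y - r v z\<bar> < 1 / real k" using k by (simp add: field_simps)
    then show ?thesis using k by simp
  qed
  have img: "c ` space M \<subseteq> V \<rightarrow>\<^sub>E {0..int k}"
  proof
    fix z assume "z \<in> c ` space M"
    then obtain y where y: "y \<in> space M" "z = c y" by auto
    have "0 \<le> \<lfloor>real k * r v y\<rfloor> \<and> \<lfloor>real k * r v y\<rfloor> \<le> int k" if "v \<in> V" for v
    proof -
      have "0 \<le> real k * r v y" "real k * r v y \<le> real k"
        using r01[OF that y(1)] by (auto simp: mult_left_le)
      then show ?thesis by (simp add: floor_le_iff) 
    qed
    then show "z \<in> V \<rightarrow>\<^sub>E {0..int k}" by (auto simp: y c_def)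
  qed
  have "finite (V \<rightarrow>\<^sub>E {0..int k})" using \<open>finite V\<close> by (intro finite_PiE) auto
  then have fin: "finite (c ` space M)" using img finite_subset by blast
  have "c -` {z} \<inter> space M \<in> sets M" if "z \<in> c ` space M" for z
  proof -
    have "z \<in> extensional V" using img that by (auto simp: PiE_def)
    then have "c -` {z} \<inter> space M = {y \<in> space M. \<forall>v\<in>V. \<lfloor>real k * r v y\<rfloor> = z v}"
      by (auto simp: c_def extensional_def fun_eq_iff restrict_def)
    also have "\<dots> \<in> sets M"
    proof (intro sets.sets_Collect_finite_All \<open>finite V\<close>)
      fix v assume "v \<in> V"
      note [measurable] = r[OF this]
      show "{y \<in> space M. \<lfloor>real k * r v y\<rfloor> = z v} \<in> sets M" by measurable
    qed
    finally show ?thesis .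
  qed
  with fin have "simple_function M c" by (simp add: simple_function_def)
  then show ?thesis using close by (rule that)
qed

text \<open>The conditional entropy of a random label with values in \<open>V\<close> given a random point \<open>y\<close> of law
  \<open>M\<close>, where \<open>r v y\<close> is a version of the conditional probability of the label \<open>v\<close> given \<open>y\<close>.\<close>

definition point_cond_entropy :: "'d measure \<Rightarrow> 'c set \<Rightarrow> ('c \<Rightarrow> 'd \<Rightarrow> real) \<Rightarrow> real" where
  "point_cond_entropy M V r = (\<Sum>v\<in>V. \<integral>y. eta (r v y) \<partial>M)"

lemma eta_le_1: "0 \<le> t \<Longrightarrow> t \<le> 1 \<Longrightarrow> eta t \<le> 1"
  using eta_tangent[of t 1] by simp

lemma borel_measurable_eta [measurable]: "eta \<in> borel_measurable borel"
  unfolding eta_def[abs_def] by measurable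

lemma (in prob_space) integrable_unit:
  fixes g :: "'a \<Rightarrow> real"
  assumes "g \<in> borel_measurable M" "\<And>y. y \<in> space M \<Longrightarrow> 0 \<le> g y \<and> g y \<le> 1"
  shows "integrable M g"
  using assms by (intro integrable_const_bound[of _ 1]) auto

text \<open>Jensen's inequality for \<open>eta\<close> with respect to the unnormalised weight \<open>w\<close>.\<close>

lemma (in prob_space) integral_eta_le:
  fixes r w :: "'a \<Rightarrow> real"
  assumes r[measurable]: "r \<in> borel_measurable M" and w[measurable]: "w \<in> borel_measurable M"
    and r01: "\<And>y. y \<in> space M \<Longrightarrow> 0 \<le> r y \<and> r y \<le> 1"
    and w01: "\<And>y. y \<in> space M \<Longrightarrow> 0 \<le> w y \<and> w y \<le> 1"
  shows "(\<integral>y. eta (r y) * w y \<partial>M) \<le> eta (\<integral>y. r y * w y \<partial>M) + (\<integral>y. r y * w y \<partial>M) * ln (\<integral>y. w y \<partial>M)"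
proof -
  define p where "p = (\<integral>y. r y * w y \<partial>M)"
  define s where "s = (\<integral>y. w y \<partial>M)"
  have irw: "integrable M (\<lambda>y. r y * w y)"
    using r01 w01 by (intro integrable_unit) (auto intro: mult_le_one)
  have iw: "integrable M w" using w01 by (intro integrable_unit) auto
  have ie: "integrable M (\<lambda>y. eta (r y) * w y)"
    using r01 w01 by (intro integrable_unit) (auto intro!: mult_le_one mult_nonneg_nonneg eta_nonneg eta_le_1)
  have p0: "0 \<le> p" unfolding p_def using r01 w01 by (intro integral_nonneg_AE AE_I2) auto
  have ps: "p \<le> s"
    unfolding p_def s_def using r01 w01 by (intro integral_mono irw iw) (auto intro: mult_left_le_one_le)
  show ?thesis
  proof (cases "p = 0")
    case True
    have "AE y in M. r y * w y = 0"
      using True irw r01 w01 unfolding p_def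
      by (subst (asm) integral_nonneg_eq_0_iff_AE) auto
    then have "AE y in M. eta (r y) * w y = 0" by (auto elim!: eventually_mono)
    then have "(\<integral>y. eta (r y) * w y \<partial>M) = (\<integral>y. 0 \<partial>M)"
      by (intro integral_cong_AE) auto
    then show ?thesis using True by (simp add: p_def)
  next
    case False
    then have p: "0 < p" using p0 by simp
    then have s: "0 < s" using ps by simp
    define t where "t = p / s"
    have t: "0 < t" using p s by (simp add: t_def)
    have "(\<integral>y. eta (r y) * w y \<partial>M) \<le> (\<integral>y. t * w y - (1 + ln t) * (r y * w y) \<partial>M)"
    proof (rule integral_mono[OF ie])
      show "integrable M (\<lambda>y. t * w y - (1 + ln t) * (r y * w y))" using irw iw by auto
      fix y assume y: "y \<in> space M"
      have "eta (r y) * w y \<le> (t - r y - r y * ln t) * w y"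
        using r01[OF y] w01[OF y] t by (intro mult_right_mono eta_tangent) auto
      then show "eta (r y) * w y \<le> t * w y - (1 + ln t) * (r y * w y)" by (simp add: algebra_simps)
    qed
    also have "\<dots> = t * s - (1 + ln t) * p"
      using irw iw by (simp add: p_def s_def)
    also have "\<dots> = eta p + p * ln s"
      using p s by (simp add: t_def eta_def ln_div algebra_simps)
    finally show ?thesis by (simp add: p_def s_def)
  qed
qed

lemma (in prob_space) cond_entropy_eq_sum:
  assumes F: "simple_function M F" and G: "simple_function M G" and L: "finite L" "G ` space M \<subseteq> L"
  shows "cond_entropy M F G = (\<Sum>l\<in>L. \<Sum>v\<in>F ` space M.
    eta (prob ((\<lambda>x. (F x, G x)) -` {(v, l)} \<inter> space M))
    + prob ((\<lambda>x. (F x, G x)) -` {(v, l)} \<inter> space M) * ln (prob (G -` {l} \<inter> space M)))"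
proof -
  let ?V = "F ` space M"
  let ?p = "\<lambda>v l. prob ((\<lambda>x. (F x, G x)) -` {(v, l)} \<inter> space M)"
  have finV: "finite ?V" using simple_functionD(1)[OF F] .
  have 1: "rv_entropy M (\<lambda>x. (F x, G x)) = (\<Sum>l\<in>L. \<Sum>v\<in>?V. eta (?p v l))"
    by (subst rv_entropy_superset[of "?V \<times> L"], use finV L in force, use L in force,
        subst sum.swap, simp add: sum.cartesian_product case_prod_beta)
  have 2: "eta (prob (G -` {l} \<inter> space M)) = - (\<Sum>v\<in>?V. ?p v l * ln (prob (G -` {l} \<inter> space M)))" for l
    unfolding eta_def sum_distrib_right[symmetric] prob_fibre_eq_sum'[OF G F, symmetric] ..
  have "rv_entropy M G = - (\<Sum>l\<in>L. \<Sum>v\<in>?V. ?p v l * ln (prob (G -` {l} \<inter> space M)))"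
    unfolding rv_entropy_superset[OF L] 2 by (simp add: sum_negf)
  then show ?thesis unfolding cond_entropy_def 1 by (simp add: sum.distrib)
qed

text \<open>Lower bound: \<open>G\<close> is a random label that is conditionally independent of \<open>F\<close> given the point, with
  conditional probabilities \<open>w l y\<close>. It carries no more information about \<open>F\<close> than the point.\<close>

lemma (in prob_space) point_cond_entropy_le:
  fixes w :: "'e \<Rightarrow> 'd \<Rightarrow> real"
  assumes F: "simple_function M F" and G: "simple_function M G" and L: "finite L" "G ` space M \<subseteq> L"
    and N: "prob_space N"
    and r: "\<And>v. v \<in> F ` space M \<Longrightarrow> r v \<in> borel_measurable N"
      "\<And>v y. v \<in> F ` space M \<Longrightarrow> y \<in> space N \<Longrightarrow> 0 \<le> r v y \<and> r v y \<le> 1"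
    and w: "\<And>l. l \<in> L \<Longrightarrow> w l \<in> borel_measurable N"
      "\<And>l y. l \<in> L \<Longrightarrow> y \<in> space N \<Longrightarrow> 0 \<le> w l y"
      "\<And>y. y \<in> space N \<Longrightarrow> (\<Sum>l\<in>L. w l y) = 1"
    and joint: "\<And>v l. v \<in> F ` space M \<Longrightarrow> l \<in> L \<Longrightarrow>
      prob ((\<lambda>x. (F x, G x)) -` {(v, l)} \<inter> space M) = (\<integral>y. r v y * w l y \<partial>N)"
    and marg: "\<And>l. l \<in> L \<Longrightarrow> prob (G -` {l} \<inter> space M) = (\<integral>y. w l y \<partial>N)"
  shows "point_cond_entropy N (F ` space M) r \<le> cond_entropy M F G"
proof -
  interpret N: prob_space N by (rule N)
  let ?V = "F ` space M"
  have w1: "w l y \<le> 1" if "l \<in> L" "y \<in> space N" for l y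
    using member_le_sum[of l L "\<lambda>l. w l y"] w that L by auto
  have "point_cond_entropy N ?V r = (\<Sum>v\<in>?V. \<integral>y. (\<Sum>l\<in>L. eta (r v y) * w l y) \<partial>N)"
    unfolding point_cond_entropy_def
    by (intro sum.cong refl Bochner_Integration.integral_cong) (simp_all add: sum_distrib_left[symmetric] w)
  also have "\<dots> = (\<Sum>v\<in>?V. \<Sum>l\<in>L. \<integral>y. eta (r v y) * w l y \<partial>N)"
  proof (intro sum.cong refl Bochner_Integration.integral_sum N.integrable_unit)
    fix v l assume v: "v \<in> ?V" and l: "l \<in> L"
    note [measurable] = r(1)[OF v] w(1)[OF l]
    show "(\<lambda>y. eta (r v y) * w l y) \<in> borel_measurable N" by measurable
    show "0 \<le> eta (r v y) * w l y \<and> eta (r v y) * w l y \<le> 1" if "y \<in> space N" for y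
      using r(2)[OF v that] w(2)[OF l that] w1[OF l that] by (auto intro!: mult_le_one mult_nonneg_nonneg eta_nonneg eta_le_1)
  qed
  also have "\<dots> \<le> (\<Sum>v\<in>?V. \<Sum>l\<in>L. eta (\<integral>y. r v y * w l y \<partial>N) + (\<integral>y. r v y * w l y \<partial>N) * ln (\<integral>y. w l y \<partial>N))"
    by (intro sum_mono N.integral_eta_le) (use r w w1 in auto)
  also have "\<dots> = cond_entropy M F G"
    unfolding cond_entropy_eq_sum[OF F G L] by (subst sum.swap) (simp add: joint marg)
  finally show ?thesis .
qed

text \<open>Upper bound: the conditional entropy given the point \<open>Y\<close> is approached by finite partitions of
  its space, on whose cells all the conditional probabilities \<open>r v\<close> are nearly constant.\<close>

lemma (in prob_space) ex_cond_entropy_le_point: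
  fixes F :: "'a \<Rightarrow> 'c" and N :: "'d measure"
  assumes F: "simple_function M F" and Y: "Y \<in> M \<rightarrow>\<^sub>M N" "distr M N Y = N"
    and r: "\<And>v. v \<in> F ` space M \<Longrightarrow> r v \<in> borel_measurable N"
      "\<And>v y. v \<in> F ` space M \<Longrightarrow> y \<in> space N \<Longrightarrow> 0 \<le> r v y \<and> r v y \<le> 1"
    and joint: "\<And>v A. v \<in> F ` space M \<Longrightarrow> A \<in> sets N \<Longrightarrow>
      prob {x \<in> space M. F x = v \<and> Y x \<in> A} = (\<integral>y. r v y * indicator A y \<partial>N)"
    and "0 < e"
  obtains c :: "'d \<Rightarrow> 'c \<Rightarrow> int" where "simple_function N c"
    "cond_entropy M F (\<lambda>x. c (Y x)) \<le> point_cond_entropy N (F ` space M) r + e"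
proof -
  let ?V = "F ` space M"
  have finV: "finite ?V" using simple_functionD(1)[OF F] .
  have "prob_space (distr M N Y)" using Y(1) by (rule prob_space_distr)
  then interpret N: prob_space N by (simp add: Y)
  define e' where "e' = e / (card ?V + 1)"
  have e': "0 < e'" using \<open>0 < e\<close> by (simp add: e'_def)
  obtain d where d: "0 < d" "\<And>s t. 0 \<le> s \<Longrightarrow> s \<le> 1 \<Longrightarrow> 0 \<le> t \<Longrightarrow> t \<le> 1 \<Longrightarrow> \<bar>s - t\<bar> < d \<Longrightarrow> \<bar>eta s - eta t\<bar> < e'"
    using eta_uniformly_continuous[OF e'] by metis
  obtain c :: "'d \<Rightarrow> 'c \<Rightarrow> int" where c: "simple_function N c"
    "\<And>v y z. v \<in> ?V \<Longrightarrow> c y = c z \<Longrightarrow> \<bar>r v y - r v z\<bar> < d / 2"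
  proof (rule ex_simple_function_bins[where r=r and M=N and d="d / 2" and V="F ` space M"])
    show "0 < d / 2" using d(1) by simp
  qed (use finV r in auto)
  let ?G = "\<lambda>x. c (Y x)"
  let ?L = "c ` space N"
  have finL: "finite ?L" using simple_functionD(1)[OF c(1)] .
  have sG: "simple_function M ?G" by (rule simple_function_comp[OF Y(1) c(1)])
  have GL: "?G ` space M \<subseteq> ?L" using measurable_space[OF Y(1)] by auto
  define A where "A l = c -` {l} \<inter> space N" for l
  have A: "A l \<in> sets N" for l unfolding A_def using simple_functionD(2)[OF c(1)] .
  have p: "prob ((\<lambda>x. (F x, ?G x)) -` {(v, l)} \<inter> space M) = (\<integral>y. r v y * indicator (A l) y \<partial>N)" if "v \<in> ?V" for v l
  proof -
    have "(\<lambda>x. (F x, ?G x)) -` {(v, l)} \<inter> space M = {x \<in> space M. F x = v \<and> Y x \<in> A l}"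
      using measurable_space[OF Y(1)] by (auto simp: A_def)
    then show ?thesis using joint[OF that A] by simp
  qed
  have s: "prob (?G -` {l} \<inter> space M) = measure N (A l)" for l
  proof -
    have "?G -` {l} \<inter> space M = Y -` A l \<inter> space M"
      using measurable_space[OF Y(1)] by (auto simp: A_def)
    then have "prob (?G -` {l} \<inter> space M) = measure (distr M N Y) (A l)"
      using Y(1) A by (simp add: measure_distr)
    then show ?thesis by (simp add: Y)
  qed
  have cell: "eta (\<integral>y. r v y * indicator (A l) y \<partial>N) + (\<integral>y. r v y * indicator (A l) y \<partial>N) * ln (measure N (A l))
      \<le> (\<integral>y. eta (r v y) * indicator (A l) y \<partial>N) + e' * measure N (A l)" if v: "v \<in> ?V" for v l
  proof -
    note [measurable] = r(1)[OF v] A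
    define q where "q = (\<integral>y. r v y * indicator (A l) y \<partial>N)"
    define m where "m = measure N (A l)"
    have int: "integrable N (\<lambda>y. g (r v y) * indicator (A l) y)"
      if "g \<in> borel_measurable borel" "\<And>t. 0 \<le> t \<Longrightarrow> t \<le> 1 \<Longrightarrow> 0 \<le> g t \<and> g t \<le> 1" for g :: "real \<Rightarrow> real"
    proof (rule N.integrable_unit)
      note [measurable] = that(1)
      show "(\<lambda>y. g (r v y) * indicator (A l) y) \<in> borel_measurable N" by measurable
    qed (use that(2) r(2)[OF v] in \<open>auto simp: indicator_def\<close>)
    have intr: "integrable N (\<lambda>y. r v y * indicator (A l) y)" by (rule int[of "\<lambda>t. t"]) auto
    have inte: "integrable N (\<lambda>y. eta (r v y) * indicator (A l) y)"
      by (rule int) (auto intro: eta_nonneg eta_le_1)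
    have intc: "integrable N (\<lambda>y. k * indicator (A l) y)" "(\<integral>y. k * indicator (A l) y \<partial>N) = k * m" for k :: real
      using A N.emeasure_finite by (auto simp: m_def less_top[symmetric])
    have q0: "0 \<le> q" unfolding q_def using r(2)[OF v] by (intro integral_nonneg_AE AE_I2) (auto simp: indicator_def)
    have qm: "q \<le> 1 * m"
      unfolding q_def intc(2)[symmetric] using r(2)[OF v]
      by (intro integral_mono intr intc) (auto simp: indicator_def)
    have e0: "0 \<le> (\<integral>y. eta (r v y) * indicator (A l) y \<partial>N)"
      using r(2)[OF v] by (intro integral_nonneg_AE AE_I2) (auto simp: indicator_def intro: eta_nonneg)
    have "eta q + q * ln m \<le> (\<integral>y. eta (r v y) * indicator (A l) y \<partial>N) + e' * m"
    proof (cases "m = 0")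
      case True
      then have "q = 0" using q0 qm by simp
      then show ?thesis using True e0 by simp
    next
      case False
      then have m: "0 < m" by (simp add: m_def less_le)
      define t where "t = q / m"
      have t: "0 \<le> t" "t \<le> 1" using q0 qm m by (auto simp: t_def)
      have near: "\<bar>r v y - t\<bar> < d" if y: "y \<in> A l" for y
      proof -
        have "\<bar>r v z - r v y\<bar> < d / 2" if "z \<in> A l" for z
          using that y by (intro c(2)[OF v]) (auto simp: A_def)
        then have osc: "r v z \<le> r v y + d / 2" "r v y - d / 2 \<le> r v z" if "z \<in> A l" for z
          using that by (smt (verit))+
        have "q \<le> (r v y + d / 2) * m"
          unfolding q_def intc(2)[symmetric]
          using osc by (intro integral_mono intr intc) (auto simp: indicator_def)
        moreover have "(r v y - d / 2) * m \<le> q"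
          unfolding q_def intc(2)[symmetric]
          using osc by (intro integral_mono intr intc) (auto simp: indicator_def)
        ultimately have "t \<le> r v y + d / 2" "r v y - d / 2 \<le> t"
          using m by (auto simp: t_def field_simps)
        then show ?thesis using d(1) by linarith
      qed
      have "eta q + q * ln m = eta t * m"
        using m q0 by (cases "q = 0") (auto simp: t_def eta_def ln_div algebra_simps)
      also have "\<dots> = (\<integral>y. eta t * indicator (A l) y \<partial>N)" by (simp only: intc(2))
      also have "\<dots> \<le> (\<integral>y. eta (r v y) * indicator (A l) y + e' * indicator (A l) y \<partial>N)"
      proof (intro integral_mono Bochner_Integration.integrable_add intc inte)
        fix y assume y: "y \<in> space N"
        show "eta t * indicator (A l) y \<le> eta (r v y) * indicator (A l) y + e' * indicator (A l) y"
        proof (cases "y \<in> A l")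
          case True
          have "\<bar>eta (r v y) - eta t\<bar> < e'"
            using near[OF True] r(2)[OF v y] t by (intro d(2)) auto
          then show ?thesis using True by simp
        qed simp
      qed
      also have "\<dots> = (\<integral>y. eta (r v y) * indicator (A l) y \<partial>N) + e' * m"
        by (simp only: Bochner_Integration.integral_add[OF inte intc(1)] intc(2))
      finally show ?thesis .
    qed
    then show ?thesis by (simp add: q_def m_def)
  qed
  have sumA: "(\<Sum>l\<in>?L. indicator (A l) y) = (1::real)" if "y \<in> space N" for y
  proof -
    have "(\<Sum>l\<in>?L. indicator (A l) y) = (\<Sum>l\<in>?L. if l = c y then 1 else (0::real))"
      using that by (intro sum.cong) (auto simp: A_def indicator_def)
    then show ?thesis using finL that by simp
  qed
  have "cond_entropy M F ?G = (\<Sum>l\<in>?L. \<Sum>v\<in>?V.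
      eta (\<integral>y. r v y * indicator (A l) y \<partial>N) + (\<integral>y. r v y * indicator (A l) y \<partial>N) * ln (measure N (A l)))"
    unfolding cond_entropy_eq_sum[OF F sG finL GL] s by (intro sum.cong refl) (simp add: p)
  also have "\<dots> \<le> (\<Sum>l\<in>?L. \<Sum>v\<in>?V. (\<integral>y. eta (r v y) * indicator (A l) y \<partial>N) + e' * measure N (A l))"
    by (intro sum_mono cell)
  also have "\<dots> = (\<Sum>v\<in>?V. \<Sum>l\<in>?L. \<integral>y. eta (r v y) * indicator (A l) y \<partial>N)
      + card ?V * (e' * (\<Sum>l\<in>?L. measure N (A l)))"
    by (simp add: sum.distrib sum_distrib_left sum.swap[of _ ?V])
  also have "(\<Sum>l\<in>?L. measure N (A l)) = 1"
  proof -
    have "(\<Sum>l\<in>?L. measure N (A l)) = (\<integral>y. (\<Sum>l\<in>?L. indicator (A l) y) \<partial>N)"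
      using A N.emeasure_finite by (subst Bochner_Integration.integral_sum) (auto simp: less_top[symmetric])
    also have "\<dots> = (\<integral>y. 1 \<partial>N)" using sumA by (intro Bochner_Integration.integral_cong) auto
    finally show ?thesis by (simp add: N.prob_space)
  qed
  also have "(\<Sum>v\<in>?V. \<Sum>l\<in>?L. \<integral>y. eta (r v y) * indicator (A l) y \<partial>N) = point_cond_entropy N ?V r"
    unfolding point_cond_entropy_def
  proof (intro sum.cong refl)
    fix v assume v: "v \<in> ?V"
    note [measurable] = r(1)[OF v] A
    have "(\<Sum>l\<in>?L. \<integral>y. eta (r v y) * indicator (A l) y \<partial>N) = (\<integral>y. (\<Sum>l\<in>?L. eta (r v y) * indicator (A l) y) \<partial>N)"
    proof (intro Bochner_Integration.integral_sum[symmetric] N.integrable_unit)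
      show "0 \<le> eta (r v y) * indicator (A l) y \<and> eta (r v y) * indicator (A l) y \<le> 1" if "y \<in> space N" for l y
        using r(2)[OF v that] by (auto simp: indicator_def intro: eta_nonneg eta_le_1)
    qed measurable
    also have "\<dots> = (\<integral>y. eta (r v y) \<partial>N)"
      by (intro Bochner_Integration.integral_cong refl) (simp only: sum_distrib_left[symmetric] sumA mult_1_right)
    finally show "(\<Sum>l\<in>?L. \<integral>y. eta (r v y) * indicator (A l) y \<partial>N) = (\<integral>y. eta (r v y) \<partial>N)" .
  qed
  also have "real (card ?V) * (e' * 1) \<le> e"
    using \<open>0 < e\<close> by (simp add: e'_def field_simps)
  finally have "cond_entropy M F ?G \<le> point_cond_entropy N ?V r + e" by simp
  with c(1) show ?thesis by (rule that)
qed

section \<open>The law of a stationary Markov process\<close>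

text \<open>The product spaces of all sequences, and of the first \<open>n\<close> coordinates.\<close>

abbreviation paths :: "'a::topological_space set \<Rightarrow> (nat \<Rightarrow> 'a) measure" where
  "paths X \<equiv> PiM UNIV (\<lambda>_. borel_on X)"

abbreviation prefixes :: "'a::topological_space set \<Rightarrow> nat \<Rightarrow> (nat \<Rightarrow> 'a) measure" where
  "prefixes X n \<equiv> PiM {0..<n} (\<lambda>_. borel_on X)"

text \<open>The integral of \<open>\<phi> (x n)\<close> over the paths that start at \<open>x\<close> and visit the sets
  \<open>b 0, \<dots>, b (n - 1)\<close> of the list at the first \<open>n\<close> times.\<close>

primrec path_weight :: "('a \<Rightarrow> 'a measure) \<Rightarrow> ('a \<Rightarrow> ennreal) \<Rightarrow> 'a set list \<Rightarrow> 'a \<Rightarrow> ennreal" where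
  "path_weight Q \<phi> [] x = \<phi> x"
| "path_weight Q \<phi> (b # bs) x = indicator b x * (\<integral>\<^sup>+y. path_weight Q \<phi> bs y \<partial>Q x)"

lemma path_weight_append:
  "path_weight Q \<phi> (cs @ bs) = path_weight Q (path_weight Q \<phi> bs) cs"
  by (induction cs) (auto simp: fun_eq_iff)

text \<open>The sequences in \<open>X\<close> whose first coordinates lie in the listed sets.\<close>

definition cylinder :: "'a set \<Rightarrow> 'a set list \<Rightarrow> (nat \<Rightarrow> 'a) set" where
  "cylinder X bs = {\<omega>. (\<forall>i. \<omega> i \<in> X) \<and> (\<forall>i<length bs. \<omega> i \<in> bs ! i)}"

lemma cylinder_Cons: "\<omega> \<in> cylinder X (b # bs) \<longleftrightarrow> \<omega> 0 \<in> X \<and> \<omega> 0 \<in> b \<and> orbit_shift \<omega> \<in> cylinder X bs"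
  unfolding cylinder_def orbit_shift_def
  by (auto simp: nth_Cons less_Suc_eq_0_disj split: nat.splits)
     (metis not0_implies_Suc)+

lemma sets_cylinder:
  assumes "set bs \<subseteq> sets (borel_on X)"
  shows "cylinder X bs \<in> sets (paths X)"
proof -
  have "cylinder X bs = {\<omega> \<in> space (paths X). \<forall>i\<in>{..<length bs}. \<omega> i \<in> bs ! i}"
    by (auto simp: cylinder_def space_PiM PiE_iff)
  also have "\<dots> \<in> sets (paths X)"
  proof (intro sets.sets_Collect_finite_All)
    fix i assume "i \<in> {..<length bs}"
    then have "bs ! i \<in> sets (borel_on X)" using assms by (auto simp: subset_iff)
    then show "{\<omega> \<in> space (paths X). \<omega> i \<in> bs ! i} \<in> sets (paths X)"
      by measurable
  qed auto
  finally show ?thesis .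
qed

lemma measure_eqI_cylinder:
  fixes P P' :: "(nat \<Rightarrow> 'a::metric_space) measure"
  assumes sets: "sets P = sets (paths X)" "sets P' = sets (paths X)"
    and fin: "finite_measure P"
    and eq: "\<And>bs. set bs \<subseteq> sets (borel_on X) \<Longrightarrow> emeasure P (cylinder X bs) = emeasure P' (cylinder X bs)"
  shows "P = P'"
proof (rule measure_eqI_PiM_infinite[OF sets])
  fix A :: "nat \<Rightarrow> 'a set" and J :: "nat set"
  assume J: "finite J" and A: "\<And>i. i \<in> J \<Longrightarrow> A i \<in> sets (borel_on X)"
  obtain n where n: "J \<subseteq> {..<n}" using finite_nat_iff_bounded J by auto
  define bs where "bs = map (\<lambda>i. if i \<in> J then A i else X) [0..<n]"
  have bs: "set bs \<subseteq> sets (borel_on X)" using A by (auto simp: bs_def carrier_in_sets_borel_on)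
  have "prod_emb UNIV (\<lambda>_. borel_on X) J (Pi\<^sub>E J A) = cylinder X bs"
  proof -
    have "i < n" if "i \<in> J" for i using n that by auto
    then show ?thesis
      by (auto simp: prod_emb_def cylinder_def bs_def PiE_iff extensional_def space_PiM)
  qed
  with eq[OF bs] show "emeasure P (prod_emb UNIV (\<lambda>_. borel_on X) J (Pi\<^sub>E J A))
      = emeasure P' (prod_emb UNIV (\<lambda>_. borel_on X) J (Pi\<^sub>E J A))" by simp
qed (use fin in auto)

lemma measure_eqI_rectangles:
  fixes X :: "'a::metric_space set"
  assumes X: "compact X" and sets: "sets P = sets (borel_on (X \<times> X))" "sets P' = sets (borel_on (X \<times> X))"
    and fin: "finite_measure P"
    and eq: "\<And>A B. A \<in> sets (borel_on X) \<Longrightarrow> B \<in> sets (borel_on X) \<Longrightarrow> emeasure P (A \<times> B) = emeasure P' (A \<times> B)"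
  shows "P = P'"
proof (rule measure_eqI_generator_eq[where A="\<lambda>_. X \<times> X" and \<Omega>="X \<times> X"
      and E="{A \<times> B | A B. A \<in> sets (borel_on X) \<and> B \<in> sets (borel_on X)}"])
  show "Int_stable {A \<times> B | A B. A \<in> sets (borel_on X) \<and> B \<in> sets (borel_on X)}"
    by (rule Int_stable_pair_measure_generator)
  show "{A \<times> B | A B. A \<in> sets (borel_on X) \<and> B \<in> sets (borel_on X)} \<subseteq> Pow (X \<times> X)"
    using sets.sets_into_space[of _ "borel_on X"] by fastforce
  have "sets (borel_on (X \<times> X)) = sigma_sets (X \<times> X) {A \<times> B | A B. A \<in> sets (borel_on X) \<and> B \<in> sets (borel_on X)}"
    unfolding sets_borel_on_Times[OF X X] sets_pair_measure by simp
  then show "sets P = sigma_sets (X \<times> X) {A \<times> B | A B. A \<in> sets (borel_on X) \<and> B \<in> sets (borel_on X)}"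
    "sets P' = sigma_sets (X \<times> X) {A \<times> B | A B. A \<in> sets (borel_on X) \<and> B \<in> sets (borel_on X)}"
    by (simp_all add: sets)
  show "range (\<lambda>_::nat. X \<times> X) \<subseteq> {A \<times> B | A B. A \<in> sets (borel_on X) \<and> B \<in> sets (borel_on X)}"
    using carrier_in_sets_borel_on by auto
  show "emeasure P (X \<times> X) \<noteq> \<infinity>"
    using finite_measure.emeasure_finite[OF fin] by auto
qed (use eq in auto)

text \<open>On a compact metric space the complement of the support is a null set, being covered by countably
  many null balls.\<close>

lemma measure_support_null:
  fixes X :: "'a::metric_space set"
  assumes X: "compact X" and M: "sets M = sets (borel_on X)"
  obtains N where "N \<in> null_sets M" "X - measure_support M \<subseteq> N"
proof -
  have sp: "space M = X" using sets_eq_imp_space_eq[OF M] by simp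
  obtain D where D: "countable D" "D \<subseteq> X" "\<And>y e. y \<in> X \<Longrightarrow> 0 < e \<Longrightarrow> \<exists>d\<in>D. dist d y < e"
    using compact_imp_separable[OF X] by metis
  define I where "I = {(d, q). d \<in> D \<and> q \<in> \<rat> \<and> ball d q \<inter> X \<in> null_sets M}"
  have "countable I"
    by (rule countable_subset[of _ "D \<times> \<rat>"]) (auto simp: I_def D(1) countable_rat)
  define N where "N = (\<Union>p\<in>I. ball (fst p) (snd p) \<inter> X)"
  have "N \<in> null_sets M"
    unfolding N_def using \<open>countable I\<close> by (rule null_sets_UN') (auto simp: I_def)
  moreover have "X - measure_support M \<subseteq> N"
  proof
    fix y assume y: "y \<in> X - measure_support M"
    then obtain U where U: "openin (top_of_set X) U" "y \<in> U" "emeasure M U = 0"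
      by (auto simp: measure_support_def sp not_less)
    obtain V where V: "open V" "U = V \<inter> X" using U(1) by (auto simp: openin_open)
    obtain d q where dq: "d \<in> D" "q \<in> \<rat>" "y \<in> ball d q" "ball d q \<subseteq> V"
      by (rule dense_rational_ball[of D y V]) (use D(3) y U V in auto)
    then have sub: "ball d q \<inter> X \<subseteq> U" using V by auto
    have Us: "U \<in> sets M" "ball d q \<inter> X \<in> sets M"
      unfolding M using U(1) by (auto intro!: openin_imp_sets_borel_on simp: Int_commute openin_open_Int)
    have "emeasure M (ball d q \<inter> X) \<le> emeasure M U"
      using sub Us by (intro emeasure_mono) auto
    then have "(d, q) \<in> I" using dq Us U(3) by (auto simp: I_def)
    then show "y \<in> N" using y dq by (auto simp: N_def intro!: bexI[of _ "(d, q)"])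
  qed
  ultimately show ?thesis by (rule that)
qed

lemma product_partition_fibres:
  "product_partition (fibres (borel_on X) f) n
    = fibres (prefixes X n) (\<lambda>\<omega>. map (\<lambda>i. f (\<omega> i)) [0..<n])"
  (is "_ = fibres _ ?F")
proof -
  have cell: "PiE {0..<n} B = ?F -` {map (\<lambda>i. f (x i)) [0..<n]} \<inter> PiE {0..<n} (\<lambda>_. X)"
    if "\<And>i. i < n \<Longrightarrow> B i = f -` {f (x i)} \<inter> X" for B x
    using that by (auto simp: PiE_iff)
  show ?thesis
  proof (intro set_eqI iffI)
    fix D assume "D \<in> product_partition (fibres (borel_on X) f) n"
    then obtain B where B: "B \<in> {0..<n} \<rightarrow> fibres (borel_on X) f" "D = PiE {0..<n} B"
      by (auto simp: product_partition_def)
    have "\<exists>x. x \<in> X \<and> B i = f -` {f x} \<inter> X" if "i < n" for i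
    proof -
      have "B i \<in> fibres (borel_on X) f" using B(1) that by auto
      then show ?thesis by (auto simp: fibres_def)
    qed
    then have "\<exists>x. \<forall>i<n. x i \<in> X \<and> B i = f -` {f (x i)} \<inter> X" by metis
    then obtain x where x: "\<And>i. i < n \<Longrightarrow> x i \<in> X \<and> B i = f -` {f (x i)} \<inter> X" by blast
    have "map (\<lambda>i. f (x i)) [0..<n] \<in> ?F ` PiE {0..<n} (\<lambda>_. X)"
      by (rule image_eqI[of _ _ "restrict x {0..<n}"]) (use x in auto)
    moreover have "D = ?F -` {map (\<lambda>i. f (x i)) [0..<n]} \<inter> PiE {0..<n} (\<lambda>_. X)"
      unfolding B(2) by (rule cell) (use x in auto)
    ultimately show "D \<in> fibres (prefixes X n) ?F"
      unfolding fibres_def space_PiM space_borel_on by blast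
  next
    fix D assume "D \<in> fibres (prefixes X n) ?F"
    then obtain x where x: "x \<in> PiE {0..<n} (\<lambda>_. X)"
      "D = ?F -` {map (\<lambda>i. f (x i)) [0..<n]} \<inter> PiE {0..<n} (\<lambda>_. X)"
      by (auto simp: fibres_def space_PiM)
    have "D = PiE {0..<n} (\<lambda>i. f -` {f (x i)} \<inter> X)"
      unfolding x(2) by (rule cell[symmetric]) simp
    moreover have "(\<lambda>i. f -` {f (x i)} \<inter> X) \<in> {0..<n} \<rightarrow> fibres (borel_on X) f"
      using x by (auto simp: fibres_def PiE_iff)
    ultimately show "D \<in> product_partition (fibres (borel_on X) f) n"
      by (auto simp: product_partition_def)
  qed
qed

text \<open>A Borel kernel on \<open>X\<close> and an initial law, not required to be stationary.\<close>

locale markov_kernel =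
  fixes X :: "'a::metric_space set" and Q :: "'a \<Rightarrow> 'a measure" and \<mu> :: "'a measure"
  assumes compact_X: "compact X" and \<mu>_borel: "\<mu> \<in> borel_probs X"
    and Q_prob [measurable]: "Q \<in> borel_on X \<rightarrow>\<^sub>M prob_algebra (borel_on X)"
begin

lemma sets_\<mu> [measurable_cong]: "sets \<mu> = sets (borel_on X)"
  using \<mu>_borel by (auto simp: borel_probs_def)

lemma space_\<mu>: "space \<mu> = X"
  using sets_eq_imp_space_eq[OF sets_\<mu>] by simp

sublocale \<mu>: prob_space \<mu>
  using \<mu>_borel by (auto simp: borel_probs_def)

lemma Q_subprob [measurable]: "Q \<in> borel_on X \<rightarrow>\<^sub>M subprob_algebra (borel_on X)"
  by (rule measurable_prob_algebraD[OF Q_prob])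

lemma prob_space_Q: "x \<in> X \<Longrightarrow> prob_space (Q x)" and sets_Q: "x \<in> X \<Longrightarrow> sets (Q x) = sets (borel_on X)"
  using measurable_space[OF Q_prob, of x] by (auto simp: space_prob_algebra)

lemma space_Q: "x \<in> X \<Longrightarrow> space (Q x) = X"
  using sets_eq_imp_space_eq[OF sets_Q] by simp

text \<open>The law \<open>\<mu>(dx) Q\<^sub>x(dy)\<close> of the first two coordinates, on the whole square.\<close>

definition pair_law :: "('a \<times> 'a) measure" where
  "pair_law = \<mu> \<bind> (\<lambda>x. distr (Q x) (borel_on (X \<times> X)) (Pair x))"

lemma measurable_pair_kernel:
  "(\<lambda>x. distr (Q x) (borel_on (X \<times> X)) (Pair x)) \<in> borel_on X \<rightarrow>\<^sub>M prob_algebra (borel_on (X \<times> X))"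
proof -
  have "(\<lambda>(x, y). Pair x y) \<in> borel_on X \<Otimes>\<^sub>M borel_on X \<rightarrow>\<^sub>M borel_on (X \<times> X)"
    by (simp add: measurable_cong_sets[OF refl sets_borel_on_Times[OF compact_X compact_X]])
  then show ?thesis by (rule measurable_distr_prob_space2[OF Q_prob])
qed

lemma sets_pair_law: "sets pair_law = sets (borel_on (X \<times> X))"
  unfolding pair_law_def using \<mu>.not_empty by (intro sets_bind) (auto simp: space_\<mu>)

lemma emeasure_pair_law:
  assumes "A \<in> sets (borel_on (X \<times> X))"
  shows "emeasure pair_law A = (\<integral>\<^sup>+x. emeasure (Q x) (Pair x -` A \<inter> X) \<partial>\<mu>)"
proof -
  have "emeasure pair_law A = (\<integral>\<^sup>+x. emeasure (distr (Q x) (borel_on (X \<times> X)) (Pair x)) A \<partial>\<mu>)"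
    unfolding pair_law_def using \<mu>.not_empty measurable_prob_algebraD[OF measurable_pair_kernel] assms
    by (intro emeasure_bind) (auto simp: measurable_cong_sets[OF sets_\<mu> refl])
  also have "\<dots> = (\<integral>\<^sup>+x. emeasure (Q x) (Pair x -` A \<inter> X) \<partial>\<mu>)"
  proof (rule nn_integral_cong)
    fix x assume "x \<in> space \<mu>"
    then have x: "x \<in> X" by (simp add: space_\<mu>)
    have "Pair x \<in> Q x \<rightarrow>\<^sub>M borel_on (X \<times> X)"
      unfolding measurable_cong_sets[OF sets_Q[OF x] sets_borel_on_Times[OF compact_X compact_X]]
      using x by (intro measurable_Pair1') simp
    then show "emeasure (distr (Q x) (borel_on (X \<times> X)) (Pair x)) A = emeasure (Q x) (Pair x -` A \<inter> X)"
      using assms by (simp add: emeasure_distr space_Q[OF x])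
  qed
  finally show ?thesis .
qed

lemma emeasure_pair_law_Times:
  assumes A: "A \<in> sets (borel_on X)" and B: "B \<in> sets (borel_on X)"
  shows "emeasure pair_law (A \<times> B) = (\<integral>\<^sup>+x. indicator A x * emeasure (Q x) B \<partial>\<mu>)"
proof -
  have "A \<times> B \<in> sets (borel_on (X \<times> X))"
    unfolding sets_borel_on_Times[OF compact_X compact_X] using A B by simp
  moreover have "Pair x -` (A \<times> B) \<inter> X = (if x \<in> A then B else {})" for x
    using sets.sets_into_space[OF B] by auto
  ultimately show ?thesis
    by (auto simp: emeasure_pair_law intro!: nn_integral_cong)
qed

end

text \<open>A kernel supported in the correspondence, with a stationary law. The law of the Markov process
  on all sequences (\<open>law\<close>) is restricted to the orbit space (\<open>\<nu>\<close>), which has full measure.\<close>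

locale stationary_markov =
  fixes X :: "'a::metric_space set" and T :: "'a \<Rightarrow> 'a set" and Q :: "'a \<Rightarrow> 'a measure" and \<mu> :: "'a measure"
  assumes compact_space: "compact X" and corr: "correspondence X T"
    and Q: "Q \<in> kernels X T" and \<mu>: "\<mu> \<in> stationary_probs X Q"
begin

sublocale markov_kernel X Q \<mu>
  using compact_space \<mu> Q by unfold_locales (auto simp: stationary_probs_def kernels_def)

lemma bind_\<mu>: "\<mu> \<bind> Q = \<mu>"
  using \<mu> by (auto simp: stationary_probs_def)

sublocale IT: Ionescu_Tulcea "markov_step \<mu> Q" "\<lambda>_. borel_on X"
  by (rule Ionescu_Tulcea_markov[OF \<mu>_borel Q])

abbreviation "law \<equiv> markov_law X \<mu> Q"
abbreviation "\<Omega> \<equiv> orbit_space X T"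
abbreviation "\<nu> \<equiv> markov_measure X T \<mu> Q"

lemma sets_law [measurable_cong]: "sets law = sets (paths X)"
  by (simp add: markov_law_def IT.PF.sets_lim)

lemma space_law: "space law = UNIV \<rightarrow>\<^sub>E X"
  using sets_eq_imp_space_eq[OF sets_law] by (simp add: space_PiM)

sublocale law: prob_space law
proof (rule prob_space_distrD)
  show "(\<lambda>\<omega>. restrict \<omega> {}) \<in> law \<rightarrow>\<^sub>M PiM {} (\<lambda>_. borel_on X)" by measurable
  show "prob_space (distr law (PiM {} (\<lambda>_. borel_on X)) (\<lambda>\<omega>. restrict \<omega> {}))"
    unfolding markov_law_def using IT.distr_lim[of "{}"] IT.PF.prob_space_P[of "{}"] by simp
qed

lemma nn_integral_path_law:
  assumes "f \<in> borel_measurable (prefixes X n)"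
  shows "(\<integral>\<^sup>+\<omega>. f \<omega> \<partial>path_law X \<mu> Q n) = (\<integral>\<^sup>+\<omega>. f (restrict \<omega> {0..<n}) \<partial>law)"
  unfolding path_law_def using assms
  by (intro nn_integral_distr) (auto intro!: measurable_restrict measurable_component_singleton simp: measurable_cong_sets[OF sets_law refl])

lemma nn_integral_path_law_Suc:
  assumes f: "f \<in> borel_measurable (prefixes X (Suc n))"
  shows "(\<integral>\<^sup>+\<omega>. f \<omega> \<partial>path_law X \<mu> Q (Suc n))
    = (\<integral>\<^sup>+\<omega>. (\<integral>\<^sup>+y. f (fun_upd \<omega> n y) \<partial>markov_step \<mu> Q n \<omega>) \<partial>path_law X \<mu> Q n)"
proof -
  have u: "(\<lambda>_. undefined) \<in> space (prefixes X 0)" by (simp add: space_PiM)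
  have "(\<integral>\<^sup>+\<omega>. f \<omega> \<partial>path_law X \<mu> Q (Suc n)) = (\<integral>\<^sup>+\<omega>. f \<omega> \<partial>(IT.C 0 n (\<lambda>_. undefined) \<bind> IT.eP n))"
    by (simp add: path_law_eq_C[OF \<mu>_borel Q])
  also have "\<dots> = (\<integral>\<^sup>+\<omega>. (\<integral>\<^sup>+\<omega>'. f \<omega>' \<partial>IT.eP n \<omega>) \<partial>IT.C 0 n (\<lambda>_. undefined))"
    using IT.measurable_eP[of n] IT.sets_C[OF u, of n]
    by (intro nn_integral_bind[OF f]) (simp add: measurable_cong_sets[OF IT.sets_C[OF u, of n] refl])
  also have "\<dots> = (\<integral>\<^sup>+\<omega>. (\<integral>\<^sup>+y. f (fun_upd \<omega> n y) \<partial>markov_step \<mu> Q n \<omega>) \<partial>IT.C 0 n (\<lambda>_. undefined))"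
    using IT.space_C[OF u, of n] by (intro nn_integral_cong IT.nn_integral_eP f) simp
  finally show ?thesis by (simp add: path_law_eq_C[OF \<mu>_borel Q])
qed

lemma measurable_path_weight:
  assumes "\<phi> \<in> borel_measurable (borel_on X)" "set bs \<subseteq> sets (borel_on X)"
  shows "path_weight Q \<phi> bs \<in> borel_measurable (borel_on X)"
  using assms(2)
proof (induction bs)
  case (Cons b bs)
  then have [measurable]: "path_weight Q \<phi> bs \<in> borel_measurable (borel_on X)" "b \<in> sets (borel_on X)" by auto
  have [measurable]: "(\<lambda>x. \<integral>\<^sup>+y. path_weight Q \<phi> bs y \<partial>Q x) \<in> borel_measurable (borel_on X)"
    by (rule measurable_compose[OF Q_subprob nn_integral_measurable_subprob_algebra]) measurable
  show ?case by simp
qed (use assms(1) in \<open>simp add: fun_eq_iff cong: measurable_cong\<close>)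

text \<open>The process is built by appending coordinates, whereas \<open>path_weight\<close> recurses from the first
  coordinate on; the two are matched by induction on the list from its end, with \<open>\<phi>\<close> arbitrary.\<close>

lemma nn_integral_path:
  assumes \<phi>: "\<phi> \<in> borel_measurable (borel_on X)" and bs: "set bs \<subseteq> sets (borel_on X)"
  shows "(\<integral>\<^sup>+\<omega>. (\<Prod>i<length bs. indicator (bs ! i) (\<omega> i)) * \<phi> (\<omega> (length bs)) \<partial>path_law X \<mu> Q (Suc (length bs)))
    = (\<integral>\<^sup>+x. path_weight Q \<phi> bs x \<partial>\<mu>)"
  using bs \<phi>
proof (induction bs arbitrary: \<phi> rule: rev_induct)
  case Nil
  note [measurable] = Nil(2)
  have "(\<integral>\<^sup>+\<omega>. \<phi> (\<omega> 0) \<partial>path_law X \<mu> Q (Suc 0)) = (\<integral>\<^sup>+\<omega>. (\<integral>\<^sup>+y. \<phi> y \<partial>\<mu>) \<partial>path_law X \<mu> Q 0)"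
    by (subst nn_integral_path_law_Suc) (auto simp: markov_step_def)
  also have "\<dots> = (\<integral>\<^sup>+\<omega>. (\<integral>\<^sup>+y. \<phi> y \<partial>\<mu>) \<partial>law)"
    by (subst nn_integral_path_law) auto
  also have "\<dots> = (\<integral>\<^sup>+y. \<phi> y \<partial>\<mu>)" by (simp add: law.emeasure_space_1)
  finally show ?case by simp
next
  case (snoc b cs)
  let ?n = "length cs"
  note [measurable] = snoc(3)
  have cs: "set cs \<subseteq> sets (borel_on X)" and b[measurable]: "b \<in> sets (borel_on X)" using snoc(2) by auto
  have nth[measurable]: "(\<lambda>\<omega>. indicator ((cs @ [b]) ! i) (\<omega> i) :: ennreal) \<in> borel_measurable (prefixes X m)"
    if "i < Suc ?n" "i < m" for i m
  proof -
    have "(cs @ [b]) ! i \<in> sets (borel_on X)"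
      using snoc(2) that by (metis length_append_singleton nth_mem subset_code(1))
    then have [measurable]: "(\<lambda>x. indicator ((cs @ [b]) ! i) x :: ennreal) \<in> borel_measurable (borel_on X)" by simp
    have "(\<lambda>\<omega>. \<omega> i) \<in> prefixes X m \<rightarrow>\<^sub>M borel_on X"
      using that by (intro measurable_component_singleton) auto
    then show ?thesis by measurable
  qed
  have prodm: "(\<lambda>\<omega>. (\<Prod>i<Suc ?n. indicator ((cs @ [b]) ! i) (\<omega> i)) :: ennreal) \<in> borel_measurable (prefixes X m)"
    if "Suc ?n \<le> m" for m
    using that by (intro borel_measurable_prod_ennreal nth) auto
  have "(\<lambda>\<omega>. \<omega> (Suc ?n)) \<in> prefixes X (Suc (Suc ?n)) \<rightarrow>\<^sub>M borel_on X"
    by (intro measurable_component_singleton) auto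
  then have \<phi>m: "(\<lambda>\<omega>. \<phi> (\<omega> (Suc ?n))) \<in> borel_measurable (prefixes X (Suc (Suc ?n)))" by measurable
  have "(\<integral>\<^sup>+\<omega>. (\<Prod>i<Suc ?n. indicator ((cs @ [b]) ! i) (\<omega> i)) * \<phi> (\<omega> (Suc ?n)) \<partial>path_law X \<mu> Q (Suc (Suc ?n)))
    = (\<integral>\<^sup>+\<omega>. (\<integral>\<^sup>+y. (\<Prod>i<Suc ?n. indicator ((cs @ [b]) ! i) ((fun_upd \<omega> (Suc ?n) y) i)) * \<phi> y \<partial>Q (\<omega> ?n)) \<partial>path_law X \<mu> Q (Suc ?n))"
    using prodm[of "Suc (Suc ?n)"] \<phi>m
    by (subst nn_integral_path_law_Suc) (auto simp: markov_step_def)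
  also have "\<dots> = (\<integral>\<^sup>+\<omega>. (\<Prod>i<?n. indicator (cs ! i) (\<omega> i)) * path_weight Q \<phi> [b] (\<omega> ?n) \<partial>path_law X \<mu> Q (Suc ?n))"
  proof (rule nn_integral_cong)
    fix \<omega> assume "\<omega> \<in> space (path_law X \<mu> Q (Suc ?n))"
    then have "\<omega> ?n \<in> X" by (auto simp: path_law_def space_PiM PiE_iff)
    then have "sets (Q (\<omega> ?n)) = sets (borel_on X)" by (rule sets_Q)
    then have [measurable]: "\<phi> \<in> borel_measurable (Q (\<omega> ?n))"
      using snoc(3) by (simp cong: measurable_cong_sets)
    have "(\<Prod>i<Suc ?n. indicator ((cs @ [b]) ! i) ((fun_upd \<omega> (Suc ?n) y) i))
        = (\<Prod>i<?n. indicator (cs ! i) (\<omega> i)) * (indicator b (\<omega> ?n) :: ennreal)" for y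
      by (simp add: nth_append)
    then show "(\<integral>\<^sup>+y. (\<Prod>i<Suc ?n. indicator ((cs @ [b]) ! i) ((fun_upd \<omega> (Suc ?n) y) i)) * \<phi> y \<partial>Q (\<omega> ?n))
        = (\<Prod>i<?n. indicator (cs ! i) (\<omega> i)) * path_weight Q \<phi> [b] (\<omega> ?n)"
      by (simp add: nn_integral_cmult mult.assoc)
  qed
  also have "\<dots> = (\<integral>\<^sup>+x. path_weight Q (path_weight Q \<phi> [b]) cs x \<partial>\<mu>)"
    by (rule snoc(1)[OF cs measurable_path_weight]) (use snoc in auto)
  finally show ?case by (simp add: path_weight_append)
qed

lemma emeasure_law_cylinder:
  assumes bs: "set bs \<subseteq> sets (borel_on X)"
  shows "emeasure law (cylinder X bs) = (\<integral>\<^sup>+x. path_weight Q (\<lambda>_. 1) bs x \<partial>\<mu>)"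
proof -
  have "(\<lambda>\<omega>. (\<Prod>i<length bs. indicator (bs ! i) (\<omega> i)) :: ennreal) \<in> borel_measurable (prefixes X (Suc (length bs)))"
  proof (intro borel_measurable_prod_ennreal)
    fix i assume i: "i \<in> {..<length bs}"
    then have [measurable]: "bs ! i \<in> sets (borel_on X)" using bs by (auto simp: subset_iff)
    have "(\<lambda>\<omega>. \<omega> i) \<in> prefixes X (Suc (length bs)) \<rightarrow>\<^sub>M borel_on X"
      using i by (intro measurable_component_singleton) auto
    then show "(\<lambda>\<omega>. indicator (bs ! i) (\<omega> i) :: ennreal) \<in> borel_measurable (prefixes X (Suc (length bs)))"
      by measurable
  qed
  then have m: "(\<lambda>\<omega>. (\<Prod>i<length bs. indicator (bs ! i) (\<omega> i)) * 1 :: ennreal) \<in> borel_measurable (prefixes X (Suc (length bs)))"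
    by simp
  have "(\<integral>\<^sup>+x. path_weight Q (\<lambda>_. 1) bs x \<partial>\<mu>)
      = (\<integral>\<^sup>+\<omega>. (\<Prod>i<length bs. indicator (bs ! i) (restrict \<omega> {0..<Suc (length bs)} i)) * 1 \<partial>law)"
    unfolding nn_integral_path_law[OF m, symmetric] by (rule nn_integral_path[symmetric]) (use bs in auto)
  also have "\<dots> = (\<integral>\<^sup>+\<omega>. indicator (cylinder X bs) \<omega> \<partial>law)"
  proof (rule nn_integral_cong)
    fix \<omega> assume "\<omega> \<in> space law"
    then have \<omega>: "\<And>i. \<omega> i \<in> X" by (auto simp: space_law)
    have "(\<Prod>i<length bs. indicator (bs ! i) (\<omega> i)) = (indicator (cylinder X bs) \<omega> :: ennreal)"
    proof (cases "\<forall>i<length bs. \<omega> i \<in> bs ! i")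
      case False
      then obtain i where "i < length bs" "\<omega> i \<notin> bs ! i" by auto
      then have "(\<Prod>i<length bs. indicator (bs ! i) (\<omega> i)) = (0::ennreal)"
        by (intro prod_zero bexI[of _ i]) auto
      then show ?thesis using False by (auto simp: cylinder_def)
    qed (use \<omega> in \<open>auto simp: cylinder_def\<close>)
    then show "(\<Prod>i<length bs. indicator (bs ! i) (restrict \<omega> {0..<Suc (length bs)} i)) * 1
      = (indicator (cylinder X bs) \<omega> :: ennreal)" by simp
  qed
  finally show ?thesis using sets_cylinder[OF bs] by (simp add: sets_law)
qed

lemma measurable_orbit_shift: "orbit_shift \<in> (paths X) \<rightarrow>\<^sub>M (paths X)"
proof -
  have "(\<lambda>\<omega>. \<lambda>i\<in>UNIV. \<omega> (Suc i)) \<in> (paths X) \<rightarrow>\<^sub>M (paths X)"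
    by (intro measurable_restrict measurable_component_singleton) auto
  then show ?thesis by (simp add: orbit_shift_def[abs_def] restrict_UNIV)
qed

lemma nn_integral_Q_\<mu>:
  assumes "g \<in> borel_measurable (borel_on X)"
  shows "(\<integral>\<^sup>+x. (\<integral>\<^sup>+y. g y \<partial>Q x) \<partial>\<mu>) = (\<integral>\<^sup>+x. g x \<partial>\<mu>)"
  using nn_integral_bind[OF assms, of Q \<mu>] Q_subprob
  by (simp add: bind_\<mu> measurable_cong_sets[OF sets_\<mu> refl])

lemma distr_law_shift: "distr law (paths X) orbit_shift = law"
proof (rule measure_eqI_cylinder)
  have sh: "orbit_shift \<in> law \<rightarrow>\<^sub>M (paths X)"
    using measurable_orbit_shift by (simp add: measurable_cong_sets[OF sets_law refl])
  interpret D: prob_space "distr law (paths X) orbit_shift" by (rule law.prob_space_distr[OF sh])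
  show "finite_measure (distr law (paths X) orbit_shift)" by (rule D.finite_measure_axioms)
  fix bs assume bs: "set bs \<subseteq> sets (borel_on X)"
  have "emeasure (distr law (paths X) orbit_shift) (cylinder X bs) = emeasure law (orbit_shift -` cylinder X bs \<inter> space law)"
    using sets_cylinder[OF bs] by (intro emeasure_distr sh) auto
  also have "orbit_shift -` cylinder X bs \<inter> space law = cylinder X (X # bs)"
    by (auto simp: cylinder_Cons space_law PiE_iff) (auto simp: cylinder_def orbit_shift_def, metis not0_implies_Suc)
  also have "emeasure law \<dots> = (\<integral>\<^sup>+x. path_weight Q (\<lambda>_. 1) (X # bs) x \<partial>\<mu>)"
    by (rule emeasure_law_cylinder) (use bs carrier_in_sets_borel_on in auto)
  also have "\<dots> = (\<integral>\<^sup>+x. (\<integral>\<^sup>+y. path_weight Q (\<lambda>_. 1) bs y \<partial>Q x) \<partial>\<mu>)"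
    by (intro nn_integral_cong) (simp add: space_\<mu>)
  also have "\<dots> = (\<integral>\<^sup>+x. path_weight Q (\<lambda>_. 1) bs x \<partial>\<mu>)"
    by (intro nn_integral_Q_\<mu> measurable_path_weight bs) auto
  also have "\<dots> = emeasure law (cylinder X bs)" by (rule emeasure_law_cylinder[OF bs, symmetric])
  finally show "emeasure (distr law (paths X) orbit_shift) (cylinder X bs) = emeasure law (cylinder X bs)" .
qed (simp_all add: sets_law)

lemma measurable_p2: "p2 \<in> (paths X) \<rightarrow>\<^sub>M borel_on (X \<times> X)"
  unfolding measurable_cong_sets[OF refl sets_borel_on_Times[OF compact_X compact_X]] p2_def[abs_def]
  by measurable

lemma distr_law_p2: "distr law (borel_on (X \<times> X)) p2 = pair_law"
proof (rule measure_eqI_rectangles[OF compact_X])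
  have p2: "p2 \<in> law \<rightarrow>\<^sub>M borel_on (X \<times> X)"
    using measurable_p2 by (simp add: measurable_cong_sets[OF sets_law refl])
  show "finite_measure (distr law (borel_on (X \<times> X)) p2)"
    using prob_space.finite_measure[OF law.prob_space_distr[OF p2]] .
  fix A B assume A: "A \<in> sets (borel_on X)" and B: "B \<in> sets (borel_on X)"
  have AB: "A \<times> B \<in> sets (borel_on (X \<times> X))"
    unfolding sets_borel_on_Times[OF compact_X compact_X] using A B by simp
  have "p2 -` (A \<times> B) \<inter> space law = cylinder X [A, B]"
    by (auto simp: p2_def cylinder_def space_law less_Suc_eq PiE_iff)
  then have "emeasure (distr law (borel_on (X \<times> X)) p2) (A \<times> B) = (\<integral>\<^sup>+x. path_weight Q (\<lambda>_. 1) [A, B] x \<partial>\<mu>)"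
    using emeasure_law_cylinder[of "[A, B]"] A B by (simp add: emeasure_distr[OF p2 AB])
  also have "\<dots> = (\<integral>\<^sup>+x. indicator A x * emeasure (Q x) B \<partial>\<mu>)"
  proof (rule nn_integral_cong)
    fix x assume "x \<in> space \<mu>"
    then have x: "x \<in> X" by (simp add: space_\<mu>)
    have "(\<integral>\<^sup>+y. indicator B y * (\<integral>\<^sup>+z. 1 \<partial>Q y) \<partial>Q x) = (\<integral>\<^sup>+y. indicator B y \<partial>Q x)"
      using prob_space.emeasure_space_1[OF prob_space_Q]
      by (intro nn_integral_cong) (simp add: space_Q[OF x])
    also have "\<dots> = emeasure (Q x) B" using B by (simp add: sets_Q[OF x])
    finally show "path_weight Q (\<lambda>_. 1) [A, B] x = indicator A x * emeasure (Q x) B" by simp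
  qed
  finally show "emeasure (distr law (borel_on (X \<times> X)) p2) (A \<times> B) = emeasure pair_law (A \<times> B)"
    by (simp add: emeasure_pair_law_Times[OF A B])
qed (simp_all add: sets_pair_law)

lemmas corr_graph_sets = sets_corr_graph[OF corr]

lemma emeasure_Q_T:
  assumes x: "x \<in> X"
  shows "emeasure (Q x) (T x) = 1"
proof -
  have Ts: "T x \<in> sets (Q x)" unfolding sets_Q[OF x] by (rule sets_correspondence[OF corr x])
  obtain N where N: "N \<in> null_sets (Q x)" "X - measure_support (Q x) \<subseteq> N"
    using measure_support_null[OF compact_X sets_Q[OF x]] by metis
  have "AE y in Q x. y \<in> T x"
  proof (rule AE_I'[OF N(1)])
    show "{y \<in> space (Q x). y \<notin> T x} \<subseteq> N"
      using N(2) Q x by (auto simp: kernels_def space_Q[OF x])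
  qed
  then show ?thesis using prob_space.emeasure_eq_1_AE[OF prob_space_Q[OF x] Ts] by simp
qed

lemma pair_law_corr_graph: "emeasure pair_law (corr_graph X T) = 1"
proof -
  have "emeasure pair_law (corr_graph X T) = (\<integral>\<^sup>+x. emeasure (Q x) (T x) \<partial>\<mu>)"
    unfolding emeasure_pair_law[OF corr_graph_sets]
  proof (rule nn_integral_cong)
    fix x assume "x \<in> space \<mu>"
    then have x: "x \<in> X" by (simp add: space_\<mu>)
    have "Pair x -` corr_graph X T \<inter> X = T x"
      using x correspondence_subset[OF corr x] by (auto simp: corr_graph_def)
    then show "emeasure (Q x) (Pair x -` corr_graph X T \<inter> X) = emeasure (Q x) (T x)" by simp
  qed
  also have "\<dots> = (\<integral>\<^sup>+x. 1 \<partial>\<mu>)"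
    by (intro nn_integral_cong) (simp add: space_\<mu> emeasure_Q_T)
  finally show ?thesis by (simp add: \<mu>.emeasure_space_1)
qed

lemma \<Omega>_sets: "\<Omega> \<in> sets (paths X)"
  by (rule sets_orbit_space(1)[OF compact_X corr])

lemma sets_\<Omega>: "sets (borel_on \<Omega>) = sets (restrict_space (paths X) \<Omega>)"
  by (rule sets_orbit_space(2)[OF compact_X corr])

lemma AE_law_\<Omega>: "AE \<omega> in law. \<omega> \<in> \<Omega>"
proof -
  have p2: "p2 \<in> law \<rightarrow>\<^sub>M borel_on (X \<times> X)"
    using measurable_p2 by (simp add: measurable_cong_sets[OF sets_law refl])
  have pl: "prob_space pair_law"
    unfolding distr_law_p2[symmetric] by (rule law.prob_space_distr[OF p2])
  have "AE p in distr law (borel_on (X \<times> X)) p2. p \<in> corr_graph X T"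
    using prob_space.AE_in_set_eq_1[OF pl] pair_law_corr_graph corr_graph_sets
    unfolding distr_law_p2 by (simp add: sets_pair_law measure_def)
  then have base: "AE \<omega> in law. p2 \<omega> \<in> corr_graph X T"
    using p2 by (rule AE_distrD[rotated])
  have shift: "orbit_shift \<in> law \<rightarrow>\<^sub>M (paths X)"
    using measurable_orbit_shift by (simp add: measurable_cong_sets[OF sets_law refl])
  have "AE \<omega> in law. p2 ((orbit_shift ^^ j) \<omega>) \<in> corr_graph X T" for j
  proof (induction j)
    case (Suc j)
    then have "AE \<omega> in distr law (paths X) orbit_shift. p2 ((orbit_shift ^^ j) \<omega>) \<in> corr_graph X T"
      by (simp only: distr_law_shift)
    then have "AE \<omega> in law. p2 ((orbit_shift ^^ j) (orbit_shift \<omega>)) \<in> corr_graph X T"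
      by (rule AE_distrD[OF shift])
    then show ?case by (simp add: funpow_swap1)
  qed (use base in simp)
  then have "AE \<omega> in law. \<forall>j. p2 ((orbit_shift ^^ j) \<omega>) \<in> corr_graph X T"
    by (simp add: AE_all_countable)
  then show ?thesis
  proof (rule AE_mp, intro AE_I2 impI)
    fix \<omega> assume *: "\<forall>j. p2 ((orbit_shift ^^ j) \<omega>) \<in> corr_graph X T"
    then show "\<omega> \<in> \<Omega>"
      by (auto simp: p2_def corr_graph_def orbit_space_def funpow_orbit_shift)
  qed
qed

lemma sets_\<nu>: "sets \<nu> = sets (borel_on \<Omega>)"
  unfolding sets_\<Omega> markov_measure_def by (rule sets_restrict_space_cong[OF sets_law])

lemma space_\<nu>: "space \<nu> = \<Omega>"
  using sets_eq_imp_space_eq[OF sets_\<nu>] by simp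

lemma emeasure_\<nu>:
  assumes "A \<in> sets (paths X)" shows "emeasure \<nu> (A \<inter> \<Omega>) = emeasure law A"
proof -
  have "emeasure \<nu> (A \<inter> \<Omega>) = emeasure law (A \<inter> \<Omega>)"
    unfolding markov_measure_def using \<Omega>_sets orbit_space_subset[of X T]
    by (intro emeasure_restrict_space) (auto simp: sets_law space_law Int_absorb2)
  also have "\<dots> = emeasure law A"
    using AE_law_\<Omega> assms \<Omega>_sets by (intro emeasure_eq_AE) (auto simp: sets_law elim: eventually_mono)
  finally show ?thesis .
qed

lemma \<nu>_borel: "\<nu> \<in> borel_probs \<Omega>"
proof -
  have "emeasure \<nu> (space \<nu>) = 1"
    using emeasure_\<nu>[OF sets.top] sets.sets_into_space[OF \<Omega>_sets] law.emeasure_space_1 sets_eq_imp_space_eq[OF sets_law]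
    by (simp add: space_\<nu> Int_absorb1)
  then show ?thesis by (auto simp: borel_probs_def sets_\<nu> intro!: prob_spaceI)
qed

lemma shift_\<Omega>: "\<omega> \<in> \<Omega> \<Longrightarrow> orbit_shift \<omega> \<in> \<Omega>"
  by (auto simp: orbit_space_def orbit_shift_def)

lemma sets_\<nu>_E:
  assumes "A \<in> sets (borel_on \<Omega>)" obtains B where "B \<in> sets (paths X)" "A = B \<inter> \<Omega>"
  using assms unfolding sets_\<Omega> by (auto simp: sets_restrict_space)

lemma \<nu>_invariant: "\<nu> \<in> invariant_probs \<Omega> orbit_shift"
proof -
  have "distr \<nu> (borel_on \<Omega>) orbit_shift = \<nu>"
  proof (rule measure_eqI)
    fix A assume "A \<in> sets (distr \<nu> (borel_on \<Omega>) orbit_shift)"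
    then have A: "A \<in> sets (borel_on \<Omega>)" by simp
    then obtain B where B: "B \<in> sets (paths X)" "A = B \<inter> \<Omega>" by (rule sets_\<nu>_E)
    have m: "orbit_shift \<in> \<nu> \<rightarrow>\<^sub>M borel_on \<Omega>"
    proof (rule measurableI)
      fix C assume "C \<in> sets (borel_on \<Omega>)"
      then obtain D where D: "D \<in> sets (paths X)" "C = D \<inter> \<Omega>" by (rule sets_\<nu>_E)
      have "orbit_shift -` C \<inter> space \<nu> = (orbit_shift -` D \<inter> space (paths X)) \<inter> \<Omega>"
        using shift_\<Omega> sets.sets_into_space[OF \<Omega>_sets] by (auto simp: space_\<nu> D)
      then show "orbit_shift -` C \<inter> space \<nu> \<in> sets \<nu>"
        unfolding sets_\<nu> sets_\<Omega> using measurable_sets[OF measurable_orbit_shift D(1)]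
        by (auto simp: sets_restrict_space)
    qed (use shift_\<Omega> in \<open>simp add: space_\<nu>\<close>)
    have "emeasure (distr \<nu> (borel_on \<Omega>) orbit_shift) A = emeasure \<nu> ((orbit_shift -` B \<inter> space (paths X)) \<inter> \<Omega>)"
      unfolding emeasure_distr[OF m A]
      using shift_\<Omega> sets.sets_into_space[OF \<Omega>_sets] by (intro arg_cong[where f="emeasure \<nu>"]) (auto simp: space_\<nu> B)
    also have "\<dots> = emeasure law (orbit_shift -` B \<inter> space (paths X))"
      by (rule emeasure_\<nu>[OF measurable_sets[OF measurable_orbit_shift B(1)]])
    also have "\<dots> = emeasure (distr law (paths X) orbit_shift) B"
      using measurable_orbit_shift B(1) sets_eq_imp_space_eq[OF sets_law]
      by (subst emeasure_distr) (auto simp: measurable_cong_sets[OF sets_law refl])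
    also have "\<dots> = emeasure \<nu> A" unfolding distr_law_shift B(2) by (rule emeasure_\<nu>[OF B(1), symmetric])
    finally show "emeasure (distr \<nu> (borel_on \<Omega>) orbit_shift) A = emeasure \<nu> A" .
  qed (simp add: sets_\<nu>)
  with \<nu>_borel show ?thesis by (simp add: invariant_probs_def)
qed

lemma distr_\<nu>_p2: "distr \<nu> (borel_on (X \<times> X)) p2 = pair_law"
proof (rule measure_eqI)
  fix A assume "A \<in> sets (distr \<nu> (borel_on (X \<times> X)) p2)"
  then have A: "A \<in> sets (borel_on (X \<times> X))" by simp
  have pm: "p2 -` C \<inter> space \<nu> = (p2 -` C \<inter> space (paths X)) \<inter> \<Omega>" for C
    using sets.sets_into_space[OF \<Omega>_sets] by (auto simp: space_\<nu>)
  have m: "p2 \<in> \<nu> \<rightarrow>\<^sub>M borel_on (X \<times> X)"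
    unfolding measurable_cong_sets[OF sets_\<nu> refl] measurable_cong_sets[OF sets_\<Omega> refl]
    by (rule measurable_restrict_space1[OF measurable_p2])
  have "emeasure (distr \<nu> (borel_on (X \<times> X)) p2) A = emeasure law (p2 -` A \<inter> space (paths X))"
    unfolding emeasure_distr[OF m A] pm by (rule emeasure_\<nu>[OF measurable_sets[OF measurable_p2 A]])
  also have "\<dots> = emeasure (distr law (borel_on (X \<times> X)) p2) A"
    using measurable_p2 A sets_eq_imp_space_eq[OF sets_law]
    by (subst emeasure_distr) (auto simp: measurable_cong_sets[OF sets_law refl])
  finally show "emeasure (distr \<nu> (borel_on (X \<times> X)) p2) A = emeasure pair_law A"
    by (simp only: distr_law_p2)
qed (simp add: sets_pair_law)

end

section \<open>Entropy of Markov measures\<close>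

lemma distr_p2_corr_graph:
  fixes X :: "'a::metric_space set"
  assumes X: "compact X" and T: "correspondence X T"
    and sets_\<nu>: "sets \<nu> = sets (borel_on (orbit_space X T))"
    and sets_P: "sets P = sets (borel_on (X \<times> X))"
    and joint: "distr \<nu> (borel_on (X \<times> X)) p2 = P"
  shows "distr \<nu> (borel_on (corr_graph X T)) p2 = restrict_space P (corr_graph X T)"
proof -
  let ?\<Gamma> = "corr_graph X T"
  have sub: "?\<Gamma> \<subseteq> X \<times> X" by (auto simp: corr_graph_def)
  note \<Gamma> = sets_corr_graph[OF T]
  have cont: "continuous_on (orbit_space X T) p2"
    unfolding p2_def[abs_def]
    by (intro continuous_intros continuous_on_subset[OF continuous_on_product_coordinates]) auto
  have m: "p2 \<in> \<nu> \<rightarrow>\<^sub>M borel_on ?\<Gamma>" "p2 \<in> \<nu> \<rightarrow>\<^sub>M borel_on (X \<times> X)"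
    unfolding measurable_cong_sets[OF sets_\<nu> refl]
    by (intro measurable_borel_on_continuous[OF cont]; auto simp: orbit_space_def p2_def corr_graph_def)+
  show ?thesis
  proof (rule measure_eqI)
    show "sets (distr \<nu> (borel_on ?\<Gamma>) p2) = sets (restrict_space P ?\<Gamma>)"
      using sub by (simp add: sets_restrict_space sets_P image_comp comp_def Int_assoc[symmetric] Int_absorb2)
    fix A assume "A \<in> sets (distr \<nu> (borel_on ?\<Gamma>) p2)"
    then have A: "A \<in> sets (borel_on ?\<Gamma>)" by simp
    then obtain U where U: "U \<in> sets borel" "A = ?\<Gamma> \<inter> U" by (auto simp: sets_restrict_space)
    then have "A = ?\<Gamma> \<inter> (X \<times> X \<inter> U)" using sub by auto
    moreover have "X \<times> X \<inter> U \<in> sets (borel_on (X \<times> X))" using U by (auto simp: sets_restrict_space)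
    ultimately have A': "A \<in> sets (borel_on (X \<times> X))" using \<Gamma> by auto
    have "emeasure (distr \<nu> (borel_on ?\<Gamma>) p2) A = emeasure (distr \<nu> (borel_on (X \<times> X)) p2) A"
      by (simp add: emeasure_distr[OF m(1) A] emeasure_distr[OF m(2) A'])
    also have "\<dots> = emeasure (restrict_space P ?\<Gamma>) A"
      unfolding joint using \<Gamma> sub sets.sets_into_space[OF A] sets_eq_imp_space_eq[OF sets_P]
      by (intro emeasure_restrict_space[symmetric]) (auto simp: sets_P Int_absorb2)
    finally show "emeasure (distr \<nu> (borel_on ?\<Gamma>) p2) A = emeasure (restrict_space P ?\<Gamma>) A" .
  qed
qed

lemma invariant_probs_measure_preserving:
  fixes \<Omega> :: "(nat \<Rightarrow> 'a::metric_space) set"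
  assumes \<nu>: "\<nu> \<in> invariant_probs \<Omega> orbit_shift" and \<Omega>: "\<And>\<omega>. \<omega> \<in> \<Omega> \<Longrightarrow> orbit_shift \<omega> \<in> \<Omega>"
  shows "measure_preserving_map \<nu> orbit_shift"
proof -
  have sets: "sets \<nu> = sets (borel_on \<Omega>)" and "prob_space \<nu>" and d: "distr \<nu> (borel_on \<Omega>) orbit_shift = \<nu>"
    using \<nu> by (auto simp: invariant_probs_def borel_probs_def)
  then interpret prob_space \<nu> by simp
  have "continuous_on \<Omega> (orbit_shift :: (nat \<Rightarrow> 'a) \<Rightarrow> _)"
    unfolding orbit_shift_def[abs_def]
    by (intro continuous_on_coordinatewise_then_product continuous_on_subset[OF continuous_on_product_coordinates]) auto
  then have "orbit_shift \<in> borel_on \<Omega> \<rightarrow>\<^sub>M borel_on \<Omega>"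
    using \<Omega> by (intro measurable_borel_on_continuous) auto
  then have "orbit_shift \<in> \<nu> \<rightarrow>\<^sub>M \<nu>"
    by (simp add: measurable_cong_sets[OF sets sets])
  moreover have "distr \<nu> \<nu> orbit_shift = \<nu>"
    using distr_cong[OF refl sets, of \<nu> orbit_shift orbit_shift] d by simp
  ultimately show ?thesis by unfold_locales
qed

lemma simple_function_coordinate_labels:
  fixes f :: "'a::metric_space \<Rightarrow> 'c"
  assumes f: "simple_function (borel_on X) f" and I: "{0..<n} \<subseteq> (I :: nat set)"
  shows "simple_function (PiM I (\<lambda>_. borel_on X)) (\<lambda>\<omega>. map (\<lambda>i. f (\<omega> i)) [0..<n])"
  using I
proof (induction n)
  case (Suc n)
  have "(\<lambda>\<omega>. \<omega> n) \<in> PiM I (\<lambda>_. borel_on X) \<rightarrow>\<^sub>M borel_on X"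
    using Suc(2) by (intro measurable_component_singleton) auto
  note sn = simple_function_comp[OF this f]
  have "simple_function (PiM I (\<lambda>_. borel_on X)) (\<lambda>\<omega>. map (\<lambda>i. f (\<omega> i)) [0..<n] @ [f (\<omega> n)])"
    by (rule simple_function_compose2[OF Suc(1) sn, where h="\<lambda>u v. u @ [v]"]) (use Suc(2) in auto)
  then show ?case by simp
qed simp

lemma itinerary_coordinate:
  "itinerary orbit_shift (\<lambda>\<omega>. f (\<omega> 0)) n \<omega> = map (\<lambda>i. f (\<omega> i)) [0..<n]"
  by (simp add: itinerary_def funpow_orbit_shift)

context stationary_markov
begin

lemma \<nu>_mpt: "measure_preserving_map \<nu> orbit_shift"
  by (rule invariant_probs_measure_preserving[OF \<nu>_invariant shift_\<Omega>])

lemma simple_function_\<nu>: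
  assumes "simple_function (paths X) F" shows "simple_function \<nu> F"
  unfolding simple_function_def
proof
  show "finite (F ` space \<nu>)"
    using simple_functionD(1)[OF assms] sets.sets_into_space[OF \<Omega>_sets] by (auto simp: space_\<nu> intro: finite_subset[OF image_mono])
  have "F -` {v} \<inter> space \<nu> = (F -` {v} \<inter> space (paths X)) \<inter> \<Omega>" for v
    using sets.sets_into_space[OF \<Omega>_sets] by (auto simp: space_\<nu>)
  then show "\<forall>v\<in>F ` space \<nu>. F -` {v} \<inter> space \<nu> \<in> sets \<nu>"
    unfolding sets_\<nu> sets_\<Omega> using simple_functionD(2)[OF assms] by (auto simp: sets_restrict_space)
qed

lemma rv_entropy_\<nu>:
  assumes F: "simple_function (paths X) F"
  shows "rv_entropy \<nu> F = rv_entropy law F"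
proof -
  have sp: "space law = space (paths X)" by (rule sets_eq_imp_space_eq[OF sets_law])
  have sub: "\<Omega> \<subseteq> space (paths X)" by (rule sets.sets_into_space[OF \<Omega>_sets])
  have "rv_entropy \<nu> F = (\<Sum>v\<in>F ` space (paths X). eta (measure \<nu> (F -` {v} \<inter> space \<nu>)))"
    using simple_functionD(1)[OF F] sub by (intro rv_entropy_superset) (auto simp: space_\<nu>)
  also have "\<dots> = rv_entropy law F"
    unfolding rv_entropy_def sp
  proof (intro sum.cong refl arg_cong[where f=eta])
    fix v
    have "F -` {v} \<inter> space \<nu> = (F -` {v} \<inter> space (paths X)) \<inter> \<Omega>" using sub by (auto simp: space_\<nu>)
    then show "measure \<nu> (F -` {v} \<inter> space \<nu>) = measure law (F -` {v} \<inter> space (paths X))"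
      using emeasure_\<nu>[OF simple_functionD(2)[OF F]] by (simp add: measure_def)
  qed
  finally show ?thesis .
qed

lemma kernel_entropy_partition_fibres:
  assumes f: "simple_function (borel_on X) f"
  shows "kernel_entropy_partition X \<mu> Q (fibres (borel_on X) f) = entropy_rate \<nu> orbit_shift (\<lambda>\<omega>. f (\<omega> 0))"
proof -
  have "partition_entropy (path_law X \<mu> Q n) (product_partition (fibres (borel_on X) f) n)
      = rv_entropy \<nu> (itinerary orbit_shift (\<lambda>\<omega>. f (\<omega> 0)) n)" for n
  proof -
    let ?F = "\<lambda>\<omega>. map (\<lambda>i. f (\<omega> i)) [0..<n]"
    let ?P = "prefixes X n"
    have m: "(\<lambda>\<omega>. restrict \<omega> {0..<n}) \<in> law \<rightarrow>\<^sub>M ?P"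
      unfolding measurable_cong_sets[OF sets_law refl]
      by (intro measurable_restrict measurable_component_singleton) auto
    have "fibres ?P ?F = fibres (path_law X \<mu> Q n) ?F"
      by (simp add: fibres_def path_law_def)
    then have "partition_entropy (path_law X \<mu> Q n) (product_partition (fibres (borel_on X) f) n)
        = rv_entropy (path_law X \<mu> Q n) ?F"
      by (simp add: product_partition_fibres partition_entropy_fibres)
    also have "\<dots> = rv_entropy law (?F \<circ> (\<lambda>\<omega>. restrict \<omega> {0..<n}))"
      unfolding path_law_def by (rule rv_entropy_distr[OF m simple_function_coordinate_labels[OF f]]) simp
    also have "\<dots> = rv_entropy law ?F"
      by (rule rv_entropy_cong) simp
    also have "\<dots> = rv_entropy \<nu> ?F"
      by (rule rv_entropy_\<nu>[OF simple_function_coordinate_labels[OF f], symmetric]) simp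
    finally show ?thesis by (simp add: itinerary_coordinate[abs_def])
  qed
  then show ?thesis by (simp add: kernel_entropy_partition_def entropy_rate_def)
qed

lemma simple_function_\<nu>_coordinate:
  assumes f: "simple_function (borel_on X) f"
  shows "simple_function \<nu> (\<lambda>\<omega>. f (\<omega> i))"
proof -
  have "(\<lambda>\<omega>. \<omega> i) \<in> (paths X) \<rightarrow>\<^sub>M borel_on X" by (intro measurable_component_singleton) auto
  from simple_function_comp[OF this f] show ?thesis by (rule simple_function_\<nu>)
qed

lemma entropy_rate_le_kernel_entropy:
  assumes f: "simple_function (borel_on X) f"
  shows "ereal (entropy_rate \<nu> orbit_shift (\<lambda>\<omega>. f (\<omega> 0))) \<le> kernel_entropy X \<mu> Q"
  unfolding kernel_entropy_def kernel_entropy_partition_fibres[OF f, symmetric]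
  by (rule SUP_upper[OF fibres_in_finite_partitions[OF f]])

lemma kernel_entropy_le_ks_entropy: "kernel_entropy X \<mu> Q \<le> ks_entropy \<nu> orbit_shift"
  unfolding kernel_entropy_def
proof (rule SUP_least)
  interpret mpt: measure_preserving_map \<nu> orbit_shift by (rule \<nu>_mpt)
  fix P assume "P \<in> finite_partitions (borel_on X)"
  then obtain f :: "'a \<Rightarrow> 'a set" where f: "simple_function (borel_on X) f" "P = fibres (borel_on X) f"
    by (rule finite_partitions_eq_fibres)
  show "ereal (kernel_entropy_partition X \<mu> Q P) \<le> ks_entropy \<nu> orbit_shift"
    unfolding f(2) kernel_entropy_partition_fibres[OF f(1)]
    by (rule mpt.entropy_rate_le_ks_entropy[OF simple_function_\<nu>_coordinate[OF f(1)]])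
qed

text \<open>\<open>r\<close> is the conditional probability that the point lies in \<open>C\<close>, given the next point.\<close>

lemma nn_integral_pair_law:
  assumes C: "C \<in> sets (borel_on X)" and W: "W \<in> borel_measurable (borel_on X)"
    and r: "r \<in> borel_measurable (borel_on X)"
    and joint: "\<And>A. A \<in> sets (borel_on X) \<Longrightarrow> emeasure pair_law (C \<times> A) = (\<integral>\<^sup>+y. r y * indicator A y \<partial>\<mu>)"
  shows "(\<integral>\<^sup>+x. indicator C x * (\<integral>\<^sup>+y. W y \<partial>Q x) \<partial>\<mu>) = (\<integral>\<^sup>+y. r y * W y \<partial>\<mu>)"
proof -
  define N1 where "N1 = density \<mu> (indicator C) \<bind> Q"
  have Qd: "Q \<in> density \<mu> (indicator C) \<rightarrow>\<^sub>M subprob_algebra (borel_on X)"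
    using Q_subprob by (simp add: measurable_cong_sets[OF sets_\<mu> refl])
  have r': "r \<in> borel_measurable \<mu>" using r by (simp add: measurable_cong_sets[OF sets_\<mu> refl])
  have C': "(indicator C :: _ \<Rightarrow> ennreal) \<in> borel_measurable \<mu>" using C by (simp add: sets_\<mu>)
  have ne: "X \<noteq> {}" using \<mu>.not_empty by (simp add: space_\<mu>)
  have Wm: "(\<lambda>x. \<integral>\<^sup>+y. W y \<partial>Q x) \<in> borel_measurable \<mu>" if "W \<in> borel_measurable (borel_on X)" for W
    using measurable_compose[OF Q_subprob nn_integral_measurable_subprob_algebra[OF that]]
    by (simp add: measurable_cong_sets[OF sets_\<mu> refl])
  have int: "(\<integral>\<^sup>+y. W y \<partial>N1) = (\<integral>\<^sup>+x. indicator C x * (\<integral>\<^sup>+y. W y \<partial>Q x) \<partial>\<mu>)"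
    if "W \<in> borel_measurable (borel_on X)" for W
  proof -
    have "(\<integral>\<^sup>+y. W y \<partial>N1) = (\<integral>\<^sup>+x. (\<integral>\<^sup>+y. W y \<partial>Q x) \<partial>density \<mu> (indicator C))"
      unfolding N1_def by (rule nn_integral_bind[OF that Qd])
    also have "\<dots> = (\<integral>\<^sup>+x. indicator C x * (\<integral>\<^sup>+y. W y \<partial>Q x) \<partial>\<mu>)"
      by (rule nn_integral_density[OF C' Wm[OF that]])
    finally show ?thesis .
  qed
  have sN1: "sets N1 = sets (borel_on X)"
    unfolding N1_def using ne by (intro sets_bind) (auto simp: space_\<mu> sets_Q)
  have "N1 = density \<mu> r"
  proof (rule measure_eqI)
    fix A assume "A \<in> sets N1"
    then have A: "A \<in> sets (borel_on X)" by (simp add: sN1)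
    have "emeasure N1 A = (\<integral>\<^sup>+y. indicator A y \<partial>N1)" using A by (simp add: sN1)
    also have "\<dots> = (\<integral>\<^sup>+x. indicator C x * (\<integral>\<^sup>+y. indicator A y \<partial>Q x) \<partial>\<mu>)"
      using A by (intro int) simp
    also have "\<dots> = (\<integral>\<^sup>+x. indicator C x * emeasure (Q x) A \<partial>\<mu>)"
      using A by (intro nn_integral_cong) (simp add: space_\<mu> sets_Q)
    also have "\<dots> = emeasure (density \<mu> r) A"
      using A joint[OF A] emeasure_pair_law_Times[OF C A] by (simp add: emeasure_density[OF r'] sets_\<mu>)
    finally show "emeasure N1 A = emeasure (density \<mu> r) A" .
  qed (simp add: sN1 sets_\<mu>)
  moreover have "(\<integral>\<^sup>+y. W y \<partial>density \<mu> r) = (\<integral>\<^sup>+y. r y * W y \<partial>\<mu>)"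
    using W by (intro nn_integral_density r') (simp add: measurable_cong_sets[OF sets_\<mu> refl])
  ultimately show ?thesis using int[OF W] by simp
qed

text \<open>By the Markov property the label of the present is conditionally independent of the future labels
  given the next point: the joint probability of a label \<open>v\<close> and future labels \<open>l\<close> is the integral of \<open>r v\<close>
  times the weight \<open>W l\<close> of the paths with labels \<open>l\<close>.\<close>

lemma point_cond_entropy_le_entropy_rate:
  fixes f :: "'a \<Rightarrow> 'c" and r :: "'c \<Rightarrow> 'a \<Rightarrow> real"
  assumes f: "simple_function (borel_on X) f"
    and r: "\<And>v. r v \<in> borel_measurable (borel_on X)"
    and r01: "\<And>v y. y \<in> X \<Longrightarrow> 0 \<le> r v y \<and> r v y \<le> 1"
    and joint: "\<And>v A. A \<in> sets (borel_on X) \<Longrightarrow>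
      emeasure pair_law ((f -` {v} \<inter> X) \<times> A) = (\<integral>\<^sup>+y. ennreal (r v y) * indicator A y \<partial>\<mu>)"
  shows "point_cond_entropy \<mu> ((\<lambda>\<omega>. f (\<omega> 0)) ` \<Omega>) r \<le> entropy_rate \<nu> orbit_shift (\<lambda>\<omega>. f (\<omega> 0))"
proof -
  interpret mpt: measure_preserving_map \<nu> orbit_shift by (rule \<nu>_mpt)
  let ?f = "\<lambda>\<omega>. f (\<omega> 0)"
  have sf: "simple_function \<nu> ?f" by (rule simple_function_\<nu>_coordinate[OF f])
  define cell where "cell v = f -` {v} \<inter> X" for v
  have cell: "cell v \<in> sets (borel_on X)" for v
    using simple_functionD(2)[OF f] by (simp add: cell_def)
  have \<Omega>X: "\<omega> i \<in> X" if "\<omega> \<in> \<Omega>" for \<omega> i using that by (auto simp: orbit_space_def)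
  show ?thesis
  proof (rule mpt.entropy_rate_ge[OF sf])
    fix n
    let ?G = "\<lambda>\<omega>. itinerary orbit_shift ?f n (orbit_shift \<omega>)"
    define L where "L = {l. set l \<subseteq> f ` X \<and> length l = n}"
    define W where "W l = path_weight Q (\<lambda>_. 1) (map cell l)" for l
    have G: "?G \<omega> = map (\<lambda>i. f (\<omega> (Suc i))) [0..<n]" for \<omega>
      by (simp add: itinerary_coordinate orbit_shift_def)
    have sG: "simple_function \<nu> ?G"
      by (rule mpt.simple_function_map[OF mpt.simple_function_itinerary[OF sf]])
    have finf: "finite (f ` X)" using simple_functionD(1)[OF f] by simp
    have finL: "finite L" unfolding L_def by (rule finite_lists_length_eq[OF finf])
    have GL: "?G ` space \<nu> \<subseteq> L" using \<Omega>X by (auto simp: space_\<nu> G L_def)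
    have cells: "set (map cell l) \<subseteq> sets (borel_on X)" for l using cell by auto
    have W: "W l \<in> borel_measurable (borel_on X)" for l
      unfolding W_def by (rule measurable_path_weight[OF _ cells]) simp
    have Wsum: "(\<Sum>l\<in>{l. set l \<subseteq> f ` X \<and> length l = m}. path_weight Q (\<lambda>_. 1) (map cell l) y) = 1"
      if "y \<in> X" for m y
      using that
    proof (induction m arbitrary: y)
      case 0
      have "{l. set l \<subseteq> f ` X \<and> length l = 0} = {[]}" by auto
      then show ?case by simp
    next
      case (Suc m)
      let ?L = "{l. set l \<subseteq> f ` X \<and> length l = m}"
      have "(\<Sum>l\<in>{l. set l \<subseteq> f ` X \<and> length l = Suc m}. path_weight Q (\<lambda>_. 1) (map cell l) y)
          = (\<Sum>(l, v)\<in>?L \<times> f ` X. indicator (cell v) y * (\<integral>\<^sup>+z. path_weight Q (\<lambda>_. 1) (map cell l) z \<partial>Q y))"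
        by (simp add: lists_length_Suc_eq sum.reindex inj_on_def case_prod_beta)
      also have "\<dots> = (\<Sum>v\<in>f ` X. indicator (cell v) y * (\<Sum>l\<in>?L. \<integral>\<^sup>+z. path_weight Q (\<lambda>_. 1) (map cell l) z \<partial>Q y))"
        by (simp add: sum.cartesian_product[symmetric] sum_distrib_left sum.swap[of _ "f ` X"])
      also have "(\<Sum>l\<in>?L. \<integral>\<^sup>+z. path_weight Q (\<lambda>_. 1) (map cell l) z \<partial>Q y)
          = (\<integral>\<^sup>+z. (\<Sum>l\<in>?L. path_weight Q (\<lambda>_. 1) (map cell l) z) \<partial>Q y)"
        by (intro nn_integral_sum[symmetric])
           (simp add: measurable_cong_sets[OF sets_Q[OF Suc(2)] refl] measurable_path_weight[OF _ cells])
      also have "\<dots> = (\<integral>\<^sup>+z. 1 \<partial>Q y)"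
        using Suc by (intro nn_integral_cong) (simp add: space_Q)
      also have "\<dots> = 1" using prob_space.emeasure_space_1[OF prob_space_Q[OF Suc(2)]] by simp
      also have "(\<Sum>v\<in>f ` X. indicator (cell v) y * 1) = (\<Sum>v\<in>f ` X. if v = f y then 1 else (0::ennreal))"
        using Suc(2) by (intro sum.cong) (auto simp: cell_def indicator_def)
      also have "\<dots> = 1" using finf Suc(2) by simp
      finally show ?case .
    qed
    have WL: "(\<Sum>l\<in>L. W l y) = 1" if "y \<in> X" for y
      using Wsum[OF that, of n] by (simp add: L_def W_def)
    have W1: "W l y \<le> 1" if "l \<in> L" "y \<in> X" for l y
      using member_le_sum[of l L "\<lambda>l. W l y"] WL that finL by auto
    have Wreal: "ennreal (enn2real (W l y)) = W l y" if "l \<in> L" "y \<in> X" for l y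
      using W1[OF that] by (intro ennreal_enn2real) (auto intro: le_less_trans)
    have Wr: "(\<lambda>y. enn2real (W l y)) \<in> borel_measurable \<mu>" for l
      using W by (simp add: measurable_cong_sets[OF sets_\<mu> refl])
    have rm: "r v \<in> borel_measurable \<mu>" for v
      using r by (simp add: measurable_cong_sets[OF sets_\<mu> refl])
    have meas: "measure \<nu> (cylinder X bs \<inter> \<Omega>) = enn2real (\<integral>\<^sup>+x. path_weight Q (\<lambda>_. 1) bs x \<partial>\<mu>)"
      if "set bs \<subseteq> sets (borel_on X)" for bs
      using emeasure_\<nu>[OF sets_cylinder[OF that]] emeasure_law_cylinder[OF that] by (simp add: measure_def)
    have Gcyl: "?G \<omega> = l \<longleftrightarrow> (\<forall>i<length l. \<omega> (Suc i) \<in> map cell l ! i)" if "\<omega> \<in> \<Omega>" "l \<in> L" for \<omega> l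
    proof -
      have "length l = n" using that by (simp add: L_def)
      then show ?thesis
        using \<Omega>X[OF that(1)] by (auto simp: G list_eq_iff_nth_eq cell_def)
    qed
    have "point_cond_entropy \<mu> (?f ` space \<nu>) r \<le> cond_entropy \<nu> ?f ?G"
    proof (rule mpt.point_cond_entropy_le[where L=L and w="\<lambda>l y. enn2real (W l y)"])
      show "prob_space \<mu>" by (rule \<mu>.prob_space_axioms)
      show "0 \<le> r v y \<and> r v y \<le> 1" if "y \<in> space \<mu>" for v y using r01 that by (simp add: space_\<mu>)
      show "(\<Sum>l\<in>L. enn2real (W l y)) = 1" if "y \<in> space \<mu>" for y
      proof -
        have y: "y \<in> X" using that by (simp add: space_\<mu>)
        have "ennreal (\<Sum>l\<in>L. enn2real (W l y)) = (\<Sum>l\<in>L. W l y)"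
          using Wreal y by (simp add: sum_ennreal[symmetric] cong: sum.cong)
        then show ?thesis using WL[OF y] by (simp add: sum_nonneg)
      qed
      fix l assume l: "l \<in> L"
      have eq: "?G -` {l} \<inter> space \<nu> = cylinder X (X # map cell l) \<inter> \<Omega>"
        using Gcyl[OF _ l] \<Omega>X by (auto simp: space_\<nu> cylinder_Cons) (auto simp: cylinder_def orbit_shift_def)
      have "measure \<nu> (?G -` {l} \<inter> space \<nu>) = enn2real (\<integral>\<^sup>+x. path_weight Q (\<lambda>_. 1) (X # map cell l) x \<partial>\<mu>)"
        unfolding eq by (rule meas) (use cell carrier_in_sets_borel_on in auto)
      also have "(\<integral>\<^sup>+x. path_weight Q (\<lambda>_. 1) (X # map cell l) x \<partial>\<mu>) = (\<integral>\<^sup>+x. (\<integral>\<^sup>+y. W l y \<partial>Q x) \<partial>\<mu>)"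
        by (intro nn_integral_cong) (simp add: space_\<mu> W_def)
      also have "\<dots> = (\<integral>\<^sup>+x. ennreal (enn2real (W l x)) \<partial>\<mu>)"
        unfolding nn_integral_Q_\<mu>[OF W] using Wreal[OF l] by (intro nn_integral_cong) (simp add: space_\<mu>)
      also have "enn2real \<dots> = (\<integral>y. enn2real (W l y) \<partial>\<mu>)"
        using Wr by (intro integral_eq_nn_integral[symmetric]) auto
      finally show "measure \<nu> (?G -` {l} \<inter> space \<nu>) = (\<integral>y. enn2real (W l y) \<partial>\<mu>)" .
      fix v
      have eq: "(\<lambda>\<omega>. (f (\<omega> 0), ?G \<omega>)) -` {(v, l)} \<inter> space \<nu> = cylinder X (cell v # map cell l) \<inter> \<Omega>"
        using Gcyl[OF _ l] \<Omega>X
        by (auto simp: space_\<nu> cylinder_Cons) (auto simp: cylinder_def orbit_shift_def cell_def)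
      have "measure \<nu> ((\<lambda>\<omega>. (f (\<omega> 0), ?G \<omega>)) -` {(v, l)} \<inter> space \<nu>)
          = enn2real (\<integral>\<^sup>+x. indicator (cell v) x * (\<integral>\<^sup>+y. W l y \<partial>Q x) \<partial>\<mu>)"
        unfolding eq using meas[of "cell v # map cell l"] cell by (simp add: W_def image_subset_iff)
      also have "(\<integral>\<^sup>+x. indicator (cell v) x * (\<integral>\<^sup>+y. W l y \<partial>Q x) \<partial>\<mu>) = (\<integral>\<^sup>+y. ennreal (r v y) * W l y \<partial>\<mu>)"
        by (rule nn_integral_pair_law[OF cell W]) (use r joint in \<open>auto simp: cell_def\<close>)
      also have "\<dots> = (\<integral>\<^sup>+y. ennreal (r v y * enn2real (W l y)) \<partial>\<mu>)"
        using Wreal[OF l] r01 by (intro nn_integral_cong) (simp add: space_\<mu> ennreal_mult)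
      also have "enn2real \<dots> = (\<integral>y. r v y * enn2real (W l y) \<partial>\<mu>)"
        using Wr rm r01 by (intro integral_eq_nn_integral[symmetric]) (auto simp: space_\<mu> intro!: AE_I2)
      finally show "measure \<nu> ((\<lambda>\<omega>. (f (\<omega> 0), ?G \<omega>)) -` {(v, l)} \<inter> space \<nu>) = (\<integral>y. r v y * enn2real (W l y) \<partial>\<mu>)" .
    qed (use sf sG finL GL Wr rm in auto)
    then show "point_cond_entropy \<mu> (?f ` \<Omega>) r \<le> cond_entropy \<nu> ?f ?G" by (simp add: space_\<nu>)
  qed
qed

end

section \<open>Kernels from invariant measures\<close>

lemma ex_conditional_probabilities:
  fixes X :: "'a::metric_space set" and f :: "'a \<Rightarrow> 'c"
  assumes X: "compact X" and P: "prob_space P" and sets_P: "sets P = sets (borel_on (X \<times> X))"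
    and sets_\<mu>: "sets \<mu> = sets (borel_on X)" and snd_P: "distr P (borel_on X) snd = \<mu>"
    and f: "simple_function (borel_on X) f"
  obtains r :: "'c \<Rightarrow> 'a \<Rightarrow> real" where "\<forall>v. r v \<in> borel_measurable (borel_on X)"
    "\<forall>v. \<forall>y\<in>X. 0 \<le> r v y \<and> r v y \<le> 1"
    "\<forall>v. \<forall>A\<in>sets (borel_on X).
      emeasure P ((f -` {v} \<inter> X) \<times> A) = (\<integral>\<^sup>+y. ennreal (r v y) * indicator A y \<partial>\<mu>)"
proof -
  interpret P: prob_space P by (rule P)
  have sets_P': "sets P = sets (borel_on X \<Otimes>\<^sub>M borel_on X)"
    by (simp add: sets_P sets_borel_on_Times[OF X X])
  note [measurable_cong] = sets_P' sets_\<mu>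
  have sP: "space P = X \<times> X" using sets_eq_imp_space_eq[OF sets_P] by simp
  define N where "N = distr P (\<mu> \<Otimes>\<^sub>M borel_on X) (\<lambda>p. (snd p, fst p))"
  have swap: "(\<lambda>p. (snd p, fst p)) \<in> P \<rightarrow>\<^sub>M \<mu> \<Otimes>\<^sub>M borel_on X" by measurable
  have mu: "prob_space \<mu>"
    unfolding snd_P[symmetric] by (rule P.prob_space_distr) measurable
  have "distr N \<mu> fst = distr P \<mu> (fst \<circ> (\<lambda>p. (snd p, fst p)))"
    unfolding N_def by (rule distr_distr[OF _ swap]) measurable
  also have "\<dots> = distr P (borel_on X) snd"
    by (rule distr_cong) (simp_all add: sets_\<mu>)
  finally have fst_N: "distr N \<mu> fst = \<mu>" by (simp add: snd_P)
  obtain K where K: "K \<in> \<mu> \<rightarrow>\<^sub>M prob_algebra (borel_on X)"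
    "\<And>A B. A \<in> sets \<mu> \<Longrightarrow> B \<in> sets (borel_on X) \<Longrightarrow>
       emeasure N (A \<times> B) = (\<integral>\<^sup>+x. indicator A x * emeasure (K x) B \<partial>\<mu>)"
  proof (rule disintegration_compact[OF X mu _ fst_N])
    show "sets N = sets (\<mu> \<Otimes>\<^sub>M borel_on X)" by (simp add: N_def)
  qed (rule that)
  have K': "K \<in> borel_on X \<rightarrow>\<^sub>M prob_algebra (borel_on X)"
    using K(1) by (simp add: measurable_cong_sets[OF sets_\<mu> refl])
  have Kp: "prob_space (K y)" if "y \<in> X" for y
    using measurable_space[OF K'] that by (simp add: space_prob_algebra)
  define cell where "cell v = f -` {v} \<inter> X" for v
  have cell: "cell v \<in> sets (borel_on X)" for v
    using simple_functionD(2)[OF f] by (simp add: cell_def)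
  show ?thesis
  proof (rule that; intro allI ballI)
    show "(\<lambda>y. measure (K y) (cell v)) \<in> borel_measurable (borel_on X)" for v
      by (rule measurable_compose[OF measurable_prob_algebraD[OF K'] measurable_measure_subprob_algebra[OF cell]])
    show "0 \<le> measure (K y) (cell v) \<and> measure (K y) (cell v) \<le> 1" if "y \<in> X" for v y
      using prob_space.prob_le_1[OF Kp[OF that]] by simp
    fix v A assume A: "A \<in> sets (borel_on X)"
    have "emeasure N (A \<times> cell v) = emeasure P ((\<lambda>p. (snd p, fst p)) -` (A \<times> cell v) \<inter> space P)"
      unfolding N_def using A cell by (intro emeasure_distr[OF swap]) (simp add: sets_\<mu>)
    also have "(\<lambda>p. (snd p, fst p)) -` (A \<times> cell v) \<inter> space P = cell v \<times> A"
      using sets.sets_into_space[OF A] by (auto simp: sP cell_def)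
    finally have "emeasure P (cell v \<times> A) = (\<integral>\<^sup>+y. indicator A y * emeasure (K y) (cell v) \<partial>\<mu>)"
      using K(2)[of A "cell v"] A cell by (simp add: sets_\<mu>)
    also have "\<dots> = (\<integral>\<^sup>+y. ennreal (measure (K y) (cell v)) * indicator A y \<partial>\<mu>)"
    proof (rule nn_integral_cong)
      fix y assume "y \<in> space \<mu>"
      then have "y \<in> X" using sets_eq_imp_space_eq[OF sets_\<mu>] by simp
      then interpret K: prob_space "K y" by (rule Kp)
      show "indicator A y * emeasure (K y) (cell v) = ennreal (measure (K y) (cell v)) * indicator A y"
        by (simp add: K.emeasure_eq_measure mult.commute)
    qed
    finally show "emeasure P ((f -` {v} \<inter> X) \<times> A) = (\<integral>\<^sup>+y. ennreal (measure (K y) (cell v)) * indicator A y \<partial>\<mu>)"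
      by (simp add: cell_def)
  qed
qed

lemma ex_small_partition:
  fixes X :: "'a::metric_space set"
  assumes X: "compact X" and e: "0 < e"
  obtains f :: "'a \<Rightarrow> nat" where "simple_function (borel_on X) f"
    "\<forall>x\<in>X. \<forall>y\<in>X. f x = f y \<longrightarrow> dist x y \<le> e"
proof -
  obtain k where k: "finite k" "k \<subseteq> X" "X \<subseteq> (\<Union>x\<in>k. ball x (e / 2))"
    using seq_compact_imp_totally_bounded[OF compact_imp_seq_compact[OF X]] e by (meson half_gt_zero)
  obtain xs where xs: "set xs = k" using finite_list[OF k(1)] by blast
  define f where "f x = (LEAST i. i < length xs \<longrightarrow> dist (xs ! i) x < e / 2)" for x
  have ex: "\<exists>i<length xs. dist (xs ! i) x < e / 2" if x: "x \<in> X" for x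
  proof -
    obtain y where "y \<in> set xs" "dist y x < e / 2" using k(3) x xs by auto
    then show ?thesis unfolding in_set_conv_nth by blast
  qed
  have f: "f x < length xs \<and> dist (xs ! f x) x < e / 2" if x: "x \<in> X" for x
  proof -
    obtain i where i: "i < length xs" "dist (xs ! i) x < e / 2" using ex[OF x] by blast
    have "f x \<le> i" unfolding f_def by (rule Least_le) (use i in simp)
    moreover have "f x < length xs \<longrightarrow> dist (xs ! f x) x < e / 2"
      unfolding f_def by (rule LeastI[of _ i]) (use i in simp)
    ultimately show ?thesis using i by auto
  qed
  have "f ` X \<subseteq> {..<length xs}" using f by auto
  then have fin: "finite (f ` X)" using finite_subset by blast
  have [measurable]: "(\<lambda>x. dist y x) \<in> borel_measurable (borel_on X)" for y
    by (rule borel_measurable_dist_borel_on)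
  have "f \<in> borel_on X \<rightarrow>\<^sub>M count_space UNIV"
    unfolding f_def by (intro measurable_Least) measurable
  then have "f -` {v} \<inter> X \<in> sets (borel_on X)" for v
    using measurable_sets[of f "borel_on X" "count_space UNIV" "{v}"] by simp
  with fin have "simple_function (borel_on X) f" by (simp add: simple_function_def)
  moreover have "\<forall>x\<in>X. \<forall>y\<in>X. f x = f y \<longrightarrow> dist x y \<le> e"
  proof (intro ballI impI)
    fix x y assume xy: "x \<in> X" "y \<in> X" "f x = f y"
    have "dist (xs ! f x) x < e / 2" "dist (xs ! f x) y < e / 2"
      using f[OF xy(1)] f[OF xy(2)] xy(3) by auto
    then show "dist x y \<le> e" using dist_triangle3[of x y "xs ! f x"] by linarith
  qed
  ultimately show ?thesis by (rule that)
qed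

text \<open>The conditional law of the second coordinate given the first, corrected on a null set by a
  measurable selection of \<open>T\<close>.\<close>

lemma ex_kernel_of_joint_law:
  fixes X :: "'a::metric_space set"
  assumes X: "compact X" and T: "correspondence X T"
    and P: "prob_space P" and sets_P: "sets P = sets (borel_on (X \<times> X))"
    and P_graph: "emeasure P (corr_graph X T) = 1"
    and fst_P: "distr P (borel_on X) fst = \<mu>" and snd_P: "distr P (borel_on X) snd = \<mu>"
  obtains Q where "Q \<in> kernels X T" "\<mu> \<in> stationary_probs X Q"
    "\<mu> \<bind> (\<lambda>x. distr (Q x) (borel_on (X \<times> X)) (Pair x)) = P"
proof -
  interpret P: prob_space P by (rule P)
  have sets_P': "sets P = sets (borel_on X \<Otimes>\<^sub>M borel_on X)"
    by (simp add: sets_P sets_borel_on_Times[OF X X])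
  note [measurable_cong] = sets_P'
  have sP: "space P = X \<times> X" using sets_eq_imp_space_eq[OF sets_P] by simp
  have sets_\<mu>: "sets \<mu> = sets (borel_on X)" by (simp add: fst_P[symmetric])
  have s\<mu>: "space \<mu> = X" using sets_eq_imp_space_eq[OF sets_\<mu>] by simp
  have mu: "prob_space \<mu>" unfolding fst_P[symmetric] by (rule P.prob_space_distr) measurable
  interpret \<mu>: prob_space \<mu> by (rule mu)
  have \<mu>b: "\<mu> \<in> borel_probs X" using mu sets_\<mu> by (simp add: borel_probs_def)
  have ne: "X \<noteq> {}" using \<mu>.not_empty s\<mu> by simp
  have TX: "T x \<subseteq> X" "T x \<in> sets (borel_on X)" if "x \<in> X" for x
    using correspondence_values[OF T that] by auto
  have fst_P': "distr P \<mu> fst = \<mu>"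
    using distr_cong[OF refl sets_\<mu>, of P fst fst] fst_P by simp
  obtain K where K: "K \<in> \<mu> \<rightarrow>\<^sub>M prob_algebra (borel_on X)"
    "\<And>A B. A \<in> sets \<mu> \<Longrightarrow> B \<in> sets (borel_on X) \<Longrightarrow>
       emeasure P (A \<times> B) = (\<integral>\<^sup>+x. indicator A x * emeasure (K x) B \<partial>\<mu>)"
  proof (rule disintegration_compact[OF X mu _ fst_P'])
    show "sets P = sets (\<mu> \<Otimes>\<^sub>M borel_on X)"
      unfolding sets_P' by (rule sets_pair_measure_cong[OF sets_\<mu>[symmetric] refl])
  qed (rule that)
  have K': "K \<in> borel_on X \<rightarrow>\<^sub>M prob_algebra (borel_on X)"
    using K(1) by (simp add: measurable_cong_sets[OF sets_\<mu> refl])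
  interpret K: markov_kernel X K \<mu>
    using X \<mu>b K' by unfold_locales
  have PK: "K.pair_law = P"
  proof (rule measure_eqI_rectangles[OF X K.sets_pair_law sets_P])
    show "finite_measure K.pair_law"
    proof
      have "emeasure K.pair_law (X \<times> X) = (\<integral>\<^sup>+x. indicator X x * emeasure (K x) X \<partial>\<mu>)"
        by (rule K.emeasure_pair_law_Times[OF carrier_in_sets_borel_on carrier_in_sets_borel_on])
      also have "\<dots> = emeasure P (X \<times> X)"
        using K(2)[of X X] carrier_in_sets_borel_on[of X] by (simp add: sets_\<mu>)
      finally show "emeasure K.pair_law (space K.pair_law) \<noteq> \<infinity>"
        using sets_eq_imp_space_eq[OF K.sets_pair_law] P.emeasure_finite by simp
    qed
  qed (simp add: K.emeasure_pair_law_Times K(2) sets_\<mu>)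
  obtain t where t: "t \<in> borel_on X \<rightarrow>\<^sub>M borel_on X" "\<And>x. x \<in> X \<Longrightarrow> t x \<in> T x"
    using correspondence_selection[OF X ne T] by metis
  have \<Gamma>: "corr_graph X T \<in> sets (borel_on X \<Otimes>\<^sub>M borel_on X)"
    using sets_corr_graph[OF T] by (simp only: sets_borel_on_Times[OF X X])
  define KT where "KT x = measure (K x) (T x)" for x
  have KT: "KT \<in> borel_measurable (borel_on X)"
    unfolding KT_def
  proof (rule measure_measurable_prob_algebra2[OF _ K'])
    have "Sigma X T = corr_graph X T" using TX by (auto simp: corr_graph_def)
    then show "Sigma (space (borel_on X)) T \<in> sets (borel_on X \<Otimes>\<^sub>M borel_on X)" using \<Gamma> by simp
  qed
  define Q where "Q x = (if KT x = 1 then K x else return (borel_on X) (t x))" for x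
  have Qm: "Q \<in> borel_on X \<rightarrow>\<^sub>M prob_algebra (borel_on X)"
  proof -
    note [measurable] = KT
    show ?thesis
      unfolding Q_def
      by (intro measurable_If K' measurable_compose[OF t(1) measurable_return_prob_space]) measurable
  qed
  interpret Q: markov_kernel X Q \<mu>
    using X \<mu>b Qm by unfold_locales
  have QT: "measure (Q x) (T x) = 1" if x: "x \<in> X" for x
    using TX[OF x] t(2)[OF x] by (auto simp: Q_def KT_def measure_return indicator_def)
  have "Q \<in> kernels X T"
    unfolding kernels_def
  proof (intro CollectI conjI ballI Qm subsetI)
    fix x y assume x: "x \<in> X" and y: "y \<in> measure_support (Q x)"
    interpret Qx: prob_space "Q x" by (rule Q.prob_space_Q[OF x])
    show "y \<in> T x"
    proof (rule ccontr)
      assume "y \<notin> T x"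
      have yX: "y \<in> X" using y Q.space_Q[OF x] by (auto simp: measure_support_def)
      have "openin (top_of_set X) (X - T x)"
        using openin_diff[OF openin_subtopology_self closedin_correspondence[OF T x]] by simp
      then have "0 < emeasure (Q x) (X - T x)"
        using y yX \<open>y \<notin> T x\<close> Q.space_Q[OF x] by (auto simp: measure_support_def)
      moreover have "measure (Q x) (X - T x) = 0"
        using Qx.prob_compl[of "T x"] TX[OF x] QT[OF x] Q.sets_Q[OF x] Q.space_Q[OF x] by simp
      ultimately show False by (simp add: Qx.emeasure_eq_measure)
    qed
  qed
  have AE_KT: "AE x in \<mu>. KT x = 1"
  proof -
    have KTm: "(\<lambda>x. ennreal (KT x)) \<in> borel_measurable \<mu>"
      using KT by (simp add: measurable_cong_sets[OF sets_\<mu> refl])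
    have KT1: "KT x \<le> 1" if "x \<in> X" for x
      unfolding KT_def by (rule prob_space.prob_le_1[OF K.prob_space_Q[OF that]])
    have "1 = (\<integral>\<^sup>+x. emeasure (K x) (Pair x -` corr_graph X T \<inter> X) \<partial>\<mu>)"
      using K.emeasure_pair_law[of "corr_graph X T"] \<Gamma> P_graph PK
      by (simp add: sets_borel_on_Times[OF X X])
    also have "\<dots> = (\<integral>\<^sup>+x. ennreal (KT x) \<partial>\<mu>)"
    proof (rule nn_integral_cong)
      fix x assume "x \<in> space \<mu>"
      then have x: "x \<in> X" by (simp add: s\<mu>)
      have "Pair x -` corr_graph X T \<inter> X = T x" using TX[OF x] x by (auto simp: corr_graph_def)
      then show "emeasure (K x) (Pair x -` corr_graph X T \<inter> X) = ennreal (KT x)"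
        using finite_measure.emeasure_eq_measure[OF prob_space.finite_measure[OF K.prob_space_Q[OF x]]]
        by (simp add: KT_def)
    qed
    finally have int1: "(\<integral>\<^sup>+x. ennreal (KT x) \<partial>\<mu>) = 1" by simp
    have "(\<integral>\<^sup>+x. 1 - ennreal (KT x) \<partial>\<mu>) = (\<integral>\<^sup>+x. 1 \<partial>\<mu>) - (\<integral>\<^sup>+x. ennreal (KT x) \<partial>\<mu>)"
      using int1 KT1 by (intro nn_integral_diff KTm AE_I2) (auto simp: s\<mu>)
    also have "\<dots> = 0" using int1 \<mu>.emeasure_space_1 by simp
    finally have "AE x in \<mu>. 1 - ennreal (KT x) = 0"
      using KTm by (subst (asm) nn_integral_0_iff_AE) auto
    then show ?thesis
    proof (rule AE_mp, intro AE_I2 impI)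
      fix x assume x: "x \<in> space \<mu>" and "1 - ennreal (KT x) = 0"
      then have "1 \<le> KT x" by (simp add: diff_eq_0_iff_ennreal)
      then show "KT x = 1" using KT1 x by (simp add: s\<mu> antisym)
    qed
  qed
  have PQ: "Q.pair_law = P"
  proof (rule measure_eqI_rectangles[OF X Q.sets_pair_law sets_P, symmetric, THEN sym])
    have rect: "emeasure Q.pair_law (A \<times> B) = emeasure P (A \<times> B)"
      if "A \<in> sets (borel_on X)" "B \<in> sets (borel_on X)" for A B
    proof -
      have "emeasure Q.pair_law (A \<times> B) = (\<integral>\<^sup>+x. indicator A x * emeasure (K x) B \<partial>\<mu>)"
        unfolding Q.emeasure_pair_law_Times[OF that]
        using AE_KT by (intro nn_integral_cong_AE) (auto simp: Q_def elim: eventually_mono)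
      then show ?thesis using K(2) that by (simp add: sets_\<mu>)
    qed
    then show "\<And>A B. A \<in> sets (borel_on X) \<Longrightarrow> B \<in> sets (borel_on X) \<Longrightarrow>
        emeasure Q.pair_law (A \<times> B) = emeasure P (A \<times> B)" .
    show "finite_measure Q.pair_law"
    proof
      show "emeasure Q.pair_law (space Q.pair_law) \<noteq> \<infinity>"
        using sets_eq_imp_space_eq[OF Q.sets_pair_law] P.emeasure_finite rect[OF carrier_in_sets_borel_on carrier_in_sets_borel_on] by simp
    qed
  qed
  have "\<mu> \<bind> Q = \<mu>"
  proof (rule measure_eqI)
    have Qs: "Q \<in> \<mu> \<rightarrow>\<^sub>M subprob_algebra (borel_on X)"
      using Q.Q_subprob by (simp add: measurable_cong_sets[OF sets_\<mu> refl])
    show sb: "sets (\<mu> \<bind> Q) = sets \<mu>"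
      using ne Q.sets_Q by (subst sets_bind[where N="borel_on X"]) (auto simp: s\<mu> sets_\<mu>)
    fix B assume "B \<in> sets (\<mu> \<bind> Q)"
    then have B: "B \<in> sets (borel_on X)" by (simp add: sb sets_\<mu>)
    have "emeasure (\<mu> \<bind> Q) B = (\<integral>\<^sup>+x. emeasure (Q x) B \<partial>\<mu>)"
      using ne by (intro emeasure_bind[OF _ Qs B]) (simp add: s\<mu>)
    also have "\<dots> = emeasure P (X \<times> B)"
      unfolding PQ[symmetric] Q.emeasure_pair_law_Times[OF carrier_in_sets_borel_on B]
      by (intro nn_integral_cong) (simp add: s\<mu>)
    also have "X \<times> B = snd -` B \<inter> space P" using sets.sets_into_space[OF B] by (auto simp: sP)
    also have "emeasure P \<dots> = emeasure (distr P (borel_on X) snd) B"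
      using B by (intro emeasure_distr[symmetric]) measurable
    finally show "emeasure (\<mu> \<bind> Q) B = emeasure \<mu> B" by (simp add: snd_P)
  qed
  then have "\<mu> \<in> stationary_probs X Q" using \<mu>b by (simp add: stationary_probs_def)
  with \<open>Q \<in> kernels X T\<close> show ?thesis
    using PQ by (intro that) (simp_all add: Q.pair_law_def)
qed

section \<open>Forward expansive correspondences\<close>

text \<open>A forward expansive correspondence on a compact space, with a fixed expansivity constant \<open>e0\<close>.\<close>

locale expansive_correspondence =
  fixes X :: "'a::metric_space set" and T :: "'a \<Rightarrow> 'a set" and e0 :: real
  assumes compact_space: "compact X" and corr: "correspondence X T" and e0: "0 < e0"
    and expansive: "\<And>x y. x \<in> orbit_space X T \<Longrightarrow> y \<in> orbit_space X T \<Longrightarrow>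
      (\<And>j. dist (x j) (y j) \<le> e0) \<Longrightarrow> x = y"
begin

abbreviation "\<Omega> \<equiv> orbit_space X T"

lemma measurable_coordinate: "(\<lambda>\<omega>. \<omega> i) \<in> borel_on \<Omega> \<rightarrow>\<^sub>M borel_on X"
  by (intro measurable_borel_on_continuous continuous_on_subset[OF continuous_on_product_coordinates])
     (auto simp: orbit_space_def)

lemma shift_space: "\<omega> \<in> \<Omega> \<Longrightarrow> orbit_shift \<omega> \<in> \<Omega>"
  by (auto simp: orbit_space_def orbit_shift_def)

lemma simple_function_coordinate:
  assumes "sets \<nu> = sets (borel_on \<Omega>)" "simple_function (borel_on X) f"
  shows "simple_function \<nu> (\<lambda>\<omega>. f (\<omega> i))"
proof -
  have "(\<lambda>\<omega>. \<omega> i) \<in> \<nu> \<rightarrow>\<^sub>M borel_on X"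
    using measurable_coordinate[of i] by (simp add: measurable_cong_sets[OF assms(1) refl])
  then show ?thesis by (rule simple_function_comp[OF _ assms(2)])
qed

text \<open>A partition into cells of diameter at most \<open>e0\<close> is generating.\<close>

lemma
  assumes \<nu>: "\<nu> \<in> invariant_probs \<Omega> orbit_shift" and f: "simple_function (borel_on X) f"
    and small: "\<And>x y. x \<in> X \<Longrightarrow> y \<in> X \<Longrightarrow> f x = f y \<Longrightarrow> dist x y \<le> e0"
  shows ks_entropy_eq_entropy_rate:
      "ks_entropy \<nu> orbit_shift = ereal (entropy_rate \<nu> orbit_shift (\<lambda>\<omega>. f (\<omega> 0)))"
    and entropy_rate_le_cond_entropy_coordinate:
      "simple_function \<nu> h \<Longrightarrow>
        entropy_rate \<nu> orbit_shift (\<lambda>\<omega>. f (\<omega> 0)) \<le> cond_entropy \<nu> (\<lambda>\<omega>. f (\<omega> 0)) (\<lambda>\<omega>. h (orbit_shift \<omega>))"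
proof -
  have mpt: "measure_preserving_map \<nu> orbit_shift"
    by (rule invariant_probs_measure_preserving[OF \<nu> shift_space])
  interpret mpt: measure_preserving_map \<nu> orbit_shift by (rule mpt)
  have sets: "sets \<nu> = sets (borel_on \<Omega>)" using \<nu> by (auto simp: invariant_probs_def borel_probs_def)
  have sf: "simple_function \<nu> (\<lambda>\<omega>. f (\<omega> 0))" by (rule simple_function_coordinate[OF sets f])
  have approx: "mpt.approximable (\<lambda>\<omega>. f (\<omega> 0)) A" if "A \<in> sets \<nu>" for A
  proof (rule expansive_approximable[OF mpt sets compact_orbit_space[OF compact_space corr] _ _ _ sf that])
    show "\<omega> j \<in> X" if "\<omega> \<in> \<Omega>" for \<omega> j using that by (simp add: orbit_space_def)
    show "x = y" if "x \<in> \<Omega>" "y \<in> \<Omega>" "\<And>j. dist (x j) (y j) \<le> e0" for x y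
      by (rule expansive[OF that])
    show "dist x y \<le> e0" if "x \<in> X" "y \<in> X" "f x = f y" for x y
      by (rule small[OF that])
  qed
  show "ks_entropy \<nu> orbit_shift = ereal (entropy_rate \<nu> orbit_shift (\<lambda>\<omega>. f (\<omega> 0)))"
    by (rule mpt.ks_entropy_generator[OF sf approx])
  show "simple_function \<nu> h \<Longrightarrow>
        entropy_rate \<nu> orbit_shift (\<lambda>\<omega>. f (\<omega> 0)) \<le> cond_entropy \<nu> (\<lambda>\<omega>. f (\<omega> 0)) (\<lambda>\<omega>. h (orbit_shift \<omega>))"
    by (rule mpt.entropy_rate_le_cond_entropy_next[OF sf approx])
qed

text \<open>\<open>\<nu>\<close> and the Markov measure have the same law of the first two coordinates, hence the same
  conditional entropy of the present label given the next point. It bounds the entropy rate of the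
  labels from above for \<open>\<nu>\<close> and from below for the Markov measure.\<close>

lemma ex_kernel_entropy_ge:
  assumes \<nu>: "\<nu> \<in> invariant_probs \<Omega> orbit_shift"
  shows "\<exists>Q\<in>kernels X T. \<exists>\<mu>\<in>stationary_probs X Q.
    distr \<nu> (borel_on (corr_graph X T)) p2 = graph_measure X T \<mu> Q \<and>
    ks_entropy \<nu> orbit_shift \<le> kernel_entropy X \<mu> Q"
proof -
  have sets: "sets \<nu> = sets (borel_on \<Omega>)" and ps: "prob_space \<nu>"
    using \<nu> by (auto simp: invariant_probs_def borel_probs_def)
  interpret \<nu>: prob_space \<nu> by (rule ps)
  interpret mpt: measure_preserving_map \<nu> orbit_shift
    by (rule invariant_probs_measure_preserving[OF \<nu> shift_space])
  have sp: "space \<nu> = \<Omega>" using sets_eq_imp_space_eq[OF sets] by simp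
  have coord: "(\<lambda>\<omega>. \<omega> i) \<in> \<nu> \<rightarrow>\<^sub>M borel_on X" for i
    using measurable_coordinate by (simp add: measurable_cong_sets[OF sets refl])
  define \<mu> where "\<mu> = distr \<nu> (borel_on X) (\<lambda>\<omega>. \<omega> 0)"
  have next_law: "distr \<nu> (borel_on X) (\<lambda>\<omega>. \<omega> 1) = \<mu>"
  proof -
    have "distr (distr \<nu> \<nu> orbit_shift) (borel_on X) (\<lambda>\<omega>. \<omega> 0) = distr \<nu> (borel_on X) ((\<lambda>\<omega>. \<omega> 0) \<circ> orbit_shift)"
      by (rule distr_distr[OF coord mpt.measurable_map])
    then show ?thesis by (simp add: mpt.distr_map \<mu>_def comp_def orbit_shift_def)
  qed
  have sets_XX: "sets (borel_on (X \<times> X)) = sets (borel_on X \<Otimes>\<^sub>M borel_on X)"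
    by (rule sets_borel_on_Times[OF compact_space compact_space])
  have p2m: "p2 \<in> \<nu> \<rightarrow>\<^sub>M borel_on (X \<times> X)"
    unfolding measurable_cong_sets[OF refl sets_XX] p2_def[abs_def]
    by (intro measurable_Pair coord)
  define P where "P = distr \<nu> (borel_on (X \<times> X)) p2"
  have P: "prob_space P" unfolding P_def by (rule \<nu>.prob_space_distr[OF p2m])
  have sets_P: "sets P = sets (borel_on (X \<times> X))" by (simp add: P_def)
  have fstm: "fst \<in> borel_on (X \<times> X) \<rightarrow>\<^sub>M borel_on X" "snd \<in> borel_on (X \<times> X) \<rightarrow>\<^sub>M borel_on X"
    unfolding measurable_cong_sets[OF sets_XX refl] by measurable
  have fst_P: "distr P (borel_on X) fst = \<mu>" and snd_P: "distr P (borel_on X) snd = \<mu>"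
    unfolding P_def using next_law
    by (simp_all add: distr_distr[OF fstm(1) p2m] distr_distr[OF fstm(2) p2m] comp_def p2_def \<mu>_def)
  note \<Gamma> = sets_corr_graph[OF corr]
  have "p2 -` corr_graph X T \<inter> space \<nu> = space \<nu>"
    by (auto simp: sp p2_def corr_graph_def orbit_space_def)
  then have P_graph: "emeasure P (corr_graph X T) = 1"
    unfolding P_def by (simp add: emeasure_distr[OF p2m \<Gamma>] \<nu>.emeasure_space_1)
  obtain Q where Q: "Q \<in> kernels X T" "\<mu> \<in> stationary_probs X Q"
    and QP: "\<mu> \<bind> (\<lambda>x. distr (Q x) (borel_on (X \<times> X)) (Pair x)) = P"
    by (rule ex_kernel_of_joint_law[OF compact_space corr P sets_P P_graph fst_P snd_P])
  interpret Q: stationary_markov X T Q \<mu>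
    using compact_space corr Q by unfold_locales
  have PL: "Q.pair_law = P" by (simp add: Q.pair_law_def QP)
  have "distr \<nu> (borel_on (corr_graph X T)) p2 = restrict_space P (corr_graph X T)"
    by (rule distr_p2_corr_graph[OF compact_space corr sets sets_P]) (simp add: P_def)
  also have "\<dots> = graph_measure X T \<mu> Q" by (simp add: graph_measure_def QP)
  finally have marg: "distr \<nu> (borel_on (corr_graph X T)) p2 = graph_measure X T \<mu> Q" .
  obtain f :: "'a \<Rightarrow> nat" where f': "simple_function (borel_on X) f"
    "\<forall>x\<in>X. \<forall>y\<in>X. f x = f y \<longrightarrow> dist x y \<le> e0"
    by (rule ex_small_partition[OF compact_space e0])
  have f: "simple_function (borel_on X) f" "x \<in> X \<Longrightarrow> y \<in> X \<Longrightarrow> f x = f y \<Longrightarrow> dist x y \<le> e0" for x y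
    using f' by blast+
  let ?f = "\<lambda>\<omega>. f (\<omega> 0)"
  obtain r :: "nat \<Rightarrow> 'a \<Rightarrow> real" where r': "\<forall>v. r v \<in> borel_measurable (borel_on X)"
    "\<forall>v. \<forall>y\<in>X. 0 \<le> r v y \<and> r v y \<le> 1"
    "\<forall>v. \<forall>A\<in>sets (borel_on X).
      emeasure P ((f -` {v} \<inter> X) \<times> A) = (\<integral>\<^sup>+y. ennreal (r v y) * indicator A y \<partial>\<mu>)"
    by (rule ex_conditional_probabilities[OF compact_space P sets_P Q.sets_\<mu> snd_P f(1)])
  have r: "r v \<in> borel_measurable (borel_on X)" "y \<in> X \<Longrightarrow> 0 \<le> r v y \<and> r v y \<le> 1"
    "A \<in> sets (borel_on X) \<Longrightarrow>
      emeasure P ((f -` {v} \<inter> X) \<times> A) = (\<integral>\<^sup>+y. ennreal (r v y) * indicator A y \<partial>\<mu>)" for v y A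
    using r' by blast+
  have sf: "simple_function \<nu> ?f" by (rule simple_function_coordinate[OF sets f(1)])
  have Y: "(\<lambda>\<omega>. \<omega> 1) \<in> \<nu> \<rightarrow>\<^sub>M \<mu>" "distr \<nu> \<mu> (\<lambda>\<omega>. \<omega> 1) = \<mu>"
    using coord[of 1] distr_cong[OF refl Q.sets_\<mu>, of \<nu> "\<lambda>\<omega>. \<omega> 1" "\<lambda>\<omega>. \<omega> 1"] next_law
    by (simp_all add: measurable_cong_sets[OF refl Q.sets_\<mu>])
  have rm: "r v \<in> borel_measurable \<mu>" for v
    using r(1) by (simp add: measurable_cong_sets[OF Q.sets_\<mu> refl])
  have joint: "measure \<nu> {\<omega> \<in> space \<nu>. f (\<omega> 0) = v \<and> \<omega> 1 \<in> A} = (\<integral>y. r v y * indicator A y \<partial>\<mu>)"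
    if "A \<in> sets \<mu>" for v A
  proof -
    have A: "A \<in> sets (borel_on X)" using that by (simp add: Q.sets_\<mu>)
    have "f -` {v} \<inter> X \<in> sets (borel_on X)" using simple_functionD(2)[OF f(1)] by simp
    then have rect: "(f -` {v} \<inter> X) \<times> A \<in> sets (borel_on (X \<times> X))"
      unfolding sets_XX using A by simp
    have "{\<omega> \<in> space \<nu>. f (\<omega> 0) = v \<and> \<omega> 1 \<in> A} = p2 -` ((f -` {v} \<inter> X) \<times> A) \<inter> space \<nu>"
      by (auto simp: p2_def sp orbit_space_def)
    then have "measure \<nu> {\<omega> \<in> space \<nu>. f (\<omega> 0) = v \<and> \<omega> 1 \<in> A} = measure P ((f -` {v} \<inter> X) \<times> A)"
      unfolding P_def by (simp add: measure_distr[OF p2m rect])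
    also have "\<dots> = enn2real (\<integral>\<^sup>+y. ennreal (r v y * indicator A y) \<partial>\<mu>)"
      unfolding measure_def r(3)[OF A] using r(2)
      by (intro arg_cong[where f=enn2real] nn_integral_cong) (auto simp: Q.space_\<mu> indicator_def)
    also have "\<dots> = (\<integral>y. r v y * indicator A y \<partial>\<mu>)"
      using rm that r(2) by (intro integral_eq_nn_integral[symmetric]) (auto simp: Q.space_\<mu> intro!: AE_I2)
    finally show ?thesis .
  qed
  have "entropy_rate \<nu> orbit_shift ?f \<le> point_cond_entropy \<mu> (?f ` \<Omega>) r"
  proof (rule field_le_epsilon)
    fix e :: real assume "0 < e"
    obtain c :: "'a \<Rightarrow> nat \<Rightarrow> int" where c: "simple_function \<mu> c"
      "cond_entropy \<nu> ?f (\<lambda>\<omega>. c (\<omega> 1)) \<le> point_cond_entropy \<mu> (?f ` space \<nu>) r + e"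
    proof (rule \<nu>.ex_cond_entropy_le_point[OF sf Y, where r=r and e=e])
      show "0 \<le> r v y \<and> r v y \<le> 1" if "y \<in> space \<mu>" for v y
        using r(2)[of y v] that by (simp add: Q.space_\<mu>)
      show "measure \<nu> {\<omega> \<in> space \<nu>. f (\<omega> 0) = v \<and> \<omega> 1 \<in> A} = (\<integral>y. r v y * indicator A y \<partial>\<mu>)"
        if "A \<in> sets \<mu>" for v A by (rule joint[OF that])
    qed (rule rm \<open>0 < e\<close> that; assumption?)+
    have "(\<lambda>\<omega>. \<omega> 0) \<in> \<nu> \<rightarrow>\<^sub>M \<mu>"
      using coord[of 0] by (simp add: measurable_cong_sets[OF refl Q.sets_\<mu>])
    from simple_function_comp[OF this c(1)]
    have "entropy_rate \<nu> orbit_shift ?f \<le> cond_entropy \<nu> ?f (\<lambda>\<omega>. c (orbit_shift \<omega> 0))"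
      by (intro entropy_rate_le_cond_entropy_coordinate[OF \<nu> f(1)] f(2))
    then show "entropy_rate \<nu> orbit_shift ?f \<le> point_cond_entropy \<mu> (?f ` \<Omega>) r + e"
      using c(2) by (simp add: orbit_shift_def sp)
  qed
  also have "\<dots> \<le> entropy_rate (markov_measure X T \<mu> Q) orbit_shift ?f"
    by (rule Q.point_cond_entropy_le_entropy_rate[OF f(1) r(1,2)]) (simp_all add: PL r(3))
  finally have le: "entropy_rate \<nu> orbit_shift ?f \<le> entropy_rate (markov_measure X T \<mu> Q) orbit_shift ?f" .
  have "ks_entropy \<nu> orbit_shift = ereal (entropy_rate \<nu> orbit_shift ?f)"
    by (rule ks_entropy_eq_entropy_rate[OF \<nu> f(1)]) (rule f(2))
  also have "\<dots> \<le> ereal (entropy_rate (markov_measure X T \<mu> Q) orbit_shift ?f)"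
    using le by simp
  also have "\<dots> \<le> kernel_entropy X \<mu> Q" by (rule Q.entropy_rate_le_kernel_entropy[OF f(1)])
  finally have "ks_entropy \<nu> orbit_shift \<le> kernel_entropy X \<mu> Q" .
  with Q marg show ?thesis by blast
qed

lemma markov_measure_properties:
  assumes Q: "Q \<in> kernels X T" and \<mu>: "\<mu> \<in> stationary_probs X Q"
  shows "markov_measure X T \<mu> Q \<in> invariant_probs \<Omega> orbit_shift"
    and "distr (markov_measure X T \<mu> Q) (borel_on (corr_graph X T)) p2 = graph_measure X T \<mu> Q"
    and "ks_entropy (markov_measure X T \<mu> Q) orbit_shift = kernel_entropy X \<mu> Q"
proof -
  interpret Q: stationary_markov X T Q \<mu>
    using compact_space corr Q \<mu> by unfold_locales
  show inv: "markov_measure X T \<mu> Q \<in> invariant_probs \<Omega> orbit_shift" by (rule Q.\<nu>_invariant)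
  show "distr (markov_measure X T \<mu> Q) (borel_on (corr_graph X T)) p2 = graph_measure X T \<mu> Q"
    using distr_p2_corr_graph[OF compact_space corr Q.sets_\<nu> Q.sets_pair_law Q.distr_\<nu>_p2]
    by (simp add: graph_measure_def Q.pair_law_def)
  obtain f :: "'a \<Rightarrow> nat" where f': "simple_function (borel_on X) f"
    "\<forall>x\<in>X. \<forall>y\<in>X. f x = f y \<longrightarrow> dist x y \<le> e0"
    by (rule ex_small_partition[OF compact_space e0])
  have f: "simple_function (borel_on X) f" "x \<in> X \<Longrightarrow> y \<in> X \<Longrightarrow> f x = f y \<Longrightarrow> dist x y \<le> e0" for x y
    using f' by blast+
  show "ks_entropy (markov_measure X T \<mu> Q) orbit_shift = kernel_entropy X \<mu> Q"
  proof (rule antisym)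
    show "ks_entropy (markov_measure X T \<mu> Q) orbit_shift \<le> kernel_entropy X \<mu> Q"
    proof -
      have "ks_entropy (markov_measure X T \<mu> Q) orbit_shift
          = ereal (entropy_rate (markov_measure X T \<mu> Q) orbit_shift (\<lambda>\<omega>. f (\<omega> 0)))"
        by (rule ks_entropy_eq_entropy_rate[OF inv f(1)]) (rule f(2))
      then show ?thesis using Q.entropy_rate_le_kernel_entropy[OF f(1)] by simp
    qed
  qed (rule Q.kernel_entropy_le_ks_entropy)
qed

end

theorem proposition3p2:
  fixes X :: "'a::metric_space set" and T :: "'a \<Rightarrow> 'a set"
  assumes "compact X" and "correspondence X T" and "forward_expansive X T"
  shows "(\<forall>\<nu> \<in> invariant_probs (orbit_space X T) orbit_shift.
           \<exists>Q \<in> kernels X T. \<exists>\<mu> \<in> stationary_probs X Q.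
             distr \<nu> (borel_on (corr_graph X T)) p2 = graph_measure X T \<mu> Q \<and>
             ks_entropy \<nu> orbit_shift \<le> kernel_entropy X \<mu> Q) \<and>
         (\<forall>Q \<in> kernels X T. \<forall>\<mu> \<in> stationary_probs X Q.
             markov_measure X T \<mu> Q \<in> invariant_probs (orbit_space X T) orbit_shift \<and>
             distr (markov_measure X T \<mu> Q) (borel_on (corr_graph X T)) p2 = graph_measure X T \<mu> Q \<and>
             ks_entropy (markov_measure X T \<mu> Q) orbit_shift = kernel_entropy X \<mu> Q)"
proof -
  obtain e0 where e0: "0 < e0" "\<And>x y. x \<in> orbit_space X T \<Longrightarrow> y \<in> orbit_space X T \<Longrightarrow> x \<noteq> y \<Longrightarrow>
      \<exists>j. dist (x j) (y j) > e0"
    using assms(3) unfolding forward_expansive_def by blast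
  interpret expansive_correspondence X T e0
  proof
    show "x = y" if "x \<in> orbit_space X T" "y \<in> orbit_space X T" "\<And>j. dist (x j) (y j) \<le> e0" for x y
      using e0(2)[OF that(1,2)] that(3) by (auto simp: not_less[symmetric])
  qed (use assms(1,2) e0(1) in auto)
  show ?thesis
    by (intro conjI ballI ex_kernel_entropy_ge markov_measure_properties)
qed

end
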